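(* Let $F\supseteq\mathbb{Q}(\zeta_\infty)$ be a field, and let $\tilde\chi\in X_{\overline{F}}$. Denote the image of $\tilde\chi$ in $X_F$ by $\chi$, and let $\varepsilon\in\mathrm{Ext}(\overline{F}^\times,\mathbb{Z})$ be the pullback of the class of the extension $0\to\mathbb{Z}\to\mathbb{R}\to\mathbb{S}^1\to 0$ in $\mathrm{Ext}(\mathbb{S}^1,\mathbb{Z})$ along $\tilde\chi\colon\overline{F}^\times\to\mathbb{S}^1$. (It lies in $\mathrm{Ext}_{\exp}(\overline{F}^\times,\mathbb{Z})$.) Then $\pi_1^{\mathrm{path}}(X_F,\chi)$ is canonically isomorphic to the stabiliser of $\varepsilon$ in $\mathrm{Gal}(\overline{F}/F)$.
   Context: $\mathbb{Q}(\zeta_\infty)\subset\mathbb{C}$ is the field generated by all complex roots of unity; $\mu_\infty$ is the group of all roots of unity; $\mathbb{S}^1\subset\mathbb{C}^\times$ is the unit circle, and $\mathbb{R}\to\mathbb{S}^1$ is $t\mapsto e^{2\pi it}$. Let $\overline{F}$ be an algebraic closure of $F$, with $\overline{F}^\times$ discrete. $X_{\overline{F}}=\{\chi\in\mathrm{Hom}(\overline{F}^\times,\mathbb{S}^1)\mid\chi|_{\mu_\infty}\text{ is the inclusion }\mu_\infty\subset\mathbb{S}^1\}$ with the compact-open topology; $G=\mathrm{Gal}(\overline{F}/F)$ acts freely on it by $\sigma(\chi)=\chi\circ\sigma^{-1}$, and $X_F=G\backslash X_{\overline{F}}$ with the quotient topology. $\mathrm{Ext}$ is $\mathrm{Ext}^1$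 of abelian groups; $\sigma\in G$ acts on $\mathrm{Ext}(\overline{F}^\times,\mathbb{Z})$ by pullback along $\sigma^{-1}$. $\mathrm{Ext}_{\exp}(\overline{F}^\times,\mathbb{Z})$ is the subset of classes whose restriction to $\mu_\infty$ is the class of $0\to\mathbb{Z}\to\mathbb{Q}\to\mu_\infty\to 0$, where $\mathbb{Q}\to\mu_\infty$ is $x\mapsto e^{2\pi ix}$. $\pi_1^{\mathrm{path}}$ is the classical fundamental group of homotopy classes of loops, with $\gamma*\delta$ meaning "first $\delta$, then $\gamma$". The canonical isomorphism is monodromy: a loop $\gamma$ at $\chi$ lifts uniquely to a path $\tilde\gamma$ in $X_{\overline{F}}$ with $\tilde\gamma(0)=\tilde\chi$; if $\tilde\gamma(1)=\sigma_\gamma(\tilde\chi)$ with $\sigma_\gamma\in G$, then $[\gamma]\mapsto\sigma_\gamma^{-1}$. *)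

theory Defs
  imports "HOL-Analysis.Analysis" "HOL-Algebra.Algebra" "HOL-Algebra.Algebraic_Closure_Type"
begin

(* frees X as a variable name *)
no_notation var (\<open>X\<index>\<close>)

section \<open>Topology\<close>

definition quotient_topology :: "'a topology \<Rightarrow> ('a \<Rightarrow> 'b) \<Rightarrow> 'b topology" where
  "quotient_topology X q =
     topology (\<lambda>U. U \<subseteq> q ` topspace X \<and> openin X {x \<in> topspace X. q x \<in> U})"

lemma openin_quotient_topology:
  "openin (quotient_topology X q) U \<longleftrightarrow>
     U \<subseteq> q ` topspace X \<and> openin X {x \<in> topspace X. q x \<in> U}"
proof -
  have "istopology (\<lambda>U. U \<subseteq> q ` topspace X \<and> openin X {x \<in> topspace X. q x \<in> U})"
    unfolding istopology_def
  proof (intro conjI allI impI)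
    fix S T
    assume "S \<subseteq> q ` topspace X \<and> openin X {x \<in> topspace X. q x \<in> S}"
      and "T \<subseteq> q ` topspace X \<and> openin X {x \<in> topspace X. q x \<in> T}"
    moreover have "{x \<in> topspace X. q x \<in> S \<inter> T} =
        {x \<in> topspace X. q x \<in> S} \<inter> {x \<in> topspace X. q x \<in> T}" by auto
    ultimately show "S \<inter> T \<subseteq> q ` topspace X" "openin X {x \<in> topspace X. q x \<in> S \<inter> T}"
      by (auto simp: openin_Int)
  next
    fix K
    assume K: "\<forall>U\<in>K. U \<subseteq> q ` topspace X \<and> openin X {x \<in> topspace X. q x \<in> U}"
    then show "\<Union>K \<subseteq> q ` topspace X" by blast
    have "{x \<in> topspace X. q x \<in> \<Union>K} = (\<Union>U\<in>K. {x \<in> topspace X. q x \<in> U})" by auto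
    with K show "openin X {x \<in> topspace X. q x \<in> \<Union>K}" by auto
  qed
  then show ?thesis by (simp add: quotient_topology_def topology_inverse')
qed

lemma topspace_quotient_topology: "topspace (quotient_topology X q) = q ` topspace X"
proof
  show "topspace (quotient_topology X q) \<subseteq> q ` topspace X"
    by (auto simp: topspace_def openin_quotient_topology)
  have "{x \<in> topspace X. q x \<in> q ` topspace X} = topspace X" by auto
  then have "openin (quotient_topology X q) (q ` topspace X)"
    by (simp add: openin_quotient_topology)
  then show "q ` topspace X \<subseteq> topspace (quotient_topology X q)" by (rule openin_subset)
qed

lemma quotient_map_quotient_topology: "quotient_map X (quotient_topology X q) q"
  by (auto simp: quotient_map_def openin_quotient_topology topspace_quotient_topology)

definition compact_open_topology :: "'a topology \<Rightarrow> 'b topology \<Rightarrow> ('a \<Rightarrow> 'b) topology" where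
  "compact_open_topology X Y =
     topology_generated_by
       {{f \<in> extensional (topspace X). continuous_map X Y f \<and> f ` K \<subseteq> U} | K U.
          compactin X K \<and> openin Y U}"


subsection \<open>The fundamental group\<close>

definition loops :: "'a topology \<Rightarrow> 'a \<Rightarrow> (real \<Rightarrow> 'a) set" where
  "loops X x = {\<gamma>. pathin X \<gamma> \<and> \<gamma> 0 = x \<and> \<gamma> 1 = x}"

text \<open>
  Loops are functions on all of \<open>real\<close>; their values outside the unit interval are irrelevant
  to \<open>homotopic_with\<close>, so that loops agreeing on the unit interval are in the same class.
\<close>

definition loop_class :: "'a topology \<Rightarrow> 'a \<Rightarrow> (real \<Rightarrow> 'a) \<Rightarrow> (real \<Rightarrow> 'a) set" where
  "loop_class X x \<gamma> =
     {\<delta> \<in> loops X x. homotopic_with (\<lambda>p. p 0 = x \<and> p 1 = x) (top_of_set {0..1}) X \<gamma> \<delta>}"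

text \<open>
  The library operation \<open>+++\<close> is restricted to types of class \<open>topological_space\<close>. Here the second
  argument is traversed first.
\<close>

definition loop_comp :: "(real \<Rightarrow> 'a) \<Rightarrow> (real \<Rightarrow> 'a) \<Rightarrow> real \<Rightarrow> 'a" where
  "loop_comp \<gamma> \<delta> = (\<lambda>t. if t \<le> 1/2 then \<delta> (2 * t) else \<gamma> (2 * t - 1))"

definition fundamental_group :: "'a topology \<Rightarrow> 'a \<Rightarrow> (real \<Rightarrow> 'a) set monoid" where
  "fundamental_group X x =
     \<lparr>carrier = loop_class X x ` loops X x,
      monoid.mult = (\<lambda>c d. \<Union>\<gamma>\<in>c. \<Union>\<delta>\<in>d. loop_class X x (loop_comp \<gamma> \<delta>)),
      one = loop_class X x (\<lambda>_. x)\<rparr>"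


section \<open>Extensions of abelian groups\<close>

record ('e, 'b, 'a) group_extension =
  middle :: "'e monoid"
  incl :: "'b \<Rightarrow> 'e"
  proj :: "'e \<Rightarrow> 'a"

definition is_extension ::
  "('a, 'm) monoid_scheme \<Rightarrow> ('b, 'n) monoid_scheme \<Rightarrow> ('e, 'b, 'a) group_extension \<Rightarrow> bool" where
  "is_extension A B X \<longleftrightarrow>
     comm_group (middle X) \<and>
     incl X \<in> hom B (middle X) \<and> inj_on (incl X) (carrier B) \<and>
     proj X \<in> hom (middle X) A \<and> proj X ` carrier (middle X) = carrier A \<and>
     incl X ` carrier B = kernel (middle X) A (proj X)"

definition ext_equiv ::
  "('b, 'n) monoid_scheme \<Rightarrow> ('e, 'b, 'a) group_extension \<Rightarrow> ('f, 'b, 'a) group_extension \<Rightarrow> bool"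
  where
  "ext_equiv B X Y \<longleftrightarrow>
     (\<exists>h \<in> iso (middle X) (middle Y).
        (\<forall>b \<in> carrier B. h (incl X b) = incl Y b) \<and>
        (\<forall>e \<in> carrier (middle X). proj Y (h e) = proj X e))"

text \<open>
  The middle group of any extension of \<open>A\<close> by \<open>B\<close> is in bijection with \<open>A \<times> B\<close> (choose a
  set-theoretic section). So every extension, on whatever type it lives, is equivalent to one whose
  middle group lives on the type \<open>'a \<times> 'b\<close>, and its class is recorded as the set of these.
\<close>

definition ext_class ::
  "('a, 'm) monoid_scheme \<Rightarrow> ('b, 'n) monoid_scheme \<Rightarrow> ('e, 'b, 'a) group_extension \<Rightarrow>
     ('a \<times> 'b, 'b, 'a) group_extension set" where
  "ext_class A B X = {Y. is_extension A B Y \<and> ext_equiv B X Y}"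

definition Ext ::
  "('a, 'm) monoid_scheme \<Rightarrow> ('b, 'n) monoid_scheme \<Rightarrow>
     ('a \<times> 'b, 'b, 'a) group_extension set set" where
  "Ext A B = {ext_class A B X | X :: ('a \<times> 'b, 'b, 'a) group_extension. is_extension A B X}"

definition pullback_extension ::
  "('c, 'k) monoid_scheme \<Rightarrow> ('c \<Rightarrow> 'a) \<Rightarrow> ('e, 'b, 'a) group_extension \<Rightarrow>
     ('e \<times> 'c, 'b, 'c) group_extension" where
  "pullback_extension C f X =
     \<lparr>middle = (middle X \<times>\<times> C)
        \<lparr>carrier := {(e, c). e \<in> carrier (middle X) \<and> c \<in> carrier C \<and> proj X e = f c}\<rparr>,
      incl = (\<lambda>b. (incl X b, \<one>\<^bsub>C\<^esub>)),
      proj = snd\<rparr>"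

definition ext_pullback ::
  "('c, 'k) monoid_scheme \<Rightarrow> ('b, 'n) monoid_scheme \<Rightarrow> ('c \<Rightarrow> 'a) \<Rightarrow>
     ('a \<times> 'b, 'b, 'a) group_extension set \<Rightarrow> ('c \<times> 'b, 'b, 'c) group_extension set" where
  "ext_pullback C B f \<xi> = (\<Union>X\<in>\<xi>. ext_class C B (pullback_extension C f X))"

lemma ext_equiv_sym:
  assumes "is_extension A B X" "is_extension A B Y" "ext_equiv B X Y"
  shows "ext_equiv B Y X"
proof -
  interpret X: comm_group "middle X" using assms by (simp add: is_extension_def)
  obtain h where h: "h \<in> iso (middle X) (middle Y)"
    and hi: "\<And>b. b \<in> carrier B \<Longrightarrow> h (incl X b) = incl Y b"
    and hp: "\<And>e. e \<in> carrier (middle X) \<Longrightarrow> proj Y (h e) = proj X e"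
    using assms(3) by (auto simp: ext_equiv_def)
  have bij: "bij_betw h (carrier (middle X)) (carrier (middle Y))"
    using h by (simp add: iso_def)
  let ?k = "inv_into (carrier (middle X)) h"
  have "?k \<in> iso (middle Y) (middle X)" using h by (rule X.iso_set_sym)
  moreover have "?k (incl Y b) = incl X b" if "b \<in> carrier B" for b
  proof -
    have "incl X b \<in> carrier (middle X)"
      using assms(1) that by (auto simp: is_extension_def hom_def)
    then show ?thesis using hi[OF that] bij by (metis bij_betw_inv_into_left)
  qed
  moreover have "proj X (?k e) = proj Y e" if "e \<in> carrier (middle Y)" for e
  proof -
    have "?k e \<in> carrier (middle X)"
      using bij that by (meson bij_betwE bij_betw_inv_into)
    from hp[OF this] show ?thesis using bij that by (simp add: bij_betw_inv_into_right)
  qed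
  ultimately show ?thesis by (auto simp: ext_equiv_def)
qed

lemma ext_equiv_trans:
  assumes "ext_equiv B X Y" "ext_equiv B Y Z"
  shows "ext_equiv B X Z"
proof -
  obtain h where h: "h \<in> iso (middle X) (middle Y)"
    "\<And>b. b \<in> carrier B \<Longrightarrow> h (incl X b) = incl Y b"
    "\<And>e. e \<in> carrier (middle X) \<Longrightarrow> proj Y (h e) = proj X e"
    using assms(1) by (auto simp: ext_equiv_def)
  obtain k where k: "k \<in> iso (middle Y) (middle Z)"
    "\<And>b. b \<in> carrier B \<Longrightarrow> k (incl Y b) = incl Z b"
    "\<And>e. e \<in> carrier (middle Y) \<Longrightarrow> proj Z (k e) = proj Y e"
    using assms(2) by (auto simp: ext_equiv_def)
  have "k \<circ> h \<in> iso (middle X) (middle Z)" using h(1) k(1) by (rule iso_set_trans)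
  moreover have "h e \<in> carrier (middle Y)" if "e \<in> carrier (middle X)" for e
    using h(1) that by (auto simp: iso_def hom_def)
  ultimately show ?thesis
    unfolding ext_equiv_def using h k by (intro bexI[of _ "k \<circ> h"]) auto
qed

lemma ext_class_nonempty:
  fixes A :: "('a, 'm) monoid_scheme" and B :: "('b, 'n) monoid_scheme"
    and X :: "('e, 'b, 'a) group_extension"
  assumes A: "group A" and B: "group B" and X: "is_extension A B X"
  shows "ext_class A B X \<noteq> {}"
proof -
  interpret X: comm_group "middle X" using X by (simp add: is_extension_def)
  interpret p: group_hom "middle X" A "proj X"
    using X A by (simp add: is_extension_def group_hom_def group_hom_axioms_def X.is_group)
  have i_closed: "\<And>b. b \<in> carrier B \<Longrightarrow> incl X b \<in> carrier (middle X)"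
    using X by (auto simp: is_extension_def hom_def)
  define s where "s a = (SOME e. e \<in> carrier (middle X) \<and> proj X e = a)" for a
  have s: "s a \<in> carrier (middle X) \<and> proj X (s a) = a" if "a \<in> carrier A" for a
  proof -
    have "a \<in> proj X ` carrier (middle X)" using X that by (simp add: is_extension_def)
    then have "\<exists>e. e \<in> carrier (middle X) \<and> proj X e = a" by blast
    then show ?thesis unfolding s_def by (rule someI_ex)
  qed
  define d where "d e = e \<otimes>\<^bsub>middle X\<^esub> inv\<^bsub>middle X\<^esub> (s (proj X e))" for e
  have d_im: "d e \<in> incl X ` carrier B" if e: "e \<in> carrier (middle X)" for e
  proof -
    have "d e \<in> kernel (middle X) A (proj X)"
      using s[of "proj X e"] e by (simp add: d_def kernel_def)
    then show ?thesis using X by (simp add: is_extension_def)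
  qed
  define f where "f e = (proj X e, inv_into (carrier B) (incl X) (d e))" for e
  have inj: "inj_on f (carrier (middle X))"
  proof (rule inj_onI)
    fix e e' assume e: "e \<in> carrier (middle X)" "e' \<in> carrier (middle X)" "f e = f e'"
    then have p: "proj X e = proj X e'" by (simp add: f_def)
    have "inv_into (carrier B) (incl X) (d e) = inv_into (carrier B) (incl X) (d e')"
      using e(3) by (simp add: f_def)
    then have "d e = d e'"
      by (rule inv_into_injective) (use d_im e(1,2) in auto)
    moreover have "inv\<^bsub>middle X\<^esub> (s (proj X e)) \<in> carrier (middle X)"
      using s[OF p.hom_closed[OF e(1)]] by simp
    ultimately show "e = e'"
      using e(1,2) unfolding d_def p by (metis X.right_cancel)
  qed
  define g where "g = inv_into (carrier (middle X)) f"
  define Y :: "('a \<times> 'b, 'b, 'a) group_extension" where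
    "Y = \<lparr>middle = image_group f (middle X), incl = f \<circ> incl X, proj = proj X \<circ> g\<rparr>"
  have g: "g (f e) = e" if "e \<in> carrier (middle X)" for e
    using inj that by (simp add: g_def)
  have car: "carrier (middle Y) = f ` carrier (middle X)"
    by (simp add: Y_def image_group_carrier)
  have pY: "proj Y (f e) = proj X e" if "e \<in> carrier (middle X)" for e
    using g[OF that] by (simp add: Y_def)
  have mult: "f e \<otimes>\<^bsub>middle Y\<^esub> f e' = f (e \<otimes>\<^bsub>middle X\<^esub> e')"
    if "e \<in> carrier (middle X)" "e' \<in> carrier (middle X)" for e e'
    using g that by (simp add: Y_def image_group_def g_def[symmetric])
  have iso: "f \<in> iso (middle X) (middle Y)"
    using inj by (auto simp: iso_def hom_def bij_betw_def car mult)
  have one: "\<one>\<^bsub>middle Y\<^esub> = f \<one>\<^bsub>middle X\<^esub>" by (simp add: Y_def image_group_one)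
  have cg: "comm_group (middle Y)"
  proof -
    interpret Y: group "middle Y"
      using X.inj_imp_image_group_is_group[OF inj] by (simp add: Y_def)
    show ?thesis
    proof (rule Y.group_comm_groupI)
      fix x y assume "x \<in> carrier (middle Y)" "y \<in> carrier (middle Y)"
      then obtain e e' where "e \<in> carrier (middle X)" "e' \<in> carrier (middle X)" "x = f e" "y = f e'"
        unfolding car by blast
      then show "x \<otimes>\<^bsub>middle Y\<^esub> y = y \<otimes>\<^bsub>middle Y\<^esub> x"
        by (simp add: mult X.m_comm)
    qed
  qed
  have incl: "incl Y \<in> hom B (middle Y)"
    using X i_closed by (auto simp: Y_def hom_def is_extension_def image_group_carrier
        image_group_def g simp flip: g_def)
  have inj_incl: "inj_on (incl Y) (carrier B)"
    unfolding Y_def using X inj i_closed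
    by (auto simp: is_extension_def intro!: comp_inj_on intro: inj_on_subset)
  have proj: "proj Y \<in> hom (middle Y) A"
    unfolding hom_def by (auto simp: car mult pY)
  have surj: "proj Y ` carrier (middle Y) = carrier A"
  proof -
    have "proj Y ` carrier (middle Y) = proj X ` carrier (middle X)"
      by (force simp: car pY image_image)
    then show ?thesis using X by (simp add: is_extension_def)
  qed
  have ker: "incl Y ` carrier B = kernel (middle Y) A (proj Y)"
  proof -
    have "kernel (middle Y) A (proj Y) = f ` kernel (middle X) A (proj X)"
      by (auto simp: kernel_def car pY)
    also have "\<dots> = f ` incl X ` carrier B" using X by (simp add: is_extension_def)
    also have "\<dots> = incl Y ` carrier B" by (simp add: Y_def image_comp)
    finally show ?thesis by simp
  qed
  have "is_extension A B Y"
    using cg incl inj_incl proj surj ker by (simp add: is_extension_def)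
  moreover have "ext_equiv B X Y"
    unfolding ext_equiv_def using iso by (intro bexI[of _ f]) (auto simp: Y_def g)
  ultimately show ?thesis by (auto simp: ext_class_def)
qed

lemma ext_class_eq_iff:
  fixes A :: "('a, 'm) monoid_scheme" and B :: "('b, 'n) monoid_scheme"
  assumes "group A" "group B" "is_extension A B X" "is_extension A B Y"
  shows "ext_class A B X = ext_class A B Y \<longleftrightarrow> ext_equiv B X Y"
proof
  assume eq: "ext_class A B X = ext_class A B Y"
  obtain Z where Z: "Z \<in> ext_class A B X" using ext_class_nonempty assms by blast
  then have "ext_equiv B X Z" "ext_equiv B Y Z" "is_extension A B Z"
    using eq by (auto simp: ext_class_def)
  then show "ext_equiv B X Y" using assms ext_equiv_sym ext_equiv_trans by blast
next
  assume XY: "ext_equiv B X Y"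
  then have "ext_equiv B Y X" using assms ext_equiv_sym by blast
  then have "ext_equiv B X Z \<longleftrightarrow> ext_equiv B Y Z" for Z :: "('a \<times> 'b, 'b, 'a) group_extension"
    using XY ext_equiv_trans by metis
  then show "ext_class A B X = ext_class A B Y" by (simp add: ext_class_def)
qed


section \<open>The circle and the roots of unity\<close>

definition circle_group :: "complex monoid" where
  "circle_group = \<lparr>carrier = sphere 0 1, monoid.mult = (*), one = 1\<rparr>"

definition roots_of_unity_group :: "complex monoid" where
  "roots_of_unity_group = circle_group\<lparr>carrier := {z. \<exists>n>0. z ^ n = 1}\<rparr>"

definition additive_group :: "'a::ab_group_add monoid" where
  "additive_group = \<lparr>carrier = UNIV, monoid.mult = (+), one = 0\<rparr>"

text \<open>The extensions of the circle by \<open>\<int>\<close> with middle group \<open>\<real>\<close>, and of the group of roots of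
  unity by \<open>\<int>\<close> with middle group \<open>\<rat>\<close>.\<close>

definition real_extension :: "(real, int, complex) group_extension" where
  "real_extension =
     \<lparr>middle = additive_group, incl = of_int, proj = (\<lambda>t. cis (2 * pi * t))\<rparr>"

definition rat_extension :: "(rat, int, complex) group_extension" where
  "rat_extension =
     \<lparr>middle = additive_group, incl = of_int, proj = (\<lambda>x. cis (2 * pi * of_rat x))\<rparr>"

text \<open>The subfield of the complex numbers generated by all roots of unity, as a ring.\<close>

definition cyclotomic_field :: "complex ring" where
  "cyclotomic_field = ring_of_type_algebra
     \<lparr>carrier := generate_field ring_of_type_algebra (carrier roots_of_unity_group)\<rparr>"


section \<open>Characters and Galois action\<close>

text \<open>
  Throughout, the algebraic closure of a field \<open>F\<close> is the whole of a type \<open>'a\<close> and \<open>F\<close> is a subset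
  of it. The inclusion of the cyclotomic field into \<open>F\<close> is an embedding \<open>\<iota>\<close>, via which complex roots
  of unity are regarded as elements of \<open>'a\<close>.
\<close>

definition units_group :: "'a::field monoid" where
  "units_group = mult_of ring_of_type_algebra"

definition galois_group :: "'a::field set \<Rightarrow> ('a \<Rightarrow> 'a) monoid" where
  "galois_group F =
     \<lparr>carrier = {\<sigma> \<in> ring_iso ring_of_type_algebra ring_of_type_algebra. \<forall>x\<in>F. \<sigma> x = x},
      monoid.mult = (\<circ>), one = id\<rparr>"

definition characters :: "(complex \<Rightarrow> 'a::field) \<Rightarrow> ('a \<Rightarrow> complex) set" where
  "characters \<iota> =
     {chi \<in> hom units_group circle_group \<inter> extensional (carrier units_group).
        \<forall>\<zeta> \<in> carrier roots_of_unity_group. chi (\<iota> \<zeta>) = \<zeta>}"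

definition character_space :: "(complex \<Rightarrow> 'a::field) \<Rightarrow> ('a \<Rightarrow> complex) topology" where
  "character_space \<iota> =
     subtopology
       (compact_open_topology (discrete_topology (carrier (units_group :: 'a monoid)))
                              (top_of_set (carrier circle_group)))
       (characters \<iota>)"

text \<open>Since \<open>\<sigma>\<close> fixes \<open>0\<close>, this preserves extensionality.\<close>

definition act_char :: "('a::field \<Rightarrow> 'a) \<Rightarrow> ('a \<Rightarrow> complex) \<Rightarrow> 'a \<Rightarrow> complex" where
  "act_char \<sigma> chi = chi \<circ> inv_into UNIV \<sigma>"

definition char_orbit :: "'a::field set \<Rightarrow> ('a \<Rightarrow> complex) \<Rightarrow> ('a \<Rightarrow> complex) set" where
  "char_orbit F chi = orbit (galois_group F) act_char chi"

definition orbit_space ::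
  "'a::field set \<Rightarrow> (complex \<Rightarrow> 'a) \<Rightarrow> ('a \<Rightarrow> complex) set topology" where
  "orbit_space F \<iota> = quotient_topology (character_space \<iota>) (char_orbit F)"

definition act_ext ::
  "('a::field \<Rightarrow> 'a) \<Rightarrow> ('a \<times> int, int, 'a) group_extension set \<Rightarrow>
     ('a \<times> int, int, 'a) group_extension set" where
  "act_ext \<sigma> \<xi> = ext_pullback units_group integer_group (inv_into UNIV \<sigma>) \<xi>"

definition Ext_exp :: "(complex \<Rightarrow> 'a::field) \<Rightarrow> ('a \<times> int, int, 'a) group_extension set set" where
  "Ext_exp \<iota> =
     {\<xi> \<in> Ext units_group integer_group.
        ext_pullback roots_of_unity_group integer_group \<iota> \<xi> =
        ext_class roots_of_unity_group integer_group rat_extension}"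

definition char_ext :: "('a::field \<Rightarrow> complex) \<Rightarrow> ('a \<times> int, int, 'a) group_extension set" where
  "char_ext chi =
     ext_pullback units_group integer_group chi
       (ext_class circle_group integer_group real_extension)"

definition is_lift ::
  "'a::field set \<Rightarrow> (complex \<Rightarrow> 'a) \<Rightarrow> ('a \<Rightarrow> complex) \<Rightarrow>
     (real \<Rightarrow> ('a \<Rightarrow> complex) set) \<Rightarrow> (real \<Rightarrow> 'a \<Rightarrow> complex) \<Rightarrow> bool" where
  "is_lift F \<iota> chi \<gamma> g \<longleftrightarrow>
     pathin (character_space \<iota>) g \<and> g 0 = chi \<and> (\<forall>t\<in>{0..1}. char_orbit F (g t) = \<gamma> t)"

end

theory Submission
  imports Defs
begin

text \<open>
  A Galois automorphism that moves some \<open>x\<close> multiplies one of the finitely many Lagrange resolvents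
  of \<open>x\<close> by a root of unity \<open>\<zeta> \<noteq> 1\<close>, because \<open>F\<close> contains the roots of unity. A character is the
  identity on roots of unity, so it changes by the factor \<open>\<zeta>\<close> at that resolvent. Hence the Galois
  group acts freely, and two characters in the same orbit that are close at the resolvents of \<open>x\<close>
  differ by an automorphism fixing \<open>x\<close>. A map from a compact convex set to the orbit space is
  lifted modulo the stabiliser of a finite set by chaining along segments; these lifts are unique
  and fit together to a lift to the character space.

  A path of characters starting at \<open>\<chi>\<close> is uniquely of the form \<open>\<chi> \<cdot> exp (2 \<pi> i a\<^sub>t)\<close> with \<open>a\<^sub>t\<close>
  additive and \<open>a\<^sub>0 = 0\<close>. So \<open>\<chi>\<close> and \<open>\<sigma> \<chi>\<close> are joined by a path iff they differ by \<open>exp (2 \<pi> i h)\<close>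
  for an additive \<open>h\<close>, which is the condition for \<open>\<sigma>\<close> to fix the extension class of \<open>\<chi>\<close>; and paths
  with the same endpoints are homotopic by joining their logarithms with line segments.
\<close>

section \<open>Pullbacks of extensions\<close>

text \<open>When the Galois group is infinite, its orbits of characters are not discrete, so the
  orbit map is not a covering and the usual path lifting does not apply. What survives is
  discreteness modulo the stabiliser of a finite set: there, closeness at finitely many elements
  forces equality within an orbit. This is why lifts are built at finite levels first. Compact
  convex sets are the common generality for paths (interval) and homotopies (square). That a path of
  characters has additive logarithms is no matter of choice: the defect of additivity is continuous,
  integer-valued and zero at the start. Logarithms are unique because the multiplicative group of an
  algebraically closed field is divisible, so it has no nonzero homomorphism to the integers.
  Monodromy reverses the order of composition, whence the inverse in the isomorphism. Homotopy
  classes turn out to be the fibres of monodromy, so the group axioms for them are transported from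
  the stabiliser.\<close>

lemma is_extensionD:
  assumes "is_extension A B X"
  shows "comm_group (middle X)" "incl X \<in> hom B (middle X)" "inj_on (incl X) (carrier B)"
    "proj X \<in> hom (middle X) A" "proj X ` carrier (middle X) = carrier A"
    "incl X ` carrier B = kernel (middle X) A (proj X)"
  using assms by (auto simp: is_extension_def)

lemma pullback_extension_simps [simp]:
  "carrier (middle (pullback_extension C f X)) =
     {(e, c). e \<in> carrier (middle X) \<and> c \<in> carrier C \<and> proj X e = f c}"
  "(e, c) \<otimes>\<^bsub>middle (pullback_extension C f X)\<^esub> (e', c') = (e \<otimes>\<^bsub>middle X\<^esub> e', c \<otimes>\<^bsub>C\<^esub> c')"
  "\<one>\<^bsub>middle (pullback_extension C f X)\<^esub> = (\<one>\<^bsub>middle X\<^esub>, \<one>\<^bsub>C\<^esub>)"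
  "incl (pullback_extension C f X) b = (incl X b, \<one>\<^bsub>C\<^esub>)"
  "proj (pullback_extension C f X) (e, c) = c"
  by (auto simp: pullback_extension_def)

lemma is_extension_pullback:
  assumes A: "group A" and B: "group B" and C: "comm_group C" and f: "f \<in> hom C A"
    and X: "is_extension A B X"
  shows "is_extension C B (pullback_extension C f X)"
proof -
  note X' = is_extensionD[OF X]
  interpret M: comm_group "middle X" by (fact X')
  interpret A: group A by fact
  interpret B: group B by fact
  interpret C: comm_group C by fact
  interpret p: group_hom "middle X" A "proj X"
    by unfold_locales (use X' in auto)
  interpret f: group_hom C A f
    by unfold_locales (use f in auto)
  interpret i: group_hom B "middle X" "incl X"
    by unfold_locales (use X' in auto)
  have pi: "proj X (incl X b) = \<one>\<^bsub>A\<^esub>" if "b \<in> carrier B" for b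
    using X'(6) that by (auto simp: kernel_def)
  let ?P = "pullback_extension C f X"
  have cg: "comm_group (middle ?P)"
  proof (rule comm_groupI)
    fix x assume "x \<in> carrier (middle ?P)"
    then obtain e c where x: "x = (e, c)" "e \<in> carrier (middle X)" "c \<in> carrier C" "proj X e = f c"
      by auto
    then show "\<exists>y\<in>carrier (middle ?P). y \<otimes>\<^bsub>middle ?P\<^esub> x = \<one>\<^bsub>middle ?P\<^esub>"
      by (intro bexI[of _ "(inv\<^bsub>middle X\<^esub> e, inv\<^bsub>C\<^esub> c)"]) auto
  next
    fix x y assume "x \<in> carrier (middle ?P)" "y \<in> carrier (middle ?P)"
    then show "x \<otimes>\<^bsub>middle ?P\<^esub> y = y \<otimes>\<^bsub>middle ?P\<^esub> x"
      by (auto simp: M.m_comm C.m_comm)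
  qed (auto simp: M.m_assoc C.m_assoc)
  have surj: "proj ?P ` carrier (middle ?P) = carrier C"
  proof
    show "carrier C \<subseteq> proj ?P ` carrier (middle ?P)"
    proof
      fix c assume c: "c \<in> carrier C"
      then have "f c \<in> proj X ` carrier (middle X)" using X'(5) by simp
      then obtain e where "e \<in> carrier (middle X)" "proj X e = f c" by force
      then show "c \<in> proj ?P ` carrier (middle ?P)" using c by (intro image_eqI[of _ _ "(e, c)"]) auto
    qed
  qed auto
  have ker: "incl ?P ` carrier B = kernel (middle ?P) C (proj ?P)"
  proof
    show "incl ?P ` carrier B \<subseteq> kernel (middle ?P) C (proj ?P)"
      by (auto simp: kernel_def pi)
    show "kernel (middle ?P) C (proj ?P) \<subseteq> incl ?P ` carrier B"
    proof
      fix z assume "z \<in> kernel (middle ?P) C (proj ?P)"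
      then obtain e where e: "z = (e, \<one>\<^bsub>C\<^esub>)" "e \<in> carrier (middle X)" "proj X e = \<one>\<^bsub>A\<^esub>"
        by (auto simp: kernel_def)
      then have "e \<in> incl X ` carrier B" by (simp add: X'(6) kernel_def)
      then show "z \<in> incl ?P ` carrier B" using e by auto
    qed
  qed
  show ?thesis
    unfolding is_extension_def
  proof (intro conjI cg surj ker)
    show "incl ?P \<in> hom B (middle ?P)"
      by (auto simp: hom_def pi i.hom_mult)
    show "inj_on (incl ?P) (carrier B)"
      using X'(3) by (auto simp: inj_on_def)
    show "proj ?P \<in> hom (middle ?P) C"
      by (auto simp: hom_def)
  qed
qed

lemma ext_equiv_pullback:
  assumes "ext_equiv B X Y"
  shows "ext_equiv B (pullback_extension C f X) (pullback_extension C f Y)"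
proof -
  obtain h where h: "h \<in> iso (middle X) (middle Y)"
    and hi: "\<And>b. b \<in> carrier B \<Longrightarrow> h (incl X b) = incl Y b"
    and hp: "\<And>e. e \<in> carrier (middle X) \<Longrightarrow> proj Y (h e) = proj X e"
    using assms by (auto simp: ext_equiv_def)
  have bij: "bij_betw h (carrier (middle X)) (carrier (middle Y))"
    using h by (simp add: iso_def)
  then have hc: "\<And>e. e \<in> carrier (middle X) \<Longrightarrow> h e \<in> carrier (middle Y)"
    by (auto simp: bij_betw_def)
  let ?h = "\<lambda>(e, c). (h e, c)"
  have "?h \<in> iso (middle (pullback_extension C f X)) (middle (pullback_extension C f Y))"
  proof (rule isoI)
    show "?h \<in> hom (middle (pullback_extension C f X)) (middle (pullback_extension C f Y))"
      using h by (auto simp: hom_def iso_def hp hc)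
    show "bij_betw ?h (carrier (middle (pullback_extension C f X)))
        (carrier (middle (pullback_extension C f Y)))"
      unfolding bij_betw_def
    proof
      show "inj_on ?h (carrier (middle (pullback_extension C f X)))"
        using bij by (auto simp: inj_on_def bij_betw_def)
      have "\<exists>e'. e' \<in> carrier (middle X) \<and> h e' = e" if "e \<in> carrier (middle Y)" for e
        using bij that unfolding bij_betw_def by (metis imageE)
      then show "?h ` carrier (middle (pullback_extension C f X)) =
          carrier (middle (pullback_extension C f Y))"
        by (force simp: hp hc image_iff)
    qed
  qed
  then show ?thesis
    unfolding ext_equiv_def by (intro bexI[of _ ?h]) (auto simp: hi)
qed

text \<open>\<open>ext_pullback\<close> is a union over all representatives in a class. Equivalent
  representatives have equivalent pullbacks, so all members of the union coincide, and
  \<open>ext_class_nonempty\<close> supplies at least one. \<open>X\<close> itself may live on any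
  type, unlike the representatives.\<close>

lemma ext_pullback_ext_class:
  assumes A: "group A" and B: "group B" and C: "comm_group C" and f: "f \<in> hom C A"
    and X: "is_extension A B X"
  shows "ext_pullback C B f (ext_class A B X) = ext_class C B (pullback_extension C f X)"
proof -
  interpret C: comm_group C by fact
  have "ext_class C B (pullback_extension C f Y) = ext_class C B (pullback_extension C f X)"
    if "Y \<in> ext_class A B X" for Y
  proof -
    have Y: "is_extension A B Y" "ext_equiv B X Y"
      using that by (auto simp: ext_class_def)
    have "ext_class C B (pullback_extension C f X) = ext_class C B (pullback_extension C f Y)"
      by (subst ext_class_eq_iff)
        (use assms Y in \<open>auto intro!: is_extension_pullback ext_equiv_pullback\<close>)
    then show ?thesis by simp
  qed
  moreover have "ext_class A B X \<noteq> {}"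
    using A B X by (rule ext_class_nonempty)
  ultimately show ?thesis by (auto simp: ext_pullback_def)
qed

text \<open>Functoriality of pullback: the iterated fibre product also records the intermediate
  element \<open>g d\<close>, which \<open>d\<close> determines.\<close>

lemma ext_equiv_pullback_pullback:
  assumes g: "g \<in> carrier D \<rightarrow> carrier C"
    and one: "g \<one>\<^bsub>D\<^esub> = \<one>\<^bsub>C\<^esub>"
    and mult: "\<And>x y. x \<in> carrier D \<Longrightarrow> y \<in> carrier D \<Longrightarrow> g (x \<otimes>\<^bsub>D\<^esub> y) = g x \<otimes>\<^bsub>C\<^esub> g y"
    and f: "\<And>x. x \<in> carrier D \<Longrightarrow> f' x = f (g x)"
  shows "ext_equiv B (pullback_extension D f' X)
    (pullback_extension D g (pullback_extension C f X))"
proof -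
  let ?P = "pullback_extension D f' X"
  let ?Q = "pullback_extension D g (pullback_extension C f X)"
  let ?h = "\<lambda>(e, d). ((e, g d), d)"
  have "?h \<in> iso (middle ?P) (middle ?Q)"
  proof (rule isoI)
    show "?h \<in> hom (middle ?P) (middle ?Q)"
      using g by (auto simp: hom_def mult f)
    show "bij_betw ?h (carrier (middle ?P)) (carrier (middle ?Q))"
      unfolding bij_betw_def using g by (force simp: inj_on_def f image_iff)
  qed
  then show ?thesis
    unfolding ext_equiv_def by (intro bexI[of _ ?h]) (auto simp: one)
qed

section \<open>Extensions of the circle\<close>

lemma circle_group_simps [simp]:
  "carrier circle_group = sphere 0 1" "x \<otimes>\<^bsub>circle_group\<^esub> y = x * y" "\<one>\<^bsub>circle_group\<^esub> = 1"
  by (auto simp: circle_group_def)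

lemma additive_group_simps [simp]:
  "carrier additive_group = UNIV" "x \<otimes>\<^bsub>additive_group\<^esub> y = x + y" "\<one>\<^bsub>additive_group\<^esub> = 0"
  by (auto simp: additive_group_def)

lemma roots_of_unity_group_simps [simp]:
  "carrier roots_of_unity_group = {z. \<exists>n>0. z ^ n = 1}"
  "x \<otimes>\<^bsub>roots_of_unity_group\<^esub> y = x * y" "\<one>\<^bsub>roots_of_unity_group\<^esub> = 1"
  by (auto simp: roots_of_unity_group_def circle_group_def)

lemma units_group_simps [simp]:
  "carrier units_group = - {0}" "x \<otimes>\<^bsub>units_group\<^esub> y = x * y" "\<one>\<^bsub>units_group\<^esub> = 1"
  by (auto simp: units_group_def ring_of_type_algebra_def)

lemma integer_group_simps [simp]:
  "carrier integer_group = UNIV" "x \<otimes>\<^bsub>integer_group\<^esub> y = x + y" "\<one>\<^bsub>integer_group\<^esub> = 0"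
  by (auto simp: integer_group_def)

lemma comm_group_circle_group: "comm_group circle_group"
proof (rule comm_groupI)
  fix x assume "x \<in> carrier circle_group"
  then show "\<exists>y\<in>carrier circle_group. y \<otimes>\<^bsub>circle_group\<^esub> x = \<one>\<^bsub>circle_group\<^esub>"
    by (intro bexI[of _ "inverse x"]) (auto simp: norm_inverse intro!: left_inverse)
qed (auto simp: norm_mult)

lemma comm_group_additive_group: "comm_group additive_group"
proof (rule comm_groupI)
  show "\<exists>y\<in>carrier additive_group. y \<otimes>\<^bsub>additive_group\<^esub> x = \<one>\<^bsub>additive_group\<^esub>" for x :: 'a
    by (intro bexI[of _ "- x"]) auto
qed (auto simp: add_ac)

lemma comm_group_units_group: "comm_group (units_group :: 'a::field monoid)"
proof (rule comm_groupI)
  fix x :: 'a assume "x \<in> carrier units_group"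
  then show "\<exists>y\<in>carrier units_group. y \<otimes>\<^bsub>units_group\<^esub> x = \<one>\<^bsub>units_group\<^esub>"
    by (intro bexI[of _ "inverse x"]) auto
qed (auto simp: mult_ac)

lemma comm_group_roots_of_unity_group: "comm_group roots_of_unity_group"
proof (rule comm_groupI)
  fix x y assume "x \<in> carrier roots_of_unity_group" "y \<in> carrier roots_of_unity_group"
  then obtain m n where mn: "m > 0" "x ^ m = 1" "n > 0" "y ^ n = 1" by auto
  then have "(x * y) ^ (m * n) = 1"
    by (metis mult.commute power_mult power_mult_distrib power_one mult_1)
  then show "x \<otimes>\<^bsub>roots_of_unity_group\<^esub> y \<in> carrier roots_of_unity_group"
    using mn by (auto intro!: exI[of _ "m * n"])
next
  fix x assume "x \<in> carrier roots_of_unity_group"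
  then obtain n where n: "n > 0" "x ^ n = 1" by auto
  then have "x \<noteq> 0" by (auto simp: zero_power)
  then show "\<exists>y\<in>carrier roots_of_unity_group. y \<otimes>\<^bsub>roots_of_unity_group\<^esub> x = \<one>\<^bsub>roots_of_unity_group\<^esub>"
    using n by (intro bexI[of _ "inverse x"]) (auto simp: power_inverse)
qed (auto simp: mult_ac)

lemma cis_2pi_eq_1_iff: "cis (2 * pi * t) = 1 \<longleftrightarrow> t \<in> \<int>"
proof
  assume "cis (2 * pi * t) = 1"
  then have "exp (\<i> * of_real (2 * pi * t)) = 1" by (simp add: cis_conv_exp)
  then obtain n :: int where "2 * pi * t = of_int (2 * n) * pi"
    unfolding exp_eq_1 by auto
  then have "t = of_int n" by simp
  then show "t \<in> \<int>" by simp
next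
  assume "t \<in> \<int>"
  then obtain n where "t = of_int n" by (auto elim: Ints_cases)
  then show "cis (2 * pi * t) = 1" by (simp add: cis_multiple_2pi)
qed

lemma cis_2pi_add: "cis (2 * pi * (s + t)) = cis (2 * pi * s) * cis (2 * pi * t)"
  by (simp add: cis_mult ring_distribs)

lemma cis_2pi_eq_iff: "cis (2 * pi * s) = cis (2 * pi * t) \<longleftrightarrow> s - t \<in> \<int>"
proof -
  have "cis (2 * pi * s) = cis (2 * pi * (s - t)) * cis (2 * pi * t)"
    using cis_2pi_add[of "s - t" t] by simp
  then show ?thesis using cis_2pi_eq_1_iff[of "s - t"] by (simp add: cis_neq_zero)
qed

lemma circle_eq_cis:
  assumes "norm z = 1" obtains t where "z = cis (2 * pi * t)"
proof -
  have "z = cis (Arg z)" using assms cis_Arg[of z] by (cases "z = 0") (auto simp: sgn_div_norm)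
  then show ?thesis using that[of "Arg z / (2 * pi)"] by simp
qed

lemma is_extension_real_extension:
  "is_extension circle_group integer_group real_extension"
  unfolding is_extension_def real_extension_def
proof (simp, intro conjI)
  show "comm_group (additive_group :: real monoid)" by (rule comm_group_additive_group)
  show "real_of_int \<in> hom integer_group additive_group" by (auto simp: hom_def)
  show "(\<lambda>t. cis (2 * pi * t)) \<in> hom additive_group circle_group"
    by (auto simp: hom_def cis_2pi_add)
  show "range (\<lambda>t. cis (2 * pi * t)) = sphere 0 1"
  proof (intro equalityI subsetI)
    fix z :: complex assume "z \<in> sphere 0 1"
    then have "norm z = 1" by simp
    then obtain t where "z = cis (2 * pi * t)" by (rule circle_eq_cis)
    then show "z \<in> range (\<lambda>t. cis (2 * pi * t))" by blast
  qed auto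
  show "range real_of_int = kernel additive_group circle_group (\<lambda>t. cis (2 * pi * t))"
    by (auto simp: kernel_def cis_2pi_eq_1_iff Ints_def)
qed (simp add: inj_on_def)

lemma norm_eq_1_of_root_of_unity:
  fixes z :: complex
  assumes "n > 0" "z ^ n = 1" shows "norm z = 1"
proof -
  have "norm z ^ n = 1 ^ n" using assms by (simp flip: norm_power)
  then show ?thesis using assms(1) by (metis norm_ge_zero power_eq_iff_eq_base zero_le_one)
qed

text \<open>If exp(2 pi i t) is an \<open>n\<close>-th root of unity, then \<open>n t\<close> is an
  integer and \<open>t\<close> is rational; conversely a denominator of \<open>x\<close> is an
  exponent that kills the image of \<open>x\<close>.\<close>

lemma is_extension_rat_extension:
  "is_extension roots_of_unity_group integer_group rat_extension"
  unfolding is_extension_def rat_extension_def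
proof (simp, intro conjI)
  have pow: "cis (2 * pi * t) ^ n = cis (2 * pi * (of_nat n * t))" for t n
    by (simp add: Complex.DeMoivre algebra_simps)
  have root: "\<exists>n>0. cis (2 * pi * of_rat x) ^ n = 1" for x
  proof -
    obtain a b where ab: "quotient_of x = (a, b)" by force
    then have x: "x = of_int a / of_int b" and b: "b > 0"
      by (auto simp: quotient_of_div quotient_of_denom_pos)
    have "real (nat b) * of_rat x = of_int a"
      using b by (simp add: x of_rat_divide)
    then have "cis (2 * pi * of_rat x) ^ nat b = 1"
      unfolding pow cis_2pi_eq_1_iff by simp
    then show ?thesis using b by (intro exI[of _ "nat b"]) auto
  qed
  show "comm_group (additive_group :: rat monoid)" by (rule comm_group_additive_group)
  show "rat_of_int \<in> hom integer_group additive_group" by (auto simp: hom_def)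
  show "(\<lambda>x. cis (2 * pi * of_rat x)) \<in> hom additive_group roots_of_unity_group"
    using root by (auto simp: hom_def cis_2pi_add of_rat_add)
  show "range (\<lambda>x. cis (2 * pi * of_rat x)) = {z. \<exists>n>0. z ^ n = 1}"
  proof (intro equalityI subsetI)
    fix z :: complex assume "z \<in> {z. \<exists>n>0. z ^ n = 1}"
    then obtain n where n: "n > 0" "z ^ n = 1" by auto
    then have "norm z = 1" by (rule norm_eq_1_of_root_of_unity)
    then obtain t where t: "z = cis (2 * pi * t)" by (rule circle_eq_cis)
    then have "of_nat n * t \<in> \<int>" using n by (simp add: pow cis_2pi_eq_1_iff)
    then obtain a where "of_nat n * t = of_int a" by (auto elim: Ints_cases)
    then have "t = of_rat (of_int a / of_nat n)"
      using n by (simp add: of_rat_divide field_simps)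
    then show "z \<in> range (\<lambda>x. cis (2 * pi * of_rat x))" using t by blast
  qed (use root in auto)
  show "range rat_of_int = kernel additive_group roots_of_unity_group (\<lambda>x. cis (2 * pi * of_rat x))"
  proof -
    have "real_of_rat x \<in> \<int> \<longleftrightarrow> x \<in> \<int>" for x
    proof
      assume "real_of_rat x \<in> \<int>"
      then obtain n where "real_of_rat x = of_int n" by (auto elim: Ints_cases)
      then have "real_of_rat x = real_of_rat (of_int n)" by simp
      then have "x = of_int n" unfolding of_rat_eq_iff .
      then show "x \<in> \<int>" by simp
    qed (auto elim!: Ints_cases)
    then show ?thesis by (auto simp: kernel_def cis_2pi_eq_1_iff Ints_def)
  qed
qed (simp add: inj_on_def)

text \<open>Exactness of Hom(C,R) -> Hom(C,S^1) -> Ext(C,Z), in the form needed for two characters.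
  An equivalence of the pullbacks preserves the second coordinate, hence shifts the real one, and
  the shift depends on \<open>c\<close> alone because the equivalence fixes the copy of the
  integers.\<close>

lemma ext_equiv_pullback_real_iff:
  assumes C: "comm_group C" and f: "f \<in> hom C circle_group" and g: "g \<in> hom C circle_group"
  shows "ext_equiv integer_group (pullback_extension C f real_extension)
      (pullback_extension C g real_extension) \<longleftrightarrow>
    (\<exists>h \<in> hom C additive_group. \<forall>x \<in> carrier C. g x = f x * cis (2 * pi * h x))"
    (is "ext_equiv _ ?P ?Q \<longleftrightarrow> _")
proof -
  interpret C: comm_group C by fact
  have R: "carrier (middle real_extension) = UNIV" "proj real_extension t = cis (2 * pi * t)"
    "incl real_extension n = of_int n" "s \<otimes>\<^bsub>middle real_extension\<^esub> t = s + t" for s t n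
    by (simp_all add: real_extension_def)
  note [simp] = R
  have f1: "f \<one>\<^bsub>C\<^esub> = 1" and g1: "g \<one>\<^bsub>C\<^esub> = 1"
    using hom_one[OF f] hom_one[OF g] C.is_group comm_group_circle_group by (auto simp: comm_group_def)
  have fm: "f (x \<otimes>\<^bsub>C\<^esub> y) = f x * f y" and gm: "g (x \<otimes>\<^bsub>C\<^esub> y) = g x * g y"
    if "x \<in> carrier C" "y \<in> carrier C" for x y
    using f g that by (auto simp: hom_def)
  have fn: "norm (f x) = 1" if "x \<in> carrier C" for x
    using f that by (auto simp: hom_def)
  show ?thesis
  proof
    assume "ext_equiv integer_group ?P ?Q"
    then obtain k where k: "k \<in> iso (middle ?P) (middle ?Q)"
      and ki: "\<And>n. k (of_int n, \<one>\<^bsub>C\<^esub>) = (of_int n, \<one>\<^bsub>C\<^esub>)"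
      and kp: "\<And>t c. c \<in> carrier C \<Longrightarrow> cis (2 * pi * t) = f c \<Longrightarrow> snd (k (t, c)) = c"
      unfolding ext_equiv_def
      by (auto simp: pullback_extension_def real_extension_def)
    have km: "k (s + t, c \<otimes>\<^bsub>C\<^esub> d) = k (s, c) \<otimes>\<^bsub>middle ?Q\<^esub> k (t, d)"
      if "c \<in> carrier C" "cis (2 * pi * s) = f c" "d \<in> carrier C" "cis (2 * pi * t) = f d" for s t c d
    proof -
      have "k ((s, c) \<otimes>\<^bsub>middle ?P\<^esub> (t, d)) = k (s, c) \<otimes>\<^bsub>middle ?Q\<^esub> k (t, d)"
        by (rule hom_mult) (use k that in \<open>auto simp: iso_def\<close>)
      then show ?thesis by simp
    qed
    \<comment> \<open>A priori the shift also depends on the real lift \<open>t\<close> of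
      \<open>f c\<close>; \<open>indep\<close> removes this dependence.\<close>
    define h' where "h' t c = fst (k (t, c)) - t" for t c
    have k_eq: "k (t, c) = (t + h' t c, c)" if "c \<in> carrier C" "cis (2 * pi * t) = f c" for t c
      using kp[OF that] by (cases "k (t, c)") (simp add: h'_def)
    have add: "h' (s + t) (c \<otimes>\<^bsub>C\<^esub> d) = h' s c + h' t d"
      if "c \<in> carrier C" "cis (2 * pi * s) = f c" "d \<in> carrier C" "cis (2 * pi * t) = f d" for s t c d
      using km[OF that] that k_eq[of "c \<otimes>\<^bsub>C\<^esub> d" "s + t"] by (simp add: k_eq cis_2pi_add fm)
    have z: "h' (of_int n) \<one>\<^bsub>C\<^esub> = 0" for n by (simp add: h'_def ki)
    have indep: "h' s c = h' t c"
      if "c \<in> carrier C" "cis (2 * pi * s) = f c" "cis (2 * pi * t) = f c" for s t c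
    proof -
      have "s - t \<in> \<int>" using that cis_2pi_eq_iff by metis
      \<comment> \<open>Two lifts of \<open>f c\<close> differ by an element of the copy of the
        integers, where \<open>h'\<close> vanishes by \<open>z\<close>.\<close>
      then obtain n where n: "s - t = of_int n" by (auto elim: Ints_cases)
      then have "h' (of_int n + t) (\<one>\<^bsub>C\<^esub> \<otimes>\<^bsub>C\<^esub> c) = h' (of_int n) \<one>\<^bsub>C\<^esub> + h' t c"
        using that by (intro add) (auto simp: f1 cis_2pi_eq_1_iff)
      moreover have "of_int n + t = s" using n by simp
      ultimately show ?thesis using that by (simp add: z)
    qed
    \<comment> \<open>This choice of lifts is not additive; \<open>indep\<close> allows
      \<open>\<tau> c + \<tau> d\<close> to replace the lift chosen for the product.\<close>
    define \<tau> where "\<tau> c = (SOME t. cis (2 * pi * t) = f c)" for c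
    have \<tau>: "cis (2 * pi * \<tau> c) = f c" if "c \<in> carrier C" for c
    proof -
      from fn[OF that] obtain t where "f c = cis (2 * pi * t)" by (rule circle_eq_cis)
      then have "\<exists>t. cis (2 * pi * t) = f c" by metis
      then show ?thesis unfolding \<tau>_def by (rule someI_ex)
    qed
    have "h' (\<tau> (c \<otimes>\<^bsub>C\<^esub> d)) (c \<otimes>\<^bsub>C\<^esub> d) = h' (\<tau> c) c + h' (\<tau> d) d"
      if "c \<in> carrier C" "d \<in> carrier C" for c d
      using that indep[of "c \<otimes>\<^bsub>C\<^esub> d" "\<tau> (c \<otimes>\<^bsub>C\<^esub> d)" "\<tau> c + \<tau> d"] add[of c "\<tau> c" d "\<tau> d"]
      by (simp add: \<tau> cis_2pi_add fm)
    then have "(\<lambda>c. h' (\<tau> c) c) \<in> hom C additive_group" by (auto simp: hom_def)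
    moreover have "g c = f c * cis (2 * pi * h' (\<tau> c) c)" if "c \<in> carrier C" for c
    proof -
      have "k (\<tau> c, c) \<in> carrier (middle ?Q)"
        using k \<tau> that by (intro hom_in_carrier[of k "middle ?P"]) (auto simp: iso_def)
      then show ?thesis using that by (simp add: k_eq \<tau> cis_2pi_add)
    qed
    ultimately show "\<exists>h \<in> hom C additive_group. \<forall>x \<in> carrier C. g x = f x * cis (2 * pi * h x)"
      by (intro bexI[where x = "\<lambda>c. h' (\<tau> c) c"] ballI)
  next
    assume "\<exists>h \<in> hom C additive_group. \<forall>x \<in> carrier C. g x = f x * cis (2 * pi * h x)"
    then obtain h where hm: "\<And>x y. x \<in> carrier C \<Longrightarrow> y \<in> carrier C \<Longrightarrow> h (x \<otimes>\<^bsub>C\<^esub> y) = h x + h y"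
      and gf: "\<And>x. x \<in> carrier C \<Longrightarrow> g x = f x * cis (2 * pi * h x)"
      by (auto simp: hom_def)
    have h1: "h \<one>\<^bsub>C\<^esub> = 0" using hm[of "\<one>\<^bsub>C\<^esub>" "\<one>\<^bsub>C\<^esub>"] by simp
    let ?k = "\<lambda>(t, c). (t + h c, c)"
    have "?k \<in> iso (middle ?P) (middle ?Q)"
    proof (rule isoI)
      show "?k \<in> hom (middle ?P) (middle ?Q)"
        by (auto simp: hom_def gf cis_2pi_add hm)
      have "(t, c) \<in> ?k ` carrier (middle ?P)"
        if "c \<in> carrier C" "cis (2 * pi * t) = g c" for t c
      proof (rule image_eqI[of _ _ "(t - h c, c)"])
        have "cis (2 * pi * (t - h c)) * cis (2 * pi * h c) = f c * cis (2 * pi * h c)"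
          using that cis_2pi_add[of "t - h c" "h c"] by (simp add: gf)
        then show "(t - h c, c) \<in> carrier (middle ?P)"
          using that by (simp add: cis_neq_zero)
      qed simp
      then show "bij_betw ?k (carrier (middle ?P)) (carrier (middle ?Q))"
        unfolding bij_betw_def by (auto simp: inj_on_def gf cis_2pi_add)
    qed
    then show "ext_equiv integer_group ?P ?Q"
      unfolding ext_equiv_def by (intro bexI[of _ ?k]) (auto simp: h1)
  qed
qed

text \<open>A real \<open>t\<close> with exp(2 pi i t) a root of unity is rational, so the pullback
  is a copy of the rationals. The natural map goes from the rationals to the pullback; reversing it
  by \<open>ext_equiv_sym\<close> is why \<open>f\<close> is shown to be a homomorphism and the
  pullback an extension.\<close>

lemma ext_equiv_rat_pullback:
  assumes "\<And>z. z \<in> carrier roots_of_unity_group \<Longrightarrow> f z = z"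
  shows "ext_equiv integer_group (pullback_extension roots_of_unity_group f real_extension) rat_extension"
    (is "ext_equiv _ ?P _")
proof -
  note E = is_extensionD[OF is_extension_rat_extension]
  let ?h = "\<lambda>q. (real_of_rat q, cis (2 * pi * real_of_rat q))"
  have p: "cis (2 * pi * of_rat q) \<in> carrier roots_of_unity_group" for q
    using E(5) by (auto simp: rat_extension_def)
  have [simp]: "carrier (middle real_extension) = UNIV" "proj real_extension t = cis (2 * pi * t)"
    "incl real_extension n = of_int n" "s \<otimes>\<^bsub>middle real_extension\<^esub> t = s + t" for s t n
    by (simp_all add: real_extension_def)
  have "?h \<in> iso (middle rat_extension) (middle ?P)"
  proof (rule isoI)
    show "?h \<in> hom (middle rat_extension) (middle ?P)"
      using p assms[OF p] by (auto simp: hom_def rat_extension_def of_rat_add cis_2pi_add)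
    show "bij_betw ?h (carrier (middle rat_extension)) (carrier (middle ?P))"
      unfolding bij_betw_def
    proof
      show "inj_on ?h (carrier (middle rat_extension))" by (auto simp: inj_on_def)
      have "z \<in> range ?h" if z: "z \<in> carrier (middle ?P)" for z
      proof -
        obtain t c where z': "z = (t, c)" by force
        then have tc: "z = (t, c)" "c \<in> carrier roots_of_unity_group" "cis (2 * pi * t) = c"
          using z assms[of c] by auto
        then obtain q where "c = cis (2 * pi * of_rat q)"
          using E(5) by (auto simp: rat_extension_def)
        moreover from this tc have "t - of_rat q \<in> \<int>" using cis_2pi_eq_iff by metis
        then obtain n where "t - of_rat q = of_int n" by (auto elim: Ints_cases)
        then have "t = of_rat (q + of_int n)" by (simp add: of_rat_add)
        ultimately show ?thesis using tc by (intro image_eqI[of _ _ "q + of_int n"]) auto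
      qed
      then show "?h ` carrier (middle rat_extension) = carrier (middle ?P)"
        using p assms[OF p] by (auto simp: rat_extension_def)
    qed
  qed
  then have "ext_equiv integer_group rat_extension ?P"
    unfolding ext_equiv_def by (intro bexI[of _ ?h]) (auto simp: rat_extension_def cis_multiple_2pi)
  moreover have "f \<in> hom roots_of_unity_group circle_group"
  proof -
    interpret comm_group roots_of_unity_group by (rule comm_group_roots_of_unity_group)
    have "norm (f z) = 1" if "z \<in> carrier roots_of_unity_group" for z
      using that assms[OF that] norm_eq_1_of_root_of_unity by auto
    moreover have "f (x * y) = f x * f y"
      if "x \<in> carrier roots_of_unity_group" "y \<in> carrier roots_of_unity_group" for x y
      using m_closed[OF that] assms[OF that(1)] assms[OF that(2)]
      by (simp add: assms del: roots_of_unity_group_simps(1))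
    ultimately show ?thesis by (simp add: hom_def)
  qed
  then have "is_extension roots_of_unity_group integer_group ?P"
    using comm_group_circle_group abelian_integer_group comm_group_roots_of_unity_group
      is_extension_real_extension
    by (intro is_extension_pullback) (auto simp: comm_group_def)
  ultimately show ?thesis
    using is_extension_rat_extension ext_equiv_sym by blast
qed

section \<open>The character space\<close>

lemma charactersD:
  assumes "chi \<in> characters \<iota>"
  shows "x \<noteq> 0 \<Longrightarrow> norm (chi x) = 1"
    and "x \<noteq> 0 \<Longrightarrow> y \<noteq> 0 \<Longrightarrow> chi (x * y) = chi x * chi y"
    and "chi 1 = 1"
    and "chi \<in> extensional (- {0})"
    and "\<zeta> \<in> carrier roots_of_unity_group \<Longrightarrow> chi (\<iota> \<zeta>) = \<zeta>"
proof -
  have h: "chi \<in> hom units_group circle_group"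
    using assms by (simp add: characters_def)
  show "chi 1 = 1"
    using hom_one[OF h] comm_group_units_group comm_group_circle_group
    by (auto simp: comm_group_def)
  show "x \<noteq> 0 \<Longrightarrow> norm (chi x) = 1" "x \<noteq> 0 \<Longrightarrow> y \<noteq> 0 \<Longrightarrow> chi (x * y) = chi x * chi y"
    using h by (auto simp: hom_def)
qed (use assms in \<open>simp_all add: characters_def\<close>)

lemma charactersI:
  assumes "\<And>x. x \<noteq> 0 \<Longrightarrow> norm (chi x) = 1"
    and "\<And>x y. x \<noteq> 0 \<Longrightarrow> y \<noteq> 0 \<Longrightarrow> chi (x * y) = chi x * chi y"
    and "chi \<in> extensional (- {0})"
    and "\<And>\<zeta>. \<zeta> \<in> carrier roots_of_unity_group \<Longrightarrow> chi (\<iota> \<zeta>) = \<zeta>"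
  shows "chi \<in> characters \<iota>"
  using assms by (auto simp: characters_def hom_def)

lemma topspace_character_space: "topspace (character_space \<iota>) = characters \<iota>"
proof -
  let ?D = "discrete_topology (carrier (units_group :: 'a monoid))"
  let ?C = "top_of_set (carrier circle_group)"
  \<comment> \<open>For empty \<open>K\<close> the condition on the image is void, so this single
    subbasic set contains every character.\<close>
  have "characters \<iota> \<subseteq> {f \<in> extensional (topspace ?D). continuous_map ?D ?C f \<and> f ` {} \<subseteq> {}}"
    by (auto simp: characters_def hom_def)
  also have "\<dots> \<subseteq> topspace (compact_open_topology ?D ?C)"
    unfolding compact_open_topology_def topology_generated_by_topspace
    using compactin_empty[of ?D] openin_empty[of ?C] by blast
  finally have "characters \<iota> \<subseteq> topspace (compact_open_topology ?D ?C)" .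
  then show ?thesis by (auto simp: character_space_def)
qed

text \<open>Compact sets of a discrete space are finite, so the compact-open topology is that of
  pointwise convergence.\<close>

lemma continuous_map_character_space:
  "continuous_map Z (character_space \<iota>) g \<longleftrightarrow>
     (\<forall>z\<in>topspace Z. g z \<in> characters \<iota>) \<and> (\<forall>x. x \<noteq> 0 \<longrightarrow> continuous_map Z euclidean (\<lambda>z. g z x))"
proof -
  let ?D = "discrete_topology (carrier (units_group :: 'b monoid))"
  let ?C = "top_of_set (carrier circle_group)"
  define B where "B K U = {f \<in> extensional (topspace ?D). continuous_map ?D ?C f \<and> f ` K \<subseteq> U}"
    for K :: "'b set" and U
  have cot: "compact_open_topology ?D ?C = topology_generated_by {B K U | K U. compactin ?D K \<and> openin ?C U}"
    by (simp add: compact_open_topology_def B_def)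
  have B: "f \<in> B K U \<longleftrightarrow> f ` K \<subseteq> U" if "f \<in> characters \<iota>" for f K U
    using that by (auto simp: B_def characters_def hom_def)
  have "continuous_map Z (character_space \<iota>) g \<longleftrightarrow>
      (\<forall>z\<in>topspace Z. g z \<in> characters \<iota>) \<and>
      (\<forall>K U. compactin ?D K \<longrightarrow> openin ?C U \<longrightarrow> openin Z {z \<in> topspace Z. g z ` K \<subseteq> U})"
    (is "?L \<longleftrightarrow> ?A \<and> ?R")
  proof -
    have "?L \<longleftrightarrow> ?A \<and> continuous_map Z (compact_open_topology ?D ?C) g"
      by (auto simp: character_space_def continuous_map_in_subtopology)
    moreover have "continuous_map Z (compact_open_topology ?D ?C) g \<longleftrightarrow> ?R" if ?A
    proof -
      have eq: "g -` B K U \<inter> topspace Z = {z \<in> topspace Z. g z ` K \<subseteq> U}" for K U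
        using that B by blast
      have "g ` topspace Z \<subseteq> B {} {}" using that B by blast
      then have "g ` topspace Z \<subseteq> \<Union>{B K U | K U. compactin ?D K \<and> openin ?C U}"
        using compactin_empty[of ?D] openin_empty[of ?C] by blast
      then show ?thesis
        unfolding cot continuous_on_generated_topo_iff eq[symmetric] by blast
    qed
    ultimately show ?thesis by blast
  qed
  also have "\<dots> \<longleftrightarrow> ?A \<and> (\<forall>x. x \<noteq> 0 \<longrightarrow> continuous_map Z euclidean (\<lambda>z. g z x))" (is "_ \<longleftrightarrow> _ \<and> ?R'")
  proof (rule conj_cong[OF refl])
    assume A: ?A
    show "?R \<longleftrightarrow> ?R'"
    proof
      assume R: ?R
      show ?R'
      proof (intro allI impI)
        fix x :: 'b assume x: "x \<noteq> 0"
        have "openin Z {z \<in> topspace Z. g z x \<in> U}" if "open U" for U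
        proof -
          have "openin Z {z \<in> topspace Z. g z ` {x} \<subseteq> carrier circle_group \<inter> U}"
            by (rule R[rule_format]) (use x that in \<open>auto simp: openin_open_Int compactin_discrete_topology\<close>)
          moreover have "{z \<in> topspace Z. g z ` {x} \<subseteq> carrier circle_group \<inter> U} =
              {z \<in> topspace Z. g z x \<in> U}"
            using A x by (auto simp: charactersD(1))
          ultimately show ?thesis by simp
        qed
        then show "continuous_map Z euclidean (\<lambda>z. g z x)"
          by (auto simp: continuous_map)
      qed
    next
      assume R: ?R'
      show ?R
      proof (intro allI impI)
        fix K U assume K: "compactin ?D K" and "openin ?C U"
        then obtain V where V: "open V" "U = sphere 0 1 \<inter> V"
          by (auto simp: openin_open)
        have K: "finite K" "0 \<notin> K" using K by (auto simp: compactin_discrete_topology)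
        have "openin Z {z \<in> topspace Z. g z x \<in> V}" if "x \<in> K" for x
          using R K that V(1) unfolding continuous_map by (metis open_openin)
        \<comment> \<open>The factor \<open>topspace Z\<close> takes care of empty \<open>K\<close>,
          for which the intersection of the family is \<open>UNIV\<close>.\<close>
        then have "openin Z (topspace Z \<inter> \<Inter>((\<lambda>x. {z \<in> topspace Z. g z x \<in> V}) ` K))"
          using K(1) by (cases "K = {}") (auto intro!: openin_Int openin_Inter)
        moreover have "norm (g z x) = 1" if "z \<in> topspace Z" "x \<in> K" for z x
          using A K(2) that by (intro charactersD(1)[of _ \<iota>]) auto
        then have "topspace Z \<inter> \<Inter>((\<lambda>x. {z \<in> topspace Z. g z x \<in> V}) ` K) =
            {z \<in> topspace Z. g z ` K \<subseteq> U}"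
          by (auto simp: V(2))
        ultimately show "openin Z {z \<in> topspace Z. g z ` K \<subseteq> U}" by simp
      qed
    qed
  qed
  finally show ?thesis .
qed

lemma openin_character_space:
  assumes "x \<noteq> 0" "open U"
  shows "openin (character_space \<iota>) {chi \<in> characters \<iota>. chi x \<in> U}"
proof -
  have "continuous_map (character_space \<iota>) (character_space \<iota>) (\<lambda>chi. chi)" by simp
  then have "continuous_map (character_space \<iota>) euclidean (\<lambda>chi. chi x)"
    unfolding continuous_map_character_space using assms by blast
  then show ?thesis using assms(2) by (simp add: continuous_map topspace_character_space)
qed

section \<open>The Galois group\<close>

lemma ring_of_type_algebra_simps [simp]:
  "carrier ring_of_type_algebra = UNIV" "x \<otimes>\<^bsub>ring_of_type_algebra\<^esub> y = x * y"
  "x \<oplus>\<^bsub>ring_of_type_algebra\<^esub> y = x + y" "\<one>\<^bsub>ring_of_type_algebra\<^esub> = 1"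
  "\<zero>\<^bsub>ring_of_type_algebra\<^esub> = 0"
  by (auto simp: ring_of_type_algebra_def)

text \<open>\<open>eval\<close> reads a list from the leading coefficient, \<open>Poly\<close> from
  the constant term; hence \<open>rev\<close>.\<close>

lemma eval_ring_of_type_algebra:
  fixes q :: "'a::field list"
  shows "ring.eval ring_of_type_algebra q y = poly (Poly (rev q)) y"
proof -
  interpret field "ring_of_type_algebra :: 'a ring" ..
  have pow: "a [^]\<^bsub>ring_of_type_algebra\<^esub> n = a ^ n" for a :: 'a and n :: nat
    by (induction n) (auto simp: mult.commute)
  show ?thesis
    by (induction q) (auto simp: pow Poly_snoc poly_monom)
qed

lemma galois_group_simps [simp]:
  "x \<otimes>\<^bsub>galois_group F\<^esub> y = x \<circ> y" "\<one>\<^bsub>galois_group F\<^esub> = id"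
  by (auto simp: galois_group_def)

lemma galois_group_iff:
  "\<sigma> \<in> carrier (galois_group F) \<longleftrightarrow>
     bij \<sigma> \<and> (\<forall>x y. \<sigma> (x + y) = \<sigma> x + \<sigma> y) \<and> (\<forall>x y. \<sigma> (x * y) = \<sigma> x * \<sigma> y) \<and>
     \<sigma> 1 = 1 \<and> (\<forall>x\<in>F. \<sigma> x = x)"
  by (auto simp: galois_group_def ring_iso_def ring_hom_def)

lemma galois_group_zero:
  assumes "\<sigma> \<in> carrier (galois_group F)"
  shows "\<sigma> 0 = 0" "\<sigma> x = 0 \<longleftrightarrow> x = 0"
proof -
  have "\<sigma> (0 + 0) = \<sigma> 0 + \<sigma> 0" using assms unfolding galois_group_iff by blast
  then show z: "\<sigma> 0 = 0" by (metis add.right_neutral add_left_cancel)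
  have "inj \<sigma>" using assms by (simp add: galois_group_iff bij_def)
  then show "\<sigma> x = 0 \<longleftrightarrow> x = 0" using z by (metis injD)
qed

lemma inv_into_galois_group:
  assumes \<sigma>: "\<sigma> \<in> carrier (galois_group F)"
  shows "inv_into UNIV \<sigma> \<in> carrier (galois_group F)"
proof -
  have b: "bij \<sigma>" and a: "\<And>x y. \<sigma> (x + y) = \<sigma> x + \<sigma> y" and m: "\<And>x y. \<sigma> (x * y) = \<sigma> x * \<sigma> y"
    and o: "\<sigma> 1 = 1" and F: "\<And>x. x \<in> F \<Longrightarrow> \<sigma> x = x"
    using \<sigma> by (auto simp: galois_group_iff)
  have inj: "inj \<sigma>" and i: "\<And>x. \<sigma> (inv_into UNIV \<sigma> x) = x"
    using b by (auto simp: bij_def surj_f_inv_f)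
  show ?thesis
    unfolding galois_group_iff
  proof (intro conjI allI ballI)
    show "bij (inv_into UNIV \<sigma>)" using b by (rule bij_imp_bij_inv)
    show "inv_into UNIV \<sigma> (x + y) = inv_into UNIV \<sigma> x + inv_into UNIV \<sigma> y" for x y
      by (rule injD[OF inj]) (simp add: i a)
    show "inv_into UNIV \<sigma> (x * y) = inv_into UNIV \<sigma> x * inv_into UNIV \<sigma> y" for x y
      by (rule injD[OF inj]) (simp add: i m)
    show "inv_into UNIV \<sigma> 1 = 1"
      by (rule injD[OF inj]) (simp add: i o)
    show "inv_into UNIV \<sigma> x = x" if "x \<in> F" for x
      by (rule injD[OF inj]) (simp add: i F that)
  qed
qed

lemma galois_group_inv_into_cancel:
  assumes "\<sigma> \<in> carrier (galois_group F)"
  shows "\<sigma> (inv_into UNIV \<sigma> x) = x" "inv_into UNIV \<sigma> (\<sigma> x) = x"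
  using assms by (auto simp: galois_group_iff bij_def surj_f_inv_f)

lemma group_galois_group: "group (galois_group F)"
proof (rule groupI)
  show "\<exists>y\<in>carrier (galois_group F). y \<otimes>\<^bsub>galois_group F\<^esub> x = \<one>\<^bsub>galois_group F\<^esub>"
    if "x \<in> carrier (galois_group F)" for x
    using inv_into_galois_group[OF that] galois_group_inv_into_cancel[OF that]
    by (intro bexI[of _ "inv_into UNIV x"]) auto
qed (auto simp: galois_group_iff bij_comp)

lemma inv_galois_group:
  assumes "\<sigma> \<in> carrier (galois_group F)"
  shows "inv\<^bsub>galois_group F\<^esub> \<sigma> = inv_into UNIV \<sigma>"
  using assms inv_into_galois_group[OF assms] galois_group_inv_into_cancel[OF assms]
  by (intro group.inv_equality[OF group_galois_group]) auto

lemma galois_group_comp: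
  "\<sigma> \<in> carrier (galois_group F) \<Longrightarrow> \<tau> \<in> carrier (galois_group F) \<Longrightarrow>
    \<sigma> \<circ> \<tau> \<in> carrier (galois_group F)"
  by (auto simp: galois_group_iff bij_comp)

lemma act_char_comp:
  assumes "\<sigma> \<in> carrier (galois_group F)" "\<tau> \<in> carrier (galois_group F)"
  shows "act_char (\<sigma> \<circ> \<tau>) chi = act_char \<sigma> (act_char \<tau> chi)"
  using assms by (simp add: act_char_def o_inv_distrib galois_group_iff o_assoc)

lemma act_char_id [simp]: "act_char id chi = chi"
  by (simp add: act_char_def inv_id)

lemma act_char_apply:
  assumes "\<sigma> \<in> carrier (galois_group F)"
  shows "act_char \<sigma> chi (\<sigma> x) = chi x" "act_char (inv_into UNIV \<sigma>) chi x = chi (\<sigma> x)"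
  using assms galois_group_inv_into_cancel[OF assms]
  by (simp_all add: act_char_def inv_inv_eq galois_group_iff)

lemma act_char_inv_cancel:
  assumes "\<sigma> \<in> carrier (galois_group F)"
  shows "act_char (inv_into UNIV \<sigma>) (act_char \<sigma> chi) = chi"
    "act_char \<sigma> (act_char (inv_into UNIV \<sigma>) chi) = chi"
  using assms by (auto simp: act_char_def galois_group_inv_into_cancel inv_inv_eq galois_group_iff fun_eq_iff bij_def surj_f_inv_f)

lemma mem_char_orbit_iff:
  "psi \<in> char_orbit F chi \<longleftrightarrow> (\<exists>\<sigma>\<in>carrier (galois_group F). psi = act_char \<sigma> chi)"
  by (auto simp: char_orbit_def orbit_def)

lemma char_orbit_self: "chi \<in> char_orbit F chi"
  unfolding mem_char_orbit_iff
  by (rule bexI[of _ id]) (auto simp: group.is_monoid[OF group_galois_group] galois_group_iff)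

lemma char_orbit_eq_iff: "char_orbit F psi = char_orbit F chi \<longleftrightarrow> psi \<in> char_orbit F chi"
proof
  assume "psi \<in> char_orbit F chi"
  then obtain \<sigma> where \<sigma>: "\<sigma> \<in> carrier (galois_group F)" "psi = act_char \<sigma> chi"
    by (auto simp: mem_char_orbit_iff)
  have "act_char \<tau> psi \<in> char_orbit F chi" if "\<tau> \<in> carrier (galois_group F)" for \<tau>
    using \<sigma> that by (auto simp: mem_char_orbit_iff act_char_comp[symmetric] intro!: bexI[of _ "\<tau> \<circ> \<sigma>"] galois_group_comp)
  moreover have "act_char \<tau> chi \<in> char_orbit F psi" if "\<tau> \<in> carrier (galois_group F)" for \<tau>
    unfolding mem_char_orbit_iff
  proof (rule bexI[of _ "\<tau> \<circ> inv_into UNIV \<sigma>"])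
    show "act_char \<tau> chi = act_char (\<tau> \<circ> inv_into UNIV \<sigma>) psi"
      using \<sigma> that inv_into_galois_group[OF \<sigma>(1)] by (simp add: act_char_comp act_char_inv_cancel)
  qed (use \<sigma> that in \<open>auto intro!: galois_group_comp inv_into_galois_group\<close>)
  ultimately show "char_orbit F psi = char_orbit F chi"
    by (auto simp: mem_char_orbit_iff[of _ _ chi] mem_char_orbit_iff[of _ _ psi])
qed (use char_orbit_self in blast)

section \<open>Galois automorphisms over a field containing the roots of unity\<close>

locale cyclotomic_closure =
  fixes F :: "'a::field set" and \<iota> :: "complex \<Rightarrow> 'a"
  assumes closure: "algebraic_closure (ring_of_type_algebra :: 'a ring) F"
    and emb: "\<iota> \<in> ring_hom cyclotomic_field (ring_of_type_algebra\<lparr>carrier := F\<rparr>)"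
begin

abbreviation "Gal \<equiv> carrier (galois_group F)"

lemma cyclotomic_field_simps:
  "carrier cyclotomic_field = generate_field ring_of_type_algebra (carrier roots_of_unity_group)"
  "x \<otimes>\<^bsub>cyclotomic_field\<^esub> y = x * y" "x \<oplus>\<^bsub>cyclotomic_field\<^esub> y = x + y"
  "\<one>\<^bsub>cyclotomic_field\<^esub> = 1"
  by (auto simp: cyclotomic_field_def)

lemma emb_root:
  assumes "\<zeta> \<in> carrier roots_of_unity_group"
  shows "\<zeta> \<in> carrier cyclotomic_field" "\<iota> \<zeta> \<in> F"
proof -
  show "\<zeta> \<in> carrier cyclotomic_field"
    unfolding cyclotomic_field_simps using assms by (rule generate_field.incl)
  then show "\<iota> \<zeta> \<in> F" using ring_hom_closed[OF emb] by simp
qed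

lemma emb_hom:
  "\<iota> 1 = 1"
  "x \<in> carrier cyclotomic_field \<Longrightarrow> y \<in> carrier cyclotomic_field \<Longrightarrow> \<iota> (x * y) = \<iota> x * \<iota> y"
  "x \<in> carrier cyclotomic_field \<Longrightarrow> y \<in> carrier cyclotomic_field \<Longrightarrow> \<iota> (x + y) = \<iota> x + \<iota> y"
  using emb by (simp_all add: ring_hom_def cyclotomic_field_simps)

text \<open>The embedding forces characteristic zero: 1/n lies in the cyclotomic field, and its
  image inverts n. The Fourier inversion in \<open>galois_group_fixes_of_gap\<close> has to cancel
  such an integer.\<close>

lemma of_nat_neq_0: assumes "n > 0" shows "(of_nat n :: 'a) \<noteq> 0"
proof -
  have one: "1 \<in> carrier cyclotomic_field"
    using generate_field.one[of ring_of_type_algebra] by (simp add: cyclotomic_field_simps)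
  have n: "of_nat (Suc k) \<in> carrier cyclotomic_field \<and> \<iota> (of_nat (Suc k)) = of_nat (Suc k)" for k
  proof (induction k)
    case (Suc k)
    have "of_nat (Suc k) \<oplus>\<^bsub>ring_of_type_algebra\<^esub> 1 \<in> carrier cyclotomic_field"
      using conjunct1[OF Suc] one unfolding cyclotomic_field_simps by (rule generate_field.eng_add)
    then have "of_nat (Suc k) + 1 \<in> carrier cyclotomic_field"
      by (simp only: ring_of_type_algebra_simps)
    then show ?case
      using Suc one emb_hom(3)[of "of_nat (Suc k)" 1] by (simp add: emb_hom(1) add.commute)
  qed (use one emb_hom(1) in auto)
  obtain k where k: "n = Suc k" using assms by (cases n) auto
  interpret C: field "ring_of_type_algebra :: complex ring" ..
  have "inv\<^bsub>ring_of_type_algebra\<^esub> (of_nat n) = (inverse (of_nat n) :: complex)"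
    using assms by (intro C.comm_inv_char) auto
  moreover have "of_nat n \<in> carrier cyclotomic_field"
    unfolding k using conjunct1[OF n] .
  then have "inv\<^bsub>ring_of_type_algebra\<^esub> (of_nat n) \<in> carrier cyclotomic_field"
    unfolding cyclotomic_field_simps by (rule generate_field.m_inv) (use assms in simp)
  ultimately have "inverse (of_nat n) \<in> carrier cyclotomic_field" by simp
  then have "\<iota> (of_nat n * inverse (of_nat n)) = of_nat n * \<iota> (inverse (of_nat n))"
    using n[of k] k by (simp add: emb_hom(2))
  moreover have "of_nat n * inverse (of_nat n) = (1::complex)" using assms by simp
  ultimately show ?thesis by (metis emb_hom(1) mult_zero_left zero_neq_one)
qed

lemma emb_root_power:
  assumes "\<zeta> \<in> carrier roots_of_unity_group"
  shows "\<iota> (\<zeta> ^ n) = \<iota> \<zeta> ^ n" "\<zeta> ^ n \<in> carrier roots_of_unity_group"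
proof -
  interpret comm_group roots_of_unity_group by (rule comm_group_roots_of_unity_group)
  have *: "\<zeta> ^ n \<in> carrier roots_of_unity_group" for n
  proof (induction n)
    case (Suc n)
    show ?case using m_closed[OF assms Suc] by (simp only: roots_of_unity_group_simps power_Suc)
  qed (use one_closed in simp)
  then show "\<zeta> ^ n \<in> carrier roots_of_unity_group" .
  show "\<iota> (\<zeta> ^ n) = \<iota> \<zeta> ^ n"
    by (induction n) (simp_all add: emb_hom(1) emb_hom(2)[OF emb_root(1)[OF assms] emb_root(1)[OF *]])
qed

lemma emb_root_neq_0:
  assumes "\<zeta> \<in> carrier roots_of_unity_group" shows "\<iota> \<zeta> \<noteq> 0"
proof
  assume z: "\<iota> \<zeta> = 0"
  obtain n where n: "n > 0" "\<zeta> ^ n = 1" using assms by auto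
  then have "\<iota> \<zeta> ^ n = 1" using emb_root_power(1)[OF assms, of n] emb_hom(1) by simp
  then show False using z n by (simp add: zero_power)
qed

text \<open>The normalisation on roots of unity survives because they lie in \<open>F\<close>, which
  automorphisms fix.\<close>

lemma act_char_characters:
  assumes \<sigma>: "\<sigma> \<in> Gal" and chi: "chi \<in> characters \<iota>"
  shows "act_char \<sigma> chi \<in> characters \<iota>"
proof (rule charactersI)
  let ?s = "inv_into UNIV \<sigma>"
  have s: "?s \<in> Gal" using \<sigma> by (rule inv_into_galois_group)
  note chi' = charactersD[OF chi] and z = galois_group_zero[OF s]
  show "norm (act_char \<sigma> chi x) = 1" if "x \<noteq> 0" for x
    using that by (simp add: act_char_def chi' z)
  show "act_char \<sigma> chi (x * y) = act_char \<sigma> chi x * act_char \<sigma> chi y" if "x \<noteq> 0" "y \<noteq> 0" for x y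
    using that s chi'(2)[of "?s x" "?s y"] by (simp add: act_char_def z galois_group_iff)
  show "act_char \<sigma> chi \<in> extensional (- {0})"
    using chi'(4) by (simp add: act_char_def z extensional_def)
  show "act_char \<sigma> chi (\<iota> \<zeta>) = \<zeta>" if "\<zeta> \<in> carrier roots_of_unity_group" for \<zeta>
    using emb_root(2)[OF that] s chi'(5)[OF that] by (simp add: act_char_def galois_group_iff)
qed

text \<open>\<open>x\<close> is a root of a nonzero polynomial whose coefficients every automorphism
  fixes, so the conjugates of \<open>x\<close> are among its finitely many roots.\<close>

lemma finite_galois_orbit: "finite ((\<lambda>\<sigma>. \<sigma> x) ` Gal)"
proof -
  interpret algebraic_closure "ring_of_type_algebra :: 'a ring" F by (rule closure)
  have "(algebraic over F) x" by (rule algebraic_extension) simp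
  then obtain p where p: "p \<in> carrier (F [X]\<^bsub>ring_of_type_algebra\<^esub>)" "p \<noteq> []" "eval p x = 0"
    using algebraicE[OF subfieldE(1)[OF subfield_axioms], of x] by auto
  note eval = eval_ring_of_type_algebra
  have "set p \<subseteq> F" "hd p \<noteq> 0"
    using p(1,2) by (auto simp: polynomial_def simp flip: univ_poly_carrier)
  \<comment> \<open>The head of the list is the leading coefficient, which sits at
    \<open>length p - 1\<close> after reversal and certifies that the polynomial is nonzero.\<close>
  have "poly.coeff (Poly (rev p)) (length p - 1) \<noteq> 0"
    using \<open>hd p \<noteq> 0\<close> p(2) by (cases p) (auto simp: nth_default_append)
  then have "Poly (rev p) \<noteq> 0" by (metis coeff_0)
  then have "finite {y. poly (Poly (rev p)) y = 0}" by (rule poly_roots_finite)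
  moreover have "poly (Poly (rev p)) (\<sigma> x) = 0" if \<sigma>: "\<sigma> \<in> Gal" for \<sigma>
  proof -
    have pow: "\<sigma> (y ^ n) = \<sigma> y ^ n" for y n
      using \<sigma> by (induction n) (auto simp: galois_group_iff)
    have "\<sigma> (poly (Poly (rev q)) x) = poly (Poly (rev q)) (\<sigma> x)" if "set q \<subseteq> F" for q
      using that \<sigma> by (induction q)
        (auto simp: galois_group_zero galois_group_iff pow Poly_snoc poly_monom)
    from this[OF \<open>set p \<subseteq> F\<close>] show ?thesis using p(3) \<sigma> by (simp add: galois_group_zero eval)
  qed
  ultimately show ?thesis by (auto elim: finite_subset[rotated])
qed

end

section \<open>Freeness of the Galois action\<close>

context cyclotomic_closure
begin

definition galois_orbit :: "'a \<Rightarrow> 'a set" where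
  "galois_orbit x = (\<lambda>\<sigma>. \<sigma> x) ` Gal"

text \<open>One period for all automorphisms at once: each returns \<open>x\<close> to itself after
  at most \<open>card (galois_orbit x)\<close> steps, and every such number divides the
  factorial.\<close>

definition exponent :: "'a \<Rightarrow> nat" where
  "exponent x = fact (card (galois_orbit x))"

definition unit_root :: "nat \<Rightarrow> complex" where
  "unit_root N = cis (2 * pi / of_nat N)"

text \<open>The second set contains the Lagrange resolvents of \<open>x\<close> under every \<open>\<sigma> \<in> Gal\<close>: take
  \<open>s i = (\<sigma> ^^ i) x\<close>.\<close>

definition probes :: "'a \<Rightarrow> 'a set" where
  "probes x = (galois_orbit x \<union>
     (\<lambda>(k, s). \<Sum>i<exponent x. \<iota> (unit_root (exponent x)) ^ (k * i) * s i) `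
       ({..<exponent x} \<times> ({..<exponent x} \<rightarrow>\<^sub>E galois_orbit x))) - {0}"

text \<open>A lower bound for the distance from 1 of the nontrivial roots of unity that can occur as
  eigenvalues. If a character changes by less at an eigenvector, the eigenvalue is 1. The inserted 1
  keeps the set nonempty when \<open>exponent x = 1\<close>.\<close>

definition gap :: "'a \<Rightarrow> real" where
  "gap x = Min (insert 1 ((\<lambda>k. norm (unit_root (exponent x) ^ k - 1)) ` {1..<exponent x}))"

lemma exponent_pos: "exponent x > 0"
  by (simp add: exponent_def)

lemma finite_probes: "finite (probes x)"
  using finite_galois_orbit[of x] by (auto simp: probes_def galois_orbit_def intro!: finite_PiE)

lemma galois_orbit_self: "x \<in> galois_orbit x"
  unfolding galois_orbit_def by (rule image_eqI[of _ _ id]) (auto simp: galois_group_iff)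

lemma galois_orbit_closed:
  assumes \<sigma>: "\<sigma> \<in> Gal" and y: "y \<in> galois_orbit x"
  shows "\<sigma> y \<in> galois_orbit x"
proof -
  obtain \<tau> where "\<tau> \<in> Gal" "y = \<tau> x" using y by (auto simp: galois_orbit_def)
  then show ?thesis
    unfolding galois_orbit_def using galois_group_comp[OF \<sigma>] by (intro image_eqI[of _ _ "\<sigma> \<circ> \<tau>"]) auto
qed

lemma probes_self: "x \<noteq> 0 \<Longrightarrow> x \<in> probes x"
  by (auto simp: probes_def galois_orbit_self)

text \<open>The index functions in \<open>probes\<close> are extensional, which keeps that set
  finite; so \<open>s\<close> is first restricted.\<close>

lemma resolvent_mem_probes:
  assumes "k < exponent x" "\<And>i. i < exponent x \<Longrightarrow> s i \<in> galois_orbit x"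
    and "y = (\<Sum>i<exponent x. \<iota> (unit_root (exponent x)) ^ (k * i) * s i)" "y \<noteq> 0"
  shows "y \<in> probes x"
proof -
  let ?s = "restrict s {..<exponent x}"
  have "(k, ?s) \<in> {..<exponent x} \<times> ({..<exponent x} \<rightarrow>\<^sub>E galois_orbit x)"
    using assms(1,2) by simp
  moreover have "y = (\<lambda>(k, s). \<Sum>i<exponent x. \<iota> (unit_root (exponent x)) ^ (k * i) * s i) (k, ?s)"
    by (simp add: assms(3))
  ultimately show ?thesis using assms(4) unfolding probes_def by blast
qed

lemma galois_group_funpow: "\<sigma> \<in> Gal \<Longrightarrow> \<sigma> ^^ n \<in> Gal"
  by (induction n) (auto simp: galois_group_iff bij_comp)

lemma unit_root:
  assumes "N > 0"
  shows "unit_root N \<in> carrier roots_of_unity_group" "unit_root N ^ N = 1"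
    "0 < k \<Longrightarrow> k < N \<Longrightarrow> unit_root N ^ k \<noteq> 1"
proof -
  show 1: "unit_root N ^ N = 1"
    using assms by (simp add: unit_root_def Complex.DeMoivre)
  then show "unit_root N \<in> carrier roots_of_unity_group"
    using assms by auto
  show "unit_root N ^ k \<noteq> 1" if "0 < k" "k < N"
  proof
    assume "unit_root N ^ k = 1"
    then have "cis (2 * pi * (k / N)) = 1" by (simp add: unit_root_def Complex.DeMoivre mult_ac)
    then have "real k / real N \<in> \<int>" unfolding cis_2pi_eq_1_iff .
    then obtain n where n: "real k / real N = of_int n" by (auto elim: Ints_cases)
    have "0 < real k / real N" "real k / real N < 1" using that by auto
    then have "0 < real_of_int n" "real_of_int n < 1" unfolding n .
    then show False by simp
  qed
qed

lemma galois_group_sum: "\<sigma> \<in> Gal \<Longrightarrow> \<sigma> (\<Sum>i\<in>A. f i) = (\<Sum>i\<in>A. \<sigma> (f i))"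
  by (induction A rule: infinite_finite_induct) (auto simp: galois_group_zero galois_group_iff)

lemma galois_group_power: "\<sigma> \<in> Gal \<Longrightarrow> \<sigma> (x ^ n) = \<sigma> x ^ n"
  by (induction n) (auto simp: galois_group_iff)

lemma galois_group_fixes_emb:
  assumes "\<sigma> \<in> Gal" "\<zeta> \<in> carrier roots_of_unity_group"
  shows "\<sigma> (\<iota> \<zeta>) = \<iota> \<zeta>"
  using assms emb_root(2) by (auto simp: galois_group_iff)

text \<open>Automorphisms fix the root of unity and permute the orbit values \<open>s i\<close>.
  Admitting every orbit-valued \<open>s\<close> in \<open>probes\<close> makes this immediate; it is
  what renders nearness Galois-invariant in \<open>near_act\<close>.\<close>

lemma probes_closed:
  assumes \<sigma>: "\<sigma> \<in> Gal" and y: "y \<in> probes x"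
  shows "\<sigma> y \<in> probes x"
proof (cases "y \<in> galois_orbit x")
  case True
  then show ?thesis using \<sigma> y galois_orbit_closed by (auto simp: probes_def galois_group_zero)
next
  case False
  let ?N = "exponent x" and ?w = "\<iota> (unit_root (exponent x))"
  obtain k s where ks: "k < ?N" "s \<in> {..<?N} \<rightarrow>\<^sub>E galois_orbit x" "y = (\<Sum>i<?N. ?w ^ (k * i) * s i)"
    using y False by (auto simp: probes_def)
  have "\<sigma> (?w ^ (k * i) * s i) = ?w ^ (k * i) * \<sigma> (s i)" for i
    using \<sigma> galois_group_fixes_emb[OF \<sigma> unit_root(1)[OF exponent_pos]]
    by (auto simp: galois_group_iff galois_group_power[OF \<sigma>])
  then have "\<sigma> y = (\<Sum>i<?N. ?w ^ (k * i) * \<sigma> (s i))"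
    unfolding ks(3) galois_group_sum[OF \<sigma>] by simp
  moreover have "\<sigma> (s i) \<in> galois_orbit x" if "i < ?N" for i
    using ks(2) that by (intro galois_orbit_closed[OF \<sigma>]) auto
  moreover have "\<sigma> y \<noteq> 0" using y \<sigma> by (auto simp: probes_def galois_group_zero)
  ultimately show ?thesis using ks(1) by (intro resolvent_mem_probes)
qed

lemma gap_pos: "gap x > 0"
  using unit_root(3)[OF exponent_pos, of _ x] by (auto simp: gap_def Min_gr_iff)

lemma gap_le: "0 < k \<Longrightarrow> k < exponent x \<Longrightarrow> gap x \<le> norm (unit_root (exponent x) ^ k - 1)"
  unfolding gap_def by (intro Min_le) auto

text \<open>Pigeonhole on \<open>card ?O + 1\<close> iterates: two coincide, and cancelling leaves a
  period \<open>j - i\<close> between 1 and the orbit size, which divides the factorial.\<close>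

lemma funpow_exponent:
  assumes \<sigma>: "\<sigma> \<in> Gal"
  shows "(\<sigma> ^^ exponent x) x = x"
proof -
  let ?O = "galois_orbit x"
  have O: "(\<sigma> ^^ i) x \<in> ?O" for i
    using galois_group_funpow[OF \<sigma>] by (auto simp: galois_orbit_def)
  have fin: "finite ?O" using finite_galois_orbit by (simp add: galois_orbit_def)
  have "\<not> inj_on (\<lambda>i. (\<sigma> ^^ i) x) {..card ?O}"
  proof
    assume "inj_on (\<lambda>i. (\<sigma> ^^ i) x) {..card ?O}"
    then have "card {..card ?O} \<le> card ?O"
      by (rule card_inj_on_le) (use O fin in auto)
    then show False by simp
  qed
  then obtain i j where ij: "i < j" "j \<le> card ?O" "(\<sigma> ^^ i) x = (\<sigma> ^^ j) x"
    unfolding inj_on_def by (metis atMost_iff linorder_neqE_nat)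
  have "(\<sigma> ^^ j) x = (\<sigma> ^^ i) ((\<sigma> ^^ (j - i)) x)"
    using ij(1) funpow_add[of i "j - i" \<sigma>] by simp
  moreover have "inj (\<sigma> ^^ i)"
    using galois_group_funpow[OF \<sigma>, of i] by (auto simp: galois_group_iff bij_def)
  ultimately have fx: "(\<sigma> ^^ (j - i)) x = x" using ij(3) by (metis injD)
  have "j - i dvd exponent x"
    unfolding exponent_def using ij by (intro dvd_fact) auto
  then obtain m where m: "exponent x = (j - i) * m" by auto
  have "((\<sigma> ^^ (j - i)) ^^ m) x = x" by (induction m) (simp_all add: fx)
  then show ?thesis by (simp add: m funpow_mult)
qed

text \<open>If \<open>\<sigma>\<close> moves \<open>x\<close>, then one of the Lagrange resolvents \<open>y k\<close> with \<open>k \<noteq> 0\<close> does not vanish,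
  and it is an eigenvector of \<open>\<sigma>\<close> for a nontrivial root of unity.\<close>

lemma galois_group_fixes_of_gap:
  assumes chi: "chi \<in> characters \<iota>" and \<sigma>: "\<sigma> \<in> Gal"
    and close: "\<And>y. y \<in> probes x \<Longrightarrow> norm (chi (\<sigma> y) - chi y) < gap x"
  shows "\<sigma> x = x"
proof (rule ccontr)
  assume moved: "\<sigma> x \<noteq> x"
  define N where "N = exponent x"
  define u where "u = unit_root N"
  define w where "w = \<iota> u"
  have N: "N > 0" by (simp add: N_def exponent_pos)
  have u: "u \<in> carrier roots_of_unity_group" "u ^ N = 1" "\<And>k. 0 < k \<Longrightarrow> k < N \<Longrightarrow> u ^ k \<noteq> 1"
    using unit_root[OF N] by (auto simp: u_def)
  note chi' = charactersD[OF chi]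
  have w0: "w \<noteq> 0" unfolding w_def using u(1) by (rule emb_root_neq_0)
  have chiw: "chi (w ^ k) = u ^ k" for k
    using chi'(5)[OF emb_root_power(2)[OF u(1)]] by (simp add: w_def emb_root_power(1)[OF u(1)])
  have wN: "w ^ N = 1"
    using emb_root_power(1)[OF u(1), of N] u(2) by (simp add: w_def emb_hom(1))
  \<comment> \<open>Faithfulness of the embedding on roots of unity is read off from
    \<open>chi\<close>, which sends \<open>w ^ i\<close> back to \<open>u ^ i\<close>.\<close>
  have w1: "w ^ i \<noteq> 1" if "0 < i" "i < N" for i
    using chiw[of i] u(3)[OF that] chi'(3) by auto
  have \<sigma>w: "\<sigma> (w ^ k) = w ^ k" for k
    unfolding w_def galois_group_power[OF \<sigma>] galois_group_fixes_emb[OF \<sigma> u(1)] ..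
  have \<sigma>m: "\<sigma> (a * b) = \<sigma> a * \<sigma> b" for a b using \<sigma> by (auto simp: galois_group_iff)
  define y where "y k = (\<Sum>i<N. w ^ (k * i) * (\<sigma> ^^ i) x)" for k
  \<comment> \<open>Applying \<open>\<sigma>\<close> and multiplying by \<open>w ^ k\<close> shifts
    the terms by one; term \<open>N\<close> equals term 0 since both \<open>w\<close> and the
    iterates at \<open>x\<close> have period \<open>N\<close>.\<close>
  have eig: "w ^ k * \<sigma> (y k) = y k" for k
  proof -
    let ?t = "\<lambda>i. w ^ (k * i) * (\<sigma> ^^ i) x"
    have "w ^ k * \<sigma> (y k) = (\<Sum>i<N. ?t (Suc i))"
      unfolding y_def galois_group_sum[OF \<sigma>] sum_distrib_left
      by (intro sum.cong) (auto simp: \<sigma>m \<sigma>w power_add)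
    moreover have "(\<Sum>i<N. ?t (Suc i)) + ?t 0 = (\<Sum>i<N. ?t i) + ?t N"
      using sum.lessThan_Suc_shift[of ?t N] by (simp add: add.commute)
    moreover have "?t N = ?t 0"
      using funpow_exponent[OF \<sigma>, of x] wN by (simp add: N_def mult.commute[of k] power_mult)
    ultimately show ?thesis by (simp add: y_def)
  qed
  \<comment> \<open>Otherwise Fourier inversion leaves \<open>y 0 = of_nat N * x\<close>. But
    \<open>y 0\<close> is fixed by \<open>\<sigma>\<close> (the case \<open>k = 0\<close> of
    \<open>eig\<close>), and cancelling \<open>N\<close> would make \<open>x\<close> fixed.\<close>
  have "\<exists>k. 0 < k \<and> k < N \<and> y k \<noteq> 0"
  proof (rule ccontr)
    assume "\<not> ?thesis"
    then have zero: "y k = 0" if "0 < k" "k < N" for k using that by blast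
    have "(\<Sum>k<N. y k) = (\<Sum>i<N. \<Sum>k<N. w ^ (k * i) * (\<sigma> ^^ i) x)"
      unfolding y_def by (rule sum.swap)
    also have "\<dots> = (\<Sum>i<N. (\<Sum>k<N. (w ^ i) ^ k) * (\<sigma> ^^ i) x)"
      by (simp add: sum_distrib_right mult.commute[of _ "_ :: nat"] flip: power_mult)
    also have "\<dots> = (\<Sum>i<N. if i = 0 then of_nat N * x else 0)"
    proof (rule sum.cong)
      fix i assume "i \<in> {..<N}"
      then show "(\<Sum>k<N. (w ^ i) ^ k) * (\<sigma> ^^ i) x = (if i = 0 then of_nat N * x else 0)"
        using geometric_sum[of "w ^ i" N] w1[of i] wN
        by (auto simp: power_mult[symmetric] mult.commute[of i]) (simp add: power_mult)
    qed simp
    also have "\<dots> = of_nat N * x" using N by (simp add: sum.delta)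
    finally have "(\<Sum>k<N. y k) = of_nat N * x" .
    moreover have "(\<Sum>k<N. y k) = (\<Sum>k<N. if k = 0 then y 0 else 0)"
      by (intro sum.cong) (auto simp: zero)
    ultimately have y0: "y 0 = of_nat N * x" using N by (simp add: sum.delta)
    have "\<sigma> (of_nat N * x) = of_nat N * x" using eig[of 0] by (simp add: y0)
    moreover have "\<sigma> (of_nat n) = of_nat n" for n
      using \<sigma> by (induction n) (auto simp: galois_group_zero galois_group_iff)
    ultimately show False using moved of_nat_neq_0[OF N] by (simp add: \<sigma>m)
  qed
  then obtain k where k: "0 < k" "k < N" "y k \<noteq> 0" by blast
  have "(\<sigma> ^^ i) x \<in> galois_orbit x" for i
    using galois_group_funpow[OF \<sigma>] by (auto simp: galois_orbit_def)
  then have "y k \<in> probes x"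
    using k unfolding y_def N_def u_def w_def by (intro resolvent_mem_probes) auto
  then have "norm (chi (\<sigma> (y k)) - chi (y k)) < gap x" by (rule close)
  \<comment> \<open>The two values differ by the factor \<open>u ^ k\<close>, so their distance is
    that of \<open>u ^ k\<close> from 1, at least \<open>gap x\<close>.\<close>
  moreover have "chi (y k) = u ^ k * chi (\<sigma> (y k))"
    using chi'(2)[of "w ^ k" "\<sigma> (y k)"] k(3) w0 by (simp add: eig chiw galois_group_zero[OF \<sigma>])
  then have "chi (\<sigma> (y k)) - chi (y k) = - ((u ^ k - 1) * chi (\<sigma> (y k)))"
    by (simp add: algebra_simps)
  then have "norm (chi (\<sigma> (y k)) - chi (y k)) = norm (u ^ k - 1)"
    using k(3) by (simp add: norm_mult chi'(1) galois_group_zero[OF \<sigma>])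
  ultimately show False using gap_le[of k x] k by (simp add: u_def N_def)
qed

text \<open>The automorphism \<open>?\<rho>\<close> leaves \<open>chi\<close> unchanged, so the
  closeness required at the probes of \<open>x\<close> holds with distance 0, for every
  \<open>x\<close>.\<close>

lemma act_char_free:
  assumes "chi \<in> characters \<iota>" "\<sigma> \<in> Gal" "\<tau> \<in> Gal" "act_char \<sigma> chi = act_char \<tau> chi"
  shows "\<sigma> = \<tau>"
proof
  fix x
  let ?\<rho> = "inv_into UNIV \<sigma> \<circ> \<tau>"
  have \<rho>: "?\<rho> \<in> Gal" using assms by (intro galois_group_comp inv_into_galois_group)
  have "chi (?\<rho> y) = chi y" for y
  proof -
    have "act_char \<tau> chi (\<tau> y) = chi y" using assms by (simp add: act_char_apply)
    moreover have "act_char \<sigma> chi (\<tau> y) = chi (?\<rho> y)" by (simp add: act_char_def)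
    ultimately show ?thesis using assms(4) by simp
  qed
  then have "?\<rho> x = x"
    using galois_group_fixes_of_gap[OF assms(1) \<rho>, of x] gap_pos by simp
  then show "\<sigma> x = \<tau> x" by (metis assms(2) comp_apply galois_group_inv_into_cancel(1))
qed

end

section \<open>Chains in convex sets\<close>

lemma segment_point_mem:
  fixes w :: "'w::real_normed_vector"
  assumes "convex W" "w0 \<in> W" "w \<in> W" "0 \<le> t" "t \<le> 1"
  shows "w0 + t *\<^sub>R (w - w0) \<in> W"
proof -
  have "w0 + t *\<^sub>R (w - w0) = (1 - t) *\<^sub>R w0 + t *\<^sub>R w"
    by (simp add: algebra_simps)
  then show ?thesis using assms by (simp add: convexD)
qed

lemma bounded_steps:
  fixes W :: "'w::real_normed_vector set"
  assumes "bounded W" "(\<eta>::real) > 0"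
  obtains N :: nat where "N > 0" "\<And>w. w \<in> W \<Longrightarrow> norm (w - w0) / N < \<eta>"
proof -
  obtain B where B: "\<And>w. w \<in> W \<Longrightarrow> dist w0 w \<le> B"
    using assms(1) bounded_any_center by blast
  obtain N :: nat where N: "N > max 0 (B / \<eta>)" using reals_Archimedean2 by blast
  show ?thesis
  proof
    show "N > 0" using N by simp
    have "B < N * \<eta>" using N assms(2) by (simp add: divide_less_eq)
    show "norm (w - w0) / N < \<eta>" if "w \<in> W" for w
      using B[OF that] \<open>B < N * \<eta>\<close> \<open>N > 0\<close>
      by (simp add: divide_less_eq dist_norm norm_minus_commute mult.commute)
  qed
qed

text \<open>Equal steps along the segment from \<open>w0\<close> to \<open>w\<close>. This stands in
  for connectedness in the uniqueness of lifts, where a property propagates over a uniform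
  distance.\<close>

lemma convex_chain_induct:
  fixes W :: "'w::real_normed_vector set"
  assumes "convex W" "bounded W" "w0 \<in> W" "w \<in> W" "\<eta> > 0" "P w0"
    and step: "\<And>u v. u \<in> W \<Longrightarrow> v \<in> W \<Longrightarrow> dist u v < \<eta> \<Longrightarrow> P u \<Longrightarrow> P v"
  shows "P w"
proof -
  obtain N :: nat where N: "N > 0" "norm (w - w0) / N < \<eta>"
    using bounded_steps[OF assms(2,5)] assms(4) by metis
  define p where "p k = w0 + (real k / N) *\<^sub>R (w - w0)" for k :: nat
  have p: "p k \<in> W" if "k \<le> N" for k
    unfolding p_def using that N assms by (intro segment_point_mem) (auto simp: divide_le_eq)
  have "P (p k)" if "k \<le> N" for k
    using that
  proof (induction k)
    case (Suc k)
    have "p (Suc k) - p k = (1 / N) *\<^sub>R (w - w0)"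
      by (simp add: p_def add_divide_distrib flip: scaleR_left_diff_distrib)
    then have "dist (p k) (p (Suc k)) < \<eta>"
      using N by (simp add: dist_norm norm_minus_commute[of "p k"])
    then show ?case using Suc step[of "p k" "p (Suc k)"] p by auto
  qed (simp add: p_def assms)
  from this[of N] show ?thesis using N by (simp add: p_def)
qed

text \<open>\<open>R\<close> is a tolerance relation, and \<open>tri\<close> gives transitivity only
  when the outer points lie over nearby \<open>u\<close>, \<open>u'\<close>. The value at
  \<open>w\<close> is found by \<open>N\<close> steps along the segment from \<open>w0\<close>. For
  close targets the two segments stay close at equal times, so their chains are compared rung by
  rung, like a ladder. Bounding steps and targets by \<open>\<eta> / 2\<close> keeps the diagonals
  of the ladder below \<open>\<eta>\<close>.\<close>

lemma convex_chain_section: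
  fixes W :: "'w::real_normed_vector set" and f :: "'w \<Rightarrow> 'x set"
  assumes W: "convex W" "bounded W" "w0 \<in> W" and c: "c \<in> f w0" and \<eta>: "\<eta> > 0"
    and refl: "\<And>x. R x x" and sym: "\<And>x y. R x y \<Longrightarrow> R y x"
    and ex: "\<And>u v x. u \<in> W \<Longrightarrow> v \<in> W \<Longrightarrow> dist u v < \<eta> \<Longrightarrow> x \<in> f u \<Longrightarrow> \<exists>y\<in>f v. R x y"
    and tri: "\<And>u v u' x y z. u \<in> W \<Longrightarrow> v \<in> W \<Longrightarrow> u' \<in> W \<Longrightarrow> x \<in> f u \<Longrightarrow> y \<in> f v \<Longrightarrow> z \<in> f u' \<Longrightarrow>
      R x y \<Longrightarrow> R y z \<Longrightarrow> dist u u' < \<eta> \<Longrightarrow> R x z"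
  obtains s where "\<And>w. w \<in> W \<Longrightarrow> s w \<in> f w" "R (s w0) c"
    "\<And>u v. u \<in> W \<Longrightarrow> v \<in> W \<Longrightarrow> dist u v < \<eta> / 2 \<Longrightarrow> R (s u) (s v)"
proof -
  obtain N :: nat where N: "N > 0" "\<And>w. w \<in> W \<Longrightarrow> norm (w - w0) / N < \<eta> / 2"
    using bounded_steps[OF W(2), of "\<eta> / 2"] \<eta> by (metis half_gt_zero)
  define p where "p w k = w0 + (real k / N) *\<^sub>R (w - w0)" for w and k :: nat
  have p: "p w k \<in> W" if "k \<le> N" "w \<in> W" for k w
    unfolding p_def using that N W by (intro segment_point_mem) (auto simp: divide_le_eq)
  have pN: "p w N = w" for w using N by (simp add: p_def)
  have p_step: "dist (p w k) (p w (Suc k)) < \<eta> / 2" if "w \<in> W" for w k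
  proof -
    have "p w (Suc k) - p w k = (1 / N) *\<^sub>R (w - w0)"
      by (simp add: p_def add_divide_distrib flip: scaleR_left_diff_distrib)
    then show ?thesis
      using N that by (simp add: dist_norm norm_minus_commute[of "p w k"])
  qed
  have p_dist: "dist (p u k) (p v k) \<le> dist u v" if "k \<le> N" for u v k
  proof -
    have "p u k - p v k = (real k / N) *\<^sub>R (u - v)"
      by (simp add: p_def algebra_simps)
    then have "dist (p u k) (p v k) = (real k / N) * dist u v" by (simp add: dist_norm)
    also have "\<dots> \<le> 1 * dist u v" using that N by (intro mult_right_mono) (auto simp: divide_le_eq)
    finally show ?thesis by simp
  qed
  define s where "s w = rec_nat c (\<lambda>k x. SOME y. y \<in> f (p w (Suc k)) \<and> R x y)" for w
  have s_Suc: "s w (Suc k) = (SOME y. y \<in> f (p w (Suc k)) \<and> R (s w k) y)" for w k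
    by (simp add: s_def)
  have s0: "s w 0 = c" for w by (simp add: s_def)
  have step: "s w (Suc k) \<in> f (p w (Suc k)) \<and> R (s w k) (s w (Suc k))"
    if "w \<in> W" "Suc k \<le> N" "s w k \<in> f (p w k)" for w k
  proof -
    have "\<exists>y\<in>f (p w (Suc k)). R (s w k) y"
      using ex[of "p w k" "p w (Suc k)" "s w k"] p that p_step[OF that(1), of k] \<eta> by auto
    then show ?thesis unfolding s_Suc by (metis (mono_tags, lifting) someI_ex)
  qed
  have s: "s w k \<in> f (p w k)" if "w \<in> W" "k \<le> N" for w k
    using that(2)
  proof (induction k)
    case 0 then show ?case using c by (simp add: s0 p_def)
  qed (use step that(1) in auto)
  have sR: "R (s w k) (s w (Suc k))" if "w \<in> W" "Suc k \<le> N" for w k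
    using step[OF that] s that by simp
  show ?thesis
  proof
    show "s w N \<in> f w" if "w \<in> W" for w using s[OF that, of N] by (simp add: pN)
    \<comment> \<open>The chain for \<open>w0\<close> never leaves this point, but the choices may
      move inside the fibre; only the relation to \<open>c\<close> is kept.\<close>
    have pw0: "p w0 k = w0" for k by (simp add: p_def)
    have "R (s w0 k) c" if "k \<le> N" for k
      using that
    proof (induction k)
      case (Suc k)
      then show ?case
        using tri[of w0 w0 w0 "s w0 (Suc k)" "s w0 k" c] W s[OF W(3), of k] s[OF W(3), of "Suc k"]
          sym[OF sR[OF W(3)]] c \<eta> by (simp add: pw0)
    qed (simp add: s0 refl)
    then show "R (s w0 N) c" by simp
    fix u v assume uv: "u \<in> W" "v \<in> W" "dist u v < \<eta> / 2"
    have "R (s u k) (s v k)" if "k \<le> N" for k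
      using that
    proof (induction k)
      case (Suc k)
      then have k: "k \<le> N" by simp
      have "dist (p u (Suc k)) (p v k) < \<eta>"
        using dist_triangle[of "p u (Suc k)" "p v k" "p u k"] p_step[OF uv(1), of k] p_dist[OF k, of u v] uv(3)
        by (simp add: dist_commute)
      then have "R (s u (Suc k)) (s v k)"
        by (intro tri[OF p[OF Suc.prems uv(1)] p[OF k uv(1)] p[OF k uv(2)] s[OF uv(1) Suc.prems]
              s[OF uv(1) k] s[OF uv(2) k] sym[OF sR[OF uv(1) Suc.prems]] Suc.IH[OF k]])
      moreover have "dist (p u (Suc k)) (p v (Suc k)) < \<eta>"
        using p_dist[OF Suc.prems, of u v] uv(3) \<eta> by simp
      ultimately show ?case
        by (intro tri[OF p[OF Suc.prems uv(1)] p[OF k uv(2)] p[OF Suc.prems uv(2)] s[OF uv(1) Suc.prems]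
              s[OF uv(2) k] s[OF uv(2) Suc.prems] _ sR[OF uv(2) Suc.prems]])
    qed (simp add: s0 refl)
    from this[of N] show "R (s u N) (s v N)" by simp
  qed
qed

section \<open>Unique lifting to the character space\<close>

context cyclotomic_closure
begin

definition fixing :: "'a set \<Rightarrow> ('a \<Rightarrow> 'a) set" where
  "fixing T = {\<sigma> \<in> Gal. \<forall>x\<in>T. \<sigma> x = x}"

text \<open>Distances are scaled by \<open>gap x\<close> so that one threshold,
  \<open>e = 1\<close>, serves \<open>galois_group_fixes_of_gap\<close> for all \<open>x\<close> in
  \<open>T\<close>.\<close>

definition near :: "'a set \<Rightarrow> real \<Rightarrow> ('a \<Rightarrow> complex) \<Rightarrow> ('a \<Rightarrow> complex) \<Rightarrow> bool" where
  "near T e chi psi \<longleftrightarrow> (\<forall>x\<in>T. \<forall>y\<in>probes x. norm (chi y - psi y) < e * gap x)"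

definition near_mod :: "'a set \<Rightarrow> real \<Rightarrow> ('a \<Rightarrow> complex) \<Rightarrow> ('a \<Rightarrow> complex) \<Rightarrow> bool" where
  "near_mod T e chi psi \<longleftrightarrow> (\<exists>\<sigma>\<in>fixing T. near T e chi (act_char \<sigma> psi))"

text \<open>Equality in the quotient of the character space by \<open>fixing T\<close>, a stage
  between that space and the orbit space.\<close>

definition eq_mod :: "'a set \<Rightarrow> ('a \<Rightarrow> complex) \<Rightarrow> ('a \<Rightarrow> complex) \<Rightarrow> bool" where
  "eq_mod T chi psi \<longleftrightarrow> (\<exists>\<sigma>\<in>fixing T. chi = act_char \<sigma> psi)"

section \<open>Nearness and equality modulo the stabiliser of a set\<close>

lemma fixing_Gal: "\<sigma> \<in> fixing T \<Longrightarrow> \<sigma> \<in> Gal" by (simp add: fixing_def)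

lemmas act_comp = act_char_comp[where F = F]
lemmas act_inv_cancel = act_char_inv_cancel[where F = F]
lemmas inv_cancel = galois_group_inv_into_cancel[where F = F]

lemma fixing_id: "id \<in> fixing T" by (simp add: fixing_def galois_group_iff)

lemma fixing_comp: "\<sigma> \<in> fixing T \<Longrightarrow> \<tau> \<in> fixing T \<Longrightarrow> \<sigma> \<circ> \<tau> \<in> fixing T"
  by (simp add: fixing_def galois_group_comp)

lemma fixing_inv: "\<sigma> \<in> fixing T \<Longrightarrow> inv_into UNIV \<sigma> \<in> fixing T"
  unfolding fixing_def using inv_into_galois_group by (auto intro: inv_into_f_eq simp: galois_group_iff bij_def)

lemma fixing_mono: "T \<subseteq> T' \<Longrightarrow> fixing T' \<subseteq> fixing T" by (auto simp: fixing_def)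

lemma near_sym: "near T e chi psi \<Longrightarrow> near T e psi chi"
  by (simp add: near_def norm_minus_commute)

lemma near_trans:
  assumes "near T d chi psi" "near T e psi phi" shows "near T (d + e) chi phi"
  unfolding near_def
proof (intro ballI)
  fix x y assume "x \<in> T" "y \<in> probes x"
  then have "norm (chi y - psi y) < d * gap x" "norm (psi y - phi y) < e * gap x"
    using assms by (auto simp: near_def)
  then show "norm (chi y - phi y) < (d + e) * gap x"
    using norm_triangle_ineq[of "chi y - psi y" "psi y - phi y"] by (simp add: algebra_simps)
qed

lemma near_refl: "e > 0 \<Longrightarrow> near T e chi chi"
  by (simp add: near_def gap_pos)

lemma near_mono:
  assumes "near T' d chi psi" "T \<subseteq> T'" "d \<le> e" shows "near T e chi psi"
  unfolding near_def
proof (intro ballI)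
  fix x y assume "x \<in> T" "y \<in> probes x"
  then have "norm (chi y - psi y) < d * gap x"
    using assms by (auto simp: near_def)
  also have "\<dots> \<le> e * gap x" using assms(3) gap_pos[of x] by simp
  finally show "norm (chi y - psi y) < e * gap x" .
qed

text \<open>This holds for all of \<open>Gal\<close> and not just for \<open>fixing T\<close>,
  because each \<open>probes x\<close> is Galois-stable.\<close>

lemma near_act:
  assumes "\<sigma> \<in> Gal" "near T e chi psi"
  shows "near T e (act_char \<sigma> chi) (act_char \<sigma> psi)"
  using assms probes_closed[OF inv_into_galois_group] by (auto simp: near_def act_char_def)

lemma near_mod_act_iff:
  assumes \<sigma>: "\<sigma> \<in> fixing T"
  shows "near_mod T e (act_char \<sigma> chi) psi \<longleftrightarrow> near_mod T e chi psi"
proof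
  assume "near_mod T e chi psi"
  then obtain \<tau> where "\<tau> \<in> fixing T" "near T e chi (act_char \<tau> psi)"
    by (auto simp: near_mod_def)
  then show "near_mod T e (act_char \<sigma> chi) psi"
    unfolding near_mod_def using \<sigma> near_act[of \<sigma> T e chi "act_char \<tau> psi"]
    by (intro bexI[of _ "\<sigma> \<circ> \<tau>"]) (auto simp: fixing_Gal act_comp fixing_comp)
next
  assume "near_mod T e (act_char \<sigma> chi) psi"
  then obtain \<tau> where "\<tau> \<in> fixing T" "near T e (act_char \<sigma> chi) (act_char \<tau> psi)"
    by (auto simp: near_mod_def)
  then show "near_mod T e chi psi"
    unfolding near_mod_def using fixing_inv[OF \<sigma>] \<sigma>
      near_act[of "inv_into UNIV \<sigma>" T e "act_char \<sigma> chi" "act_char \<tau> psi"]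
    by (intro bexI[of _ "inv_into UNIV \<sigma> \<circ> \<tau>"])
      (auto simp: fixing_Gal act_comp fixing_comp act_inv_cancel)
qed

lemma near_mod_sym:
  assumes "near_mod T e chi psi" shows "near_mod T e psi chi"
proof -
  obtain \<sigma> where \<sigma>: "\<sigma> \<in> fixing T" "near T e chi (act_char \<sigma> psi)"
    using assms by (auto simp: near_mod_def)
  then have "near_mod T e (act_char \<sigma> psi) chi"
    unfolding near_mod_def using near_sym fixing_id by (intro bexI[of _ id]) auto
  then show ?thesis using \<sigma>(1) by (simp add: near_mod_act_iff)
qed

lemma near_mod_trans:
  assumes "near_mod T d chi psi" "near_mod T e psi phi" shows "near_mod T (d + e) chi phi"
proof -
  obtain \<sigma> \<tau> where \<sigma>: "\<sigma> \<in> fixing T" "near T d chi (act_char \<sigma> psi)"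
    and \<tau>: "\<tau> \<in> fixing T" "near T e psi (act_char \<tau> phi)"
    using assms by (auto simp: near_mod_def)
  have "near T e (act_char \<sigma> psi) (act_char (\<sigma> \<circ> \<tau>) phi)"
    using near_act[OF fixing_Gal[OF \<sigma>(1)] \<tau>(2)] \<sigma> \<tau> by (simp add: act_comp fixing_Gal)
  then have "near T (d + e) chi (act_char (\<sigma> \<circ> \<tau>) phi)" using \<sigma>(2) near_trans by blast
  then show ?thesis using \<sigma> \<tau> fixing_comp unfolding near_mod_def by blast
qed

lemma near_imp_near_mod: "near T e chi psi \<Longrightarrow> near_mod T e chi psi"
  unfolding near_mod_def using fixing_id by (intro bexI[of _ id]) auto

lemma near_mod_mono:
  "near_mod T' d chi psi \<Longrightarrow> T \<subseteq> T' \<Longrightarrow> d \<le> e \<Longrightarrow> near_mod T e chi psi"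
  using near_mono fixing_mono unfolding near_mod_def by blast

lemma eq_mod_near_mod: "eq_mod T chi psi \<Longrightarrow> near_mod T e psi phi \<Longrightarrow> near_mod T e chi phi"
  using near_mod_act_iff unfolding eq_mod_def by auto

lemma eq_mod_sym: "eq_mod T chi psi \<Longrightarrow> eq_mod T psi chi"
  unfolding eq_mod_def using fixing_inv fixing_Gal act_inv_cancel by metis

lemma eq_mod_trans: "eq_mod T chi psi \<Longrightarrow> eq_mod T psi phi \<Longrightarrow> eq_mod T chi phi"
  unfolding eq_mod_def using fixing_comp fixing_Gal act_comp by metis

lemma eq_mod_refl: "eq_mod T chi chi"
  unfolding eq_mod_def using fixing_id by (intro bexI[of _ id]) auto

text \<open>The value at a point of \<open>T\<close> survives the passage to the quotient by
  \<open>fixing T\<close>; this lets a lift for \<open>{x}\<close> determine the coordinate at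
  \<open>x\<close>.\<close>

lemma eq_mod_apply:
  assumes "eq_mod T chi psi" "x \<in> T" shows "chi x = psi x"
proof -
  obtain \<sigma> where \<sigma>: "\<sigma> \<in> fixing T" "chi = act_char \<sigma> psi" using assms by (auto simp: eq_mod_def)
  have "inv_into UNIV \<sigma> x = x" using fixing_inv[OF \<sigma>(1)] assms(2) by (simp add: fixing_def)
  then show ?thesis by (simp add: \<sigma> act_char_def)
qed

text \<open>Fibres become discrete modulo \<open>fixing T\<close>:
  \<open>\<tau> \<circ> \<sigma>\<close> displaces \<open>chi\<close> by less than the gap at every
  probe, so it fixes \<open>T\<close> by \<open>galois_group_fixes_of_gap\<close>, and then so does
  \<open>\<sigma>\<close>.\<close>

lemma near_mod_imp_eq_mod:
  assumes chi: "chi \<in> characters \<iota>" and psi: "psi \<in> char_orbit F chi" and near: "near_mod T 1 chi psi"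
  shows "eq_mod T psi chi"
proof -
  obtain \<sigma> where \<sigma>: "\<sigma> \<in> Gal" "psi = act_char \<sigma> chi"
    using psi by (auto simp: mem_char_orbit_iff)
  obtain \<tau> where \<tau>: "\<tau> \<in> fixing T" "near T 1 chi (act_char \<tau> psi)"
    using near by (auto simp: near_mod_def)
  let ?\<rho> = "inv_into UNIV (\<tau> \<circ> \<sigma>)"
  have \<tau>\<sigma>: "\<tau> \<circ> \<sigma> \<in> Gal" using \<sigma> \<tau> by (intro galois_group_comp) (auto simp: fixing_Gal)
  have \<rho>: "?\<rho> \<in> Gal" using \<tau>\<sigma> by (rule inv_into_galois_group)
  have "act_char \<tau> psi = act_char (\<tau> \<circ> \<sigma>) chi" using \<sigma> \<tau> by (simp add: act_comp fixing_Gal)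
  then have "near T 1 chi (chi \<circ> ?\<rho>)" using \<tau>(2) by (simp add: act_char_def)
  then have "?\<rho> x = x" if "x \<in> T" for x
    using that by (intro galois_group_fixes_of_gap[OF chi \<rho>]) (auto simp: near_def norm_minus_commute)
  then have "?\<rho> \<in> fixing T" using \<rho> by (simp add: fixing_def)
  then have "\<tau> \<circ> \<sigma> \<in> fixing T"
    using fixing_inv \<tau>\<sigma> by (metis galois_group_iff inv_inv_eq)
  then have "inv_into UNIV \<tau> \<circ> (\<tau> \<circ> \<sigma>) \<in> fixing T" using \<tau>(1) fixing_inv fixing_comp by blast
  moreover have "inv_into UNIV \<tau> \<circ> (\<tau> \<circ> \<sigma>) = \<sigma>"
    using \<tau>(1) by (simp add: fun_eq_iff fixing_def inv_cancel)
  ultimately show ?thesis using \<sigma>(2) by (auto simp: eq_mod_def)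
qed

text \<open>This replaces compactness of the Galois group.\<close>

lemma galois_group_local:
  assumes "\<And>T. finite T \<Longrightarrow> \<exists>\<tau>\<in>Gal. \<forall>x\<in>T. r x = \<tau> x"
  shows "r \<in> Gal"
  unfolding galois_group_iff
proof (intro conjI allI ballI)
  show "bij r"
  proof (rule bijI)
    show "inj r"
    proof (rule injI)
      fix x y assume "r x = r y"
      moreover obtain \<tau> where "\<tau> \<in> Gal" "r x = \<tau> x" "r y = \<tau> y" using assms[of "{x, y}"] by auto
      ultimately show "x = y" by (metis inv_cancel(2))
    qed
    have "\<exists>x. r x = z" for z
    proof -
      \<comment> \<open>The whole orbit of \<open>z\<close> is tested because it contains the
        preimage of \<open>z\<close> under whichever \<open>\<tau>\<close> agrees with
        \<open>r\<close> on it.\<close>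
      have "finite (galois_orbit z)" by (simp add: galois_orbit_def finite_galois_orbit)
      then obtain \<tau> where \<tau>: "\<tau> \<in> Gal" "\<And>x. x \<in> galois_orbit z \<Longrightarrow> r x = \<tau> x"
        using assms by metis
      have "inv_into UNIV \<tau> z \<in> galois_orbit z"
        using inv_into_galois_group[OF \<tau>(1)] by (auto simp: galois_orbit_def)
      then show ?thesis using \<tau> by (metis inv_cancel(1))
    qed
    then show "surj r" by (metis surjI)
  qed
  show "r (x + y) = r x + r y" for x y
    using assms[of "{x, y, x + y}"] by (auto simp: galois_group_iff)
  show "r (x * y) = r x * r y" for x y
    using assms[of "{x, y, x * y}"] by (auto simp: galois_group_iff)
  show "r 1 = 1"
    using assms[of "{1}"] by (auto simp: galois_group_iff)
  show "r x = x" if "x \<in> F" for x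
    using assms[of "{x}"] that by (auto simp: galois_group_iff)
qed

section \<open>The topology of the orbit space and maps into it\<close>

lemma topspace_orbit_space: "topspace (orbit_space F \<iota>) = char_orbit F ` characters \<iota>"
  by (simp add: orbit_space_def topspace_quotient_topology topspace_character_space)

lemma continuous_map_char_orbit: "continuous_map (character_space \<iota>) (orbit_space F \<iota>) (char_orbit F)"
  unfolding orbit_space_def by (intro quotient_imp_continuous_map quotient_map_quotient_topology)

lemma mem_orbit_space:
  assumes "A \<in> topspace (orbit_space F \<iota>)"
  shows "A \<noteq> {}" "chi \<in> A \<Longrightarrow> chi \<in> characters \<iota>" "chi \<in> A \<Longrightarrow> char_orbit F chi = A"
proof -
  obtain psi where psi: "psi \<in> characters \<iota>" "A = char_orbit F psi"
    using assms by (auto simp: topspace_orbit_space)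
  show "A \<noteq> {}" using char_orbit_self psi by blast
  show "chi \<in> A \<Longrightarrow> chi \<in> characters \<iota>" using psi act_char_characters by (auto simp: mem_char_orbit_iff)
  show "chi \<in> A \<Longrightarrow> char_orbit F chi = A" using psi char_orbit_eq_iff by blast
qed

lemma continuous_map_act_char:
  assumes "\<sigma> \<in> Gal"
  shows "continuous_map (character_space \<iota>) (character_space \<iota>) (act_char \<sigma>)"
proof -
  have "continuous_map (character_space \<iota>) (character_space \<iota>) (\<lambda>chi. chi)" by simp
  then have "\<And>x. x \<noteq> 0 \<Longrightarrow> continuous_map (character_space \<iota>) euclidean (\<lambda>chi. chi x)"
    unfolding continuous_map_character_space by blast
  then show ?thesis
    unfolding continuous_map_character_space topspace_character_space
    using act_char_characters assms galois_group_zero(2)[OF inv_into_galois_group[OF assms]]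
    by (simp add: act_char_def)
qed

text \<open>The saturation of \<open>V\<close> is the union of its Galois translates. Openness of
  the orbit map supplies the neighbourhoods in \<open>uniformly_near\<close>.\<close>

lemma openin_char_orbit_image:
  assumes V: "openin (character_space \<iota>) V"
  shows "openin (orbit_space F \<iota>) (char_orbit F ` V)"
proof -
  have sub: "V \<subseteq> characters \<iota>" using openin_subset[OF V] by (simp add: topspace_character_space)
  have "{x \<in> characters \<iota>. char_orbit F x \<in> char_orbit F ` V} =
      (\<Union>\<sigma>\<in>Gal. {x \<in> characters \<iota>. act_char \<sigma> x \<in> V})"
  proof (intro equalityI subsetI)
    fix x assume "x \<in> {x \<in> characters \<iota>. char_orbit F x \<in> char_orbit F ` V}"
    then obtain v where v: "x \<in> characters \<iota>" "v \<in> V" "char_orbit F v = char_orbit F x" by auto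
    then show "x \<in> (\<Union>\<sigma>\<in>Gal. {x \<in> characters \<iota>. act_char \<sigma> x \<in> V})"
      by (auto simp: char_orbit_eq_iff mem_char_orbit_iff)
  next
    fix x assume "x \<in> (\<Union>\<sigma>\<in>Gal. {x \<in> characters \<iota>. act_char \<sigma> x \<in> V})"
    then obtain \<sigma> where \<sigma>: "\<sigma> \<in> Gal" "x \<in> characters \<iota>" "act_char \<sigma> x \<in> V" by auto
    then have "char_orbit F (act_char \<sigma> x) = char_orbit F x"
      by (auto simp: char_orbit_eq_iff mem_char_orbit_iff)
    then show "x \<in> {x \<in> characters \<iota>. char_orbit F x \<in> char_orbit F ` V}"
      using \<sigma> by (auto simp: image_iff intro!: bexI[of _ "act_char \<sigma> x"])
  qed
  moreover have "openin (character_space \<iota>) {x \<in> characters \<iota>. act_char \<sigma> x \<in> V}" if "\<sigma> \<in> Gal" for \<sigma>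
    using openin_continuous_map_preimage[OF continuous_map_act_char[OF that] V]
    by (simp add: topspace_character_space)
  ultimately have "openin (character_space \<iota>) {x \<in> characters \<iota>. char_orbit F x \<in> char_orbit F ` V}"
    by auto
  then show ?thesis
    using sub by (auto simp: orbit_space_def openin_quotient_topology topspace_character_space)
qed

text \<open>Only finitely many evaluations are constrained, because \<open>T\<close> and each
  \<open>probes x\<close> are finite.\<close>

lemma openin_near:
  assumes T: "finite T"
  shows "openin (character_space \<iota>) {psi \<in> characters \<iota>. near T e chi psi}"
proof -
  let ?A = "\<lambda>(x, y). {psi \<in> characters \<iota>. psi y \<in> ball (chi y) (e * gap x)}"
  have "openin (character_space \<iota>) (characters \<iota> \<inter> \<Inter>(?A ` Sigma T probes))"
  proof (cases "Sigma T probes = {}")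
    case True
    then show ?thesis using openin_topspace[of "character_space \<iota>"] by (simp add: topspace_character_space)
  next
    case False
    have "openin (character_space \<iota>) (?A p)" if "p \<in> Sigma T probes" for p
      using that openin_character_space[OF _ open_ball] by (auto simp: probes_def simp del: mem_ball)
    then have "openin (character_space \<iota>) (\<Inter>(?A ` Sigma T probes))"
      using False T finite_probes by (intro openin_Inter) auto
    moreover have "openin (character_space \<iota>) (characters \<iota>)"
      using openin_topspace[of "character_space \<iota>"] by (simp add: topspace_character_space)
    ultimately show ?thesis by (rule openin_Int[rotated])
  qed
  moreover have "characters \<iota> \<inter> \<Inter>(?A ` Sigma T probes) = {psi \<in> characters \<iota>. near T e chi psi}"
    by (auto simp: near_def dist_norm)
  ultimately show ?thesis by simp
qed

text \<open>A Lebesgue number argument. Each point of \<open>W\<close> has a neighbourhood over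
  which all orbits meet the nearness ball of radius \<open>e / 2\<close> around one
  \<open>c\<close>. Two points in it have representatives near each other, and the automorphism
  taking the first representative to \<open>chi\<close> carries the second one along.\<close>

lemma uniformly_near:
  fixes W :: "'w::real_normed_vector set"
  assumes f: "continuous_map (top_of_set W) (orbit_space F \<iota>) f" and W: "compact W"
    and T: "finite T" and e: "e > 0"
  obtains \<eta> where "\<eta> > 0"
    "\<And>u v chi. u \<in> W \<Longrightarrow> v \<in> W \<Longrightarrow> dist u v < \<eta> \<Longrightarrow> chi \<in> f u \<Longrightarrow> \<exists>psi\<in>f v. near T e chi psi"
proof -
  define V where "V c = {psi \<in> characters \<iota>. near T (e / 2) c psi}" for c
  have fW: "f w \<in> topspace (orbit_space F \<iota>)" if "w \<in> W" for w
    using f that by (auto simp: continuous_map)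
  let ?C = "{B. open B \<and> (\<exists>c. \<forall>v\<in>W \<inter> B. f v \<in> char_orbit F ` V c)}"
  have cover: "W \<subseteq> \<Union>?C"
  proof
    fix w assume w: "w \<in> W"
    obtain c where c: "c \<in> f w" using mem_orbit_space(1)[OF fW[OF w]] by blast
    have cV: "c \<in> V c" using c e mem_orbit_space(2)[OF fW[OF w]] by (simp add: V_def near_refl)
    have "openin (top_of_set W) {v \<in> W. f v \<in> char_orbit F ` V c}"
      using openin_continuous_map_preimage[OF f openin_char_orbit_image[OF openin_near[OF T]]]
      by (simp add: V_def)
    then obtain B where B: "open B" "{v \<in> W. f v \<in> char_orbit F ` V c} = W \<inter> B"
      by (auto simp: openin_open)
    have "f w \<in> char_orbit F ` V c" using cV mem_orbit_space(3)[OF fW[OF w] c] by blast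
    then have "w \<in> B" using B(2) w by blast
    moreover have "B \<in> ?C" using B by blast
    ultimately show "w \<in> \<Union>?C" by blast
  qed
  obtain \<eta> where \<eta>: "\<eta> > 0" "\<forall>w\<in>W. \<exists>B\<in>?C. ball w \<eta> \<subseteq> B"
    by (rule Heine_Borel_lemma[OF W cover]) blast+
  show ?thesis
  proof
    fix u v chi assume uv: "u \<in> W" "v \<in> W" "dist u v < \<eta>" and chi: "chi \<in> f u"
    obtain B c where B: "ball u \<eta> \<subseteq> B" "\<And>v. v \<in> W \<Longrightarrow> v \<in> B \<Longrightarrow> f v \<in> char_orbit F ` V c"
      using \<eta>(2)[rule_format, OF uv(1)] uv(1) by blast
    have "u \<in> B" "v \<in> B" using B(1) uv \<eta>(1) by auto
    then obtain a b where ab: "a \<in> V c" "f u = char_orbit F a" "b \<in> V c" "f v = char_orbit F b"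
      using B(2) uv by (metis imageE)
    have ne: "near T e a b"
      using near_trans[OF near_sym[of T "e/2" c a], of "e/2" b] ab by (simp add: V_def)
    obtain \<sigma> where \<sigma>: "\<sigma> \<in> Gal" "chi = act_char \<sigma> a"
      using chi ab(2) by (auto simp: mem_char_orbit_iff)
    then show "\<exists>psi\<in>f v. near T e chi psi"
      using near_act[OF \<sigma>(1) ne] ab(4) by (intro bexI[of _ "act_char \<sigma> b"]) (auto simp: mem_char_orbit_iff)
  qed (fact \<eta>(1))
qed

lemma near_mod_fibre:
  assumes "A \<in> topspace (orbit_space F \<iota>)" "chi \<in> A" "psi \<in> A" "near_mod T e chi psi" "e \<le> 1"
  shows "eq_mod T chi psi"
proof -
  have "near_mod T 1 psi chi" using assms near_mod_mono near_mod_sym by blast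
  then show ?thesis
    using assms mem_orbit_space[OF assms(1)] near_mod_imp_eq_mod[of psi chi T] by blast
qed

text \<open>Two characters over the same point that are \<open>near_mod T 1\<close> are equal modulo \<open>T\<close>; the constant
  \<open>1/8\<close> leaves room for applying the triangle inequality three times.\<close>

definition level_lift ::
  "'w::real_normed_vector set \<Rightarrow> ('w \<Rightarrow> ('a \<Rightarrow> complex) set) \<Rightarrow> 'w \<Rightarrow> ('a \<Rightarrow> complex) \<Rightarrow> 'a set \<Rightarrow>
     ('w \<Rightarrow> 'a \<Rightarrow> complex) \<Rightarrow> bool" where
  "level_lift W f w0 c T s \<longleftrightarrow> (\<forall>w\<in>W. s w \<in> f w) \<and> eq_mod T (s w0) c \<and>
     (\<exists>\<eta>>0. \<forall>u\<in>W. \<forall>v\<in>W. dist u v < \<eta> \<longrightarrow> near_mod T (1/8) (s u) (s v))"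

text \<open>\<open>near_mod T (1/8)\<close> is not transitive, but \<open>tri\<close> holds for
  nearby outer points: move \<open>x\<close> to some \<open>z'\<close> over \<open>u'\<close>; then
  \<open>z'\<close> and \<open>z\<close> lie in one fibre and are near with constant 3/8, hence
  equal modulo \<open>T\<close>.\<close>

lemma ex_level_lift:
  fixes W :: "'w::real_normed_vector set"
  assumes f: "continuous_map (top_of_set W) (orbit_space F \<iota>) f" and W: "compact W" "convex W"
    and w0: "w0 \<in> W" and c: "c \<in> f w0" and T: "finite T"
  shows "\<exists>s. level_lift W f w0 c T s"
proof -
  have fW: "f w \<in> topspace (orbit_space F \<iota>)" if "w \<in> W" for w
    using f that by (auto simp: continuous_map)
  obtain \<eta> where \<eta>: "\<eta> > 0"
    "\<And>u v chi. u \<in> W \<Longrightarrow> v \<in> W \<Longrightarrow> dist u v < \<eta> \<Longrightarrow> chi \<in> f u \<Longrightarrow> \<exists>psi\<in>f v. near T (1/8) chi psi"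
    using uniformly_near[OF f W(1) T, of "1/8"] by auto
  let ?R = "near_mod T (1/8)"
  obtain s where s: "\<And>w. w \<in> W \<Longrightarrow> s w \<in> f w" "?R (s w0) c"
    "\<And>u v. u \<in> W \<Longrightarrow> v \<in> W \<Longrightarrow> dist u v < \<eta> / 2 \<Longrightarrow> ?R (s u) (s v)"
  proof (rule convex_chain_section[where f = f and R = ?R, OF W(2) compact_imp_bounded[OF W(1)] w0 c \<eta>(1)])
    show "?R x x" for x by (simp add: near_imp_near_mod near_refl)
    show "?R x y \<Longrightarrow> ?R y x" for x y by (rule near_mod_sym)
    show "\<exists>y\<in>f v. ?R x y" if "u \<in> W" "v \<in> W" "dist u v < \<eta>" "x \<in> f u" for u v x
      using \<eta>(2)[OF that] near_imp_near_mod by blast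
    fix u v u' x y z
    assume A: "u \<in> W" "v \<in> W" "u' \<in> W" "x \<in> f u" "y \<in> f v" "z \<in> f u'" "?R x y" "?R y z" "dist u u' < \<eta>"
    obtain z' where z': "z' \<in> f u'" "?R x z'"
      using \<eta>(2)[OF A(1,3,9,4)] near_imp_near_mod by blast
    have "near_mod T (1/8 + (1/8 + 1/8)) z' z"
      using near_mod_trans[OF near_mod_sym[OF z'(2)] near_mod_trans[OF A(7,8)]] .
    then have "eq_mod T z' z" using near_mod_fibre[OF fW[OF A(3)] z'(1) A(6)] by simp
    then have "?R z x" using eq_mod_near_mod[OF eq_mod_sym near_mod_sym[OF z'(2)]] by blast
    then show "?R x z" by (rule near_mod_sym)
  qed blast
  have "eq_mod T (s w0) c"
    using near_mod_fibre[OF fW[OF w0] s(1)[OF w0] c s(2)] by simp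
  then show ?thesis
    unfolding level_lift_def using s \<eta>(1) by (intro exI[of _ s] conjI exI[of _ "\<eta> / 2"]) auto
qed

text \<open>Along a chain the two lifts stay in one class, since different classes over a point are
  never near with constant 1/4. Two sets \<open>T\<close> and \<open>T'\<close> are allowed so that
  a lift for \<open>{x}\<close> can be compared with one for a finite set containing
  \<open>x\<close>.\<close>

lemma level_lift_unique:
  fixes W :: "'w::real_normed_vector set"
  assumes f: "f ` W \<subseteq> topspace (orbit_space F \<iota>)" and W: "bounded W" "convex W"
    and w0: "w0 \<in> W" and s: "level_lift W f w0 c T s" and s': "level_lift W f w0 c T' s'"
    and sub: "T \<subseteq> T'" and w: "w \<in> W"
  shows "eq_mod T (s w) (s' w)"
proof -
  obtain \<eta> where \<eta>: "\<eta> > 0" "\<And>u v. u \<in> W \<Longrightarrow> v \<in> W \<Longrightarrow> dist u v < \<eta> \<Longrightarrow> near_mod T (1/8) (s u) (s v)"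
    using s unfolding level_lift_def by blast
  obtain \<eta>' where \<eta>': "\<eta>' > 0" "\<And>u v. u \<in> W \<Longrightarrow> v \<in> W \<Longrightarrow> dist u v < \<eta>' \<Longrightarrow> near_mod T' (1/8) (s' u) (s' v)"
    using s' unfolding level_lift_def by blast
  have mem: "s w \<in> f w" "s' w \<in> f w" if "w \<in> W" for w
    using s s' that by (auto simp: level_lift_def)
  show ?thesis
  proof (rule convex_chain_induct[OF W(2,1) w0 w, of "min \<eta> \<eta>'"])
    have "eq_mod T (s' w0) c" using s' sub fixing_mono unfolding level_lift_def eq_mod_def by blast
    then show "eq_mod T (s w0) (s' w0)"
      using s eq_mod_sym eq_mod_trans unfolding level_lift_def by blast
    fix u v assume uv: "u \<in> W" "v \<in> W" "dist u v < min \<eta> \<eta>'" "eq_mod T (s u) (s' u)"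
    have "near_mod T (1/8) (s v) (s u)" using \<eta>(2) uv near_mod_sym by auto
    moreover have "near_mod T (1/8) (s' u) (s' v)" using near_mod_mono[OF \<eta>'(2)[OF uv(1,2)] sub] uv(3) by simp
    then have "near_mod T (1/8) (s u) (s' v)" using uv(4) eq_mod_near_mod by blast
    ultimately have "near_mod T (1/8 + 1/8) (s v) (s' v)" by (rule near_mod_trans)
    then show "eq_mod T (s v) (s' v)"
      using near_mod_fibre mem[OF uv(2)] f uv(2) by (force simp: image_subset_iff)
  qed (use \<eta> \<eta>' in auto)
qed

text \<open>\<open>g\<close> reads its value at \<open>x\<close> off a level lift for
  \<open>{x}\<close>, chosen independently for every \<open>x\<close>. The point is that these
  values form a single character over \<open>f w\<close>: on a finite \<open>T\<close> they agree
  with those of one level lift for \<open>T\<close>, and \<open>galois_group_local\<close> passes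
  from finite sets to the whole field.\<close>

theorem ex_character_lift:
  fixes W :: "'w::real_normed_vector set"
  assumes f: "continuous_map (top_of_set W) (orbit_space F \<iota>) f" and W: "compact W" "convex W"
    and w0: "w0 \<in> W" and c: "c \<in> f w0"
  obtains g where "continuous_map (top_of_set W) (character_space \<iota>) g" "g w0 = c"
    "\<And>w. w \<in> W \<Longrightarrow> char_orbit F (g w) = f w"
proof -
  have fW: "f w \<in> topspace (orbit_space F \<iota>)" if "w \<in> W" for w
    using f that by (auto simp: continuous_map)
  then have fW': "f ` W \<subseteq> topspace (orbit_space F \<iota>)" by blast
  define s where "s x = (SOME s. level_lift W f w0 c {x} s)" for x
  have s: "level_lift W f w0 c {x} (s x)" for x
  proof -
    have "\<exists>s. level_lift W f w0 c {x} s" by (rule ex_level_lift[OF f W w0 c]) simp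
    then show ?thesis unfolding s_def by (rule someI_ex)
  qed
  then have s_mem: "s x w \<in> f w" if "w \<in> W" for x w using that by (simp add: level_lift_def)
  \<comment> \<open>At 0 the value has to be \<open>undefined\<close>, as characters are extensional
    on the nonzero elements.\<close>
  define g where "g w x = (if x = 0 then undefined else s x w x)" for w x
  have g_mem: "g w \<in> f w" if w: "w \<in> W" for w
  proof -
    obtain psi where psi: "psi \<in> f w" using mem_orbit_space(1)[OF fW[OF w]] by blast
    have psi_char: "psi \<in> characters \<iota>" and orb: "f w = char_orbit F psi"
      using mem_orbit_space[OF fW[OF w]] psi by auto
    have "\<forall>x. \<exists>\<rho>. \<rho> \<in> Gal \<and> s x w = psi \<circ> \<rho>"
    proof
      fix x
      obtain \<rho> where "\<rho> \<in> Gal" "s x w = act_char \<rho> psi"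
        using s_mem[OF w, of x] unfolding orb mem_char_orbit_iff by blast
      then show "\<exists>\<rho>. \<rho> \<in> Gal \<and> s x w = psi \<circ> \<rho>"
        using inv_into_galois_group by (auto simp: act_char_def)
    qed
    then obtain \<rho> where \<rho>: "\<And>x. \<rho> x \<in> Gal" "\<And>x. s x w = psi \<circ> \<rho> x" by metis
    have \<rho>': "s x w = act_char (inv_into UNIV (\<rho> x)) psi" for x
      using \<rho>(1)[of x] by (simp add: \<rho>(2) act_char_def inv_inv_eq galois_group_iff)
    \<comment> \<open>\<open>g w\<close> is \<open>psi\<close> composed with this diagonal, so it
      lies in the orbit of \<open>psi\<close> once the diagonal is an automorphism.\<close>
    have r: "(\<lambda>x. \<rho> x x) \<in> Gal"
    proof (rule galois_group_local)
      fix T :: "'a set" assume T: "finite T"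
      obtain t where t: "level_lift W f w0 c T t" using ex_level_lift[OF f W w0 c T] by blast
      then have "t w \<in> f w" using w by (simp add: level_lift_def)
      then obtain \<tau> where \<tau>: "\<tau> \<in> Gal" "t w = act_char \<tau> psi"
        unfolding orb mem_char_orbit_iff by blast
      \<comment> \<open>Freeness turns equality of characters modulo \<open>{x}\<close> into an
        identity of automorphisms: the inverse of \<open>\<rho> x\<close> is
        \<open>\<sigma> \<circ> \<tau>\<close> with \<open>\<sigma>\<close> fixing
        \<open>x\<close>.\<close>
      have "\<rho> x x = inv_into UNIV \<tau> x" if "x \<in> T" for x
      proof -
        have "eq_mod {x} (s x w) (t w)"
          using that by (intro level_lift_unique[OF fW' compact_imp_bounded[OF W(1)] W(2) w0 s t _ w]) auto
        then obtain \<sigma> where \<sigma>: "\<sigma> \<in> fixing {x}" "s x w = act_char \<sigma> (t w)" by (auto simp: eq_mod_def)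
        then have "act_char (inv_into UNIV (\<rho> x)) psi = act_char (\<sigma> \<circ> \<tau>) psi"
          using \<tau> by (simp add: \<rho>'[symmetric] act_comp fixing_Gal)
        then have "inv_into UNIV (\<rho> x) = \<sigma> \<circ> \<tau>"
          using \<sigma> \<tau> \<rho>(1) by (intro act_char_free[OF psi_char])
            (auto simp: inv_into_galois_group galois_group_comp fixing_Gal)
        then have "\<sigma> (\<tau> (\<rho> x x)) = x"
          using inv_cancel(2)[OF \<rho>(1), of x x] by (simp add: fun_eq_iff)
        moreover have "\<sigma> x = x" using \<sigma>(1) by (simp add: fixing_def)
        ultimately have "\<tau> (\<rho> x x) = x"
          using fixing_Gal[OF \<sigma>(1)] by (metis inv_cancel(2))
        then show ?thesis using \<tau>(1) by (metis inv_cancel(2))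
      qed
      then show "\<exists>\<tau>\<in>Gal. \<forall>x\<in>T. \<rho> x x = \<tau> x" using inv_into_galois_group[OF \<tau>(1)] by blast
    qed
    have "psi 0 = undefined" using charactersD(4)[OF psi_char] by (simp add: extensional_def)
    then have "g w = act_char (inv_into UNIV (\<lambda>x. \<rho> x x)) psi"
      using r galois_group_zero(1)[OF r] by (auto simp: act_char_def inv_inv_eq galois_group_iff g_def \<rho>(2))
    then show ?thesis using inv_into_galois_group[OF r] unfolding orb mem_char_orbit_iff by blast
  qed
  show ?thesis
  proof
    have "continuous_on W (\<lambda>w. g w x)" if x: "x \<noteq> 0" for x
      unfolding continuous_on_iff
    proof (intro ballI allI impI)
      fix w e assume w: "w \<in> W" and e: "(e::real) > 0"
      \<comment> \<open>The bound 1/8 keeps the comparison inside a fibre below its threshold;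
        \<open>e / gap x\<close> yields the continuity estimate, as nearness is measured in units of
        \<open>gap x\<close>.\<close>
      define d where "d = min (1/8) (e / gap x)"
      have d: "d > 0" "d \<le> 1/8" "d * gap x \<le> e" using e gap_pos[of x]
        by (auto simp: d_def min_def field_simps)
      obtain \<eta> where \<eta>: "\<eta> > 0"
        "\<And>u v. u \<in> W \<Longrightarrow> v \<in> W \<Longrightarrow> dist u v < \<eta> \<Longrightarrow> near_mod {x} (1/8) (s x u) (s x v)"
        using s[of x] unfolding level_lift_def by blast
      obtain \<eta>' where \<eta>': "\<eta>' > 0"
        "\<And>u v chi. u \<in> W \<Longrightarrow> v \<in> W \<Longrightarrow> dist u v < \<eta>' \<Longrightarrow> chi \<in> f u \<Longrightarrow> \<exists>psi\<in>f v. near {x} d chi psi"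
        using uniformly_near[OF f W(1) _ d(1), of "{x}"] by auto
      show "\<exists>\<delta>>0. \<forall>v\<in>W. dist v w < \<delta> \<longrightarrow> dist (g v x) (g w x) < e"
      proof (intro exI[of _ "min \<eta> \<eta>'"] conjI ballI impI)
        fix v assume v: "v \<in> W" "dist v w < min \<eta> \<eta>'"
        \<comment> \<open>The chosen \<open>s x\<close> need not be continuous. A point
          \<open>psi\<close> over \<open>v\<close> near \<open>s x w\<close> equals
          \<open>s x v\<close> modulo \<open>{x}\<close>, hence has the same value at
          \<open>x\<close>.\<close>
        obtain psi where psi: "psi \<in> f v" "near {x} d (s x w) psi"
          using \<eta>'(2)[OF w v(1) _ s_mem[OF w]] v(2) by (auto simp: dist_commute)
        have "near_mod {x} (1/8 + 1/8) psi (s x v)"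
        proof (rule near_mod_trans)
          show "near_mod {x} (1/8) psi (s x w)"
            using near_mod_mono[OF near_imp_near_mod[OF near_sym[OF psi(2)]] _ d(2)] by blast
          show "near_mod {x} (1/8) (s x w) (s x v)"
            using \<eta>(2)[OF w v(1)] v(2) by (simp add: dist_commute)
        qed
        then have "eq_mod {x} psi (s x v)"
          using near_mod_fibre[OF fW[OF v(1)] psi(1) s_mem[OF v(1)]] by simp
        then have "psi x = s x v x" by (rule eq_mod_apply) simp
        moreover have "norm (s x w x - psi x) < d * gap x"
          using psi(2) probes_self[OF x] by (simp add: near_def)
        ultimately show "dist (g v x) (g w x) < e"
          using x d(3) by (simp add: g_def dist_norm norm_minus_commute)
      qed (use \<eta> \<eta>' in simp)
    qed
    then show "continuous_map (top_of_set W) (character_space \<iota>) g"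
      unfolding continuous_map_character_space using g_mem mem_orbit_space(2)[OF fW] by auto
    show "char_orbit F (g w) = f w" if "w \<in> W" for w
      using mem_orbit_space(3)[OF fW[OF that] g_mem[OF that]] .
    have "c \<in> characters \<iota>" using mem_orbit_space(2)[OF fW[OF w0] c] .
    then have "c 0 = undefined" using charactersD(4) by (auto simp: extensional_def)
    moreover have "s x w0 x = c x" for x
      using s[of x] eq_mod_apply[of "{x}"] by (simp add: level_lift_def)
    ultimately show "g w0 = c" by (auto simp: g_def fun_eq_iff)
  qed
qed

section \<open>Uniqueness of lifts\<close>

lemma uniformly_near_character:
  fixes W :: "'w::real_normed_vector set"
  assumes g: "continuous_map (top_of_set W) (character_space \<iota>) g" and W: "compact W" and e: "e > 0"
  obtains \<eta> where "\<eta> > 0" "\<And>u v. u \<in> W \<Longrightarrow> v \<in> W \<Longrightarrow> dist u v < \<eta> \<Longrightarrow> near {x} e (g u) (g v)"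
proof -
  have "\<exists>\<eta>>0. \<forall>u\<in>W. \<forall>v\<in>W. dist u v < \<eta> \<longrightarrow> norm (g u y - g v y) < e * gap x" if "y \<in> probes x" for y
  proof -
    have "continuous_on W (\<lambda>w. g w y)"
      using g that unfolding continuous_map_character_space by (auto simp: probes_def)
    then have "uniformly_continuous_on W (\<lambda>w. g w y)" using W by (rule compact_uniformly_continuous)
    then show ?thesis
      unfolding uniformly_continuous_on_def dist_norm[of "g _ y"]
      using e gap_pos[of x] by (metis dist_commute mult_pos_pos)
  qed
  then obtain \<eta> where \<eta>: "\<And>y. y \<in> probes x \<Longrightarrow> \<eta> y > 0"
    "\<And>y u v. y \<in> probes x \<Longrightarrow> u \<in> W \<Longrightarrow> v \<in> W \<Longrightarrow> dist u v < \<eta> y \<Longrightarrow> norm (g u y - g v y) < e * gap x"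
    by metis
  show ?thesis
  proof
    \<comment> \<open>The inserted 1 covers empty \<open>probes x\<close>, which occurs for
      \<open>x = 0\<close>.\<close>
    show "Min (insert 1 (\<eta> ` probes x)) > 0"
      using \<eta>(1) finite_probes[of x] by (simp add: Min_gr_iff)
    fix u v assume "u \<in> W" "v \<in> W" "dist u v < Min (insert 1 (\<eta> ` probes x))"
    then show "near {x} e (g u) (g v)"
      using \<eta>(2) finite_probes[of x] by (auto simp: near_def)
  qed
qed

text \<open>Coordinates are treated one at a time: equality modulo \<open>{x}\<close> spreads along
  chains, and it already gives equality of the values at \<open>x\<close>.\<close>

theorem character_lift_unique:
  fixes W :: "'w::real_normed_vector set"
  assumes g: "continuous_map (top_of_set W) (character_space \<iota>) g"
    and h: "continuous_map (top_of_set W) (character_space \<iota>) h"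
    and W: "compact W" "convex W" and w0: "w0 \<in> W" "g w0 = h w0"
    and orb: "\<And>w. w \<in> W \<Longrightarrow> char_orbit F (g w) = char_orbit F (h w)" and w: "w \<in> W"
  shows "g w = h w"
proof
  fix x
  have gh: "g w \<in> characters \<iota>" "h w \<in> characters \<iota>" if "w \<in> W" for w
    using g h that unfolding continuous_map_character_space by auto
  obtain \<eta> where \<eta>: "\<eta> > 0" "\<And>u v. u \<in> W \<Longrightarrow> v \<in> W \<Longrightarrow> dist u v < \<eta> \<Longrightarrow> near {x} (1/8) (g u) (g v)"
    using uniformly_near_character[OF g W(1), of "1/8" x] by auto
  obtain \<eta>' where \<eta>': "\<eta>' > 0" "\<And>u v. u \<in> W \<Longrightarrow> v \<in> W \<Longrightarrow> dist u v < \<eta>' \<Longrightarrow> near {x} (1/8) (h u) (h v)"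
    using uniformly_near_character[OF h W(1), of "1/8" x] by auto
  have "eq_mod {x} (g w) (h w)"
  proof (rule convex_chain_induct[OF W(2) compact_imp_bounded[OF W(1)] w0(1) w, of "min \<eta> \<eta>'"])
    show "eq_mod {x} (g w0) (h w0)" by (simp add: w0 eq_mod_refl)
    fix u v assume uv: "u \<in> W" "v \<in> W" "dist u v < min \<eta> \<eta>'" "eq_mod {x} (g u) (h u)"
    have "near_mod {x} (1/8) (g v) (g u)"
      using \<eta>(2)[of u v] uv near_mod_sym near_imp_near_mod by simp
    moreover have "near_mod {x} (1/8) (g u) (h v)"
      using \<eta>'(2)[of u v] uv eq_mod_near_mod near_imp_near_mod by simp
    ultimately have "near_mod {x} (1/8 + 1/8) (g v) (h v)" by (rule near_mod_trans)
    then show "eq_mod {x} (g v) (h v)"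
      using gh[OF uv(2)] orb[OF uv(2)] char_orbit_self[of "g v" F] char_orbit_self[of "h v" F]
      by (intro near_mod_fibre[of "char_orbit F (g v)" _ _ _ "1/8 + 1/8"]) (auto simp: topspace_orbit_space)
  qed (use \<eta> \<eta>' in auto)
  then show "g w x = h w x" by (rule eq_mod_apply) simp
qed

end

section \<open>Characters and logarithms\<close>

context cyclotomic_closure
begin

text \<open>Divisibility of the multiplicative group, from the splitting of X^n - x over the
  closure; it feeds \<open>additive_integral_imp_zero\<close>.\<close>

lemma ex_root:
  assumes n: "n > 0" shows "\<exists>y::'a. y ^ n = x"
proof -
  interpret algebraic_closure "ring_of_type_algebra :: 'a ring" F by (rule closure)
  define p where "p = Polynomial.monom 1 n - [:x:]"
  have lc: "poly.coeff p n = 1"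
    using n by (auto simp: p_def coeff_pCons split: nat.splits)
  have "Polynomial.degree p \<le> n"
    unfolding p_def by (rule degree_diff_le) (auto simp: degree_monom_le)
  with lc have deg: "Polynomial.degree p = n"
    by (metis antisym le_degree zero_neq_one)
  define P where "P = rev (Polynomial.coeffs p)"
  have "p \<noteq> 0" using lc by auto
  have len: "Polynomials.degree P = n"
    using deg by (simp add: P_def degree_eq_length_coeffs)
  have P: "P \<in> carrier (poly_ring ring_of_type_algebra)"
    using \<open>p \<noteq> 0\<close> by (auto simp: univ_poly_def polynomial_def P_def hd_rev last_coeffs_eq_coeff_degree)
  have "roots P \<noteq> {#}"
    using roots_over_carrier[OF P] n len unfolding splitted_def by auto
  then obtain y where "y \<in># roots P" by blast
  then have "is_root P y" using roots_mem_iff_is_root[OF P] by auto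
  then have "poly p y = 0" by (simp add: is_root_def eval_ring_of_type_algebra P_def)
  then show ?thesis by (auto simp: p_def poly_monom)
qed

definition additive :: "('a \<Rightarrow> real) \<Rightarrow> bool" where
  "additive h \<longleftrightarrow> (\<forall>x y. x \<noteq> 0 \<longrightarrow> y \<noteq> 0 \<longrightarrow> h (x * y) = h x + h y)"

text \<open>The action of real-valued homomorphisms on characters through exp(2 pi i h). The case at
  0 keeps the result extensional.\<close>

definition twist :: "('a \<Rightarrow> complex) \<Rightarrow> ('a \<Rightarrow> real) \<Rightarrow> 'a \<Rightarrow> complex" where
  "twist chi h = (\<lambda>x. if x = 0 then undefined else chi x * cis (2 * pi * h x))"

lemma additive_power:
  assumes "additive h" "x \<noteq> 0" shows "h (x ^ n) = n * h x"
proof (induction n)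
  case 0
  have "h (1 * 1) = h 1 + h 1" using assms(1) unfolding additive_def by (metis zero_neq_one)
  then show ?case by simp
next
  case (Suc n)
  then show ?case using assms by (simp add: additive_def algebra_simps)
qed

text \<open>Torsion dies in the reals; this is why twisting preserves the normalisation on roots of
  unity.\<close>

lemma additive_emb_root:
  assumes "additive h" "\<zeta> \<in> carrier roots_of_unity_group" shows "h (\<iota> \<zeta>) = 0"
proof -
  obtain n where n: "n > 0" "\<zeta> ^ n = 1" using assms by auto
  have "real n * h (\<iota> \<zeta>) = h (\<iota> \<zeta> ^ n)"
    using additive_power[OF assms(1) emb_root_neq_0[OF assms(2)]] by simp
  also have "\<dots> = h (\<iota> \<zeta> ^ 0)"
    using emb_root_power(1)[OF assms(2), of n] n emb_hom(1) by simp
  also have "\<dots> = 0"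
    using additive_power[OF assms(1) emb_root_neq_0[OF assms(2)], of 0] by simp
  finally show ?thesis using n by simp
qed

text \<open>The multiplicative group is divisible, so it has no nonzero homomorphism to \<open>\<int>\<close>.\<close>

lemma additive_integral_imp_zero:
  assumes h: "additive h" and int: "\<And>x. x \<noteq> 0 \<Longrightarrow> h x \<in> \<int>" and x: "x \<noteq> 0"
  shows "h x = 0"
proof (rule ccontr)
  assume nz: "h x \<noteq> 0"
  \<comment> \<open>For \<open>n\<close> larger than the absolute value of \<open>h x\<close>, an
    \<open>n\<close>-th root of \<open>x\<close> would have a nonzero image of absolute value less
    than 1.\<close>
  obtain n :: nat where n: "real n > \<bar>h x\<bar>" using reals_Archimedean2 by blast
  then have "n > 0" by (cases n) auto
  then obtain y where y: "y ^ n = x" using ex_root by blast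
  then have y0: "y \<noteq> 0" using x \<open>n > 0\<close> by (auto simp: zero_power)
  have eq: "real n * h y = h x" using additive_power[OF h y0, of n] y by simp
  then have "h y \<noteq> 0" using nz by auto
  then have "\<bar>h y\<bar> \<ge> 1" using Ints_nonzero_abs_ge1[OF int[OF y0]] by simp
  then have "real n * \<bar>h y\<bar> \<ge> real n" using mult_left_mono[of 1 "\<bar>h y\<bar>" "real n"] by simp
  then show False using n eq by (metis abs_mult abs_of_nat not_less)
qed

lemma twist_characters:
  assumes chi: "chi \<in> characters \<iota>" and h: "additive h"
  shows "twist chi h \<in> characters \<iota>"
proof (rule charactersI)
  note chi' = charactersD[OF chi]
  show "norm (twist chi h x) = 1" if "x \<noteq> 0" for x
    using that by (simp add: twist_def norm_mult chi')
  show "twist chi h (x * y) = twist chi h x * twist chi h y" if "x \<noteq> 0" "y \<noteq> 0" for x y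
    using that h by (simp add: twist_def additive_def chi' cis_2pi_add)
  show "twist chi h \<in> extensional (- {0})" by (simp add: twist_def extensional_def)
  show "twist chi h (\<iota> \<zeta>) = \<zeta>" if "\<zeta> \<in> carrier roots_of_unity_group" for \<zeta>
    using emb_root_neq_0[OF that] additive_emb_root[OF h that] chi'(5)[OF that] by (simp add: twist_def)
qed

text \<open>Equality of the twists makes \<open>h - k\<close> integer-valued; divisibility improves
  this to zero.\<close>

lemma twist_eq_imp_eq:
  assumes chi: "chi \<in> characters \<iota>" and h: "additive h" "additive k"
    and eq: "twist chi h = twist chi k" and x: "x \<noteq> 0"
  shows "h x = k x"
proof -
  have "additive (\<lambda>x. h x - k x)" using h by (simp add: additive_def)
  moreover have "h y - k y \<in> \<int>" if "y \<noteq> 0" for y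
  proof -
    have "chi y \<noteq> 0" using charactersD(1)[OF chi that] by auto
    then have "cis (2 * pi * h y) = cis (2 * pi * k y)"
      using fun_cong[OF eq, of y] that by (simp add: twist_def)
    then show ?thesis by (simp add: cis_2pi_eq_iff)
  qed
  ultimately have "h x - k x = 0" by (rule additive_integral_imp_zero[OF _ _ x])
  then show ?thesis by simp
qed

lemma continuous_map_twist:
  assumes chi: "chi \<in> characters \<iota>" and a: "\<And>w. w \<in> W \<Longrightarrow> additive (a w)"
    and cont: "\<And>x. x \<noteq> 0 \<Longrightarrow> continuous_on W (\<lambda>w. a w x)"
  shows "continuous_map (top_of_set W) (character_space \<iota>) (\<lambda>w. twist chi (a w))"
  unfolding continuous_map_character_space
proof (intro conjI ballI allI impI)
  show "twist chi (a w) \<in> characters \<iota>" if "w \<in> topspace (top_of_set W)" for w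
    using that by (simp add: twist_characters chi a)
  fix x :: 'a assume "x \<noteq> 0"
  moreover from this have "continuous_on W (\<lambda>w. chi x * cis (2 * pi * a w x))"
    by (intro continuous_intros cont)
  ultimately show "continuous_map (top_of_set W) euclidean (\<lambda>w. twist chi (a w) x)"
    by (simp add: twist_def)
qed

text \<open>For each \<open>x\<close> separately, the path \<open>g t x / g 0 x\<close> in the
  circle has a continuous real logarithm starting at 0. Additivity follows because the defect
  \<open>?D\<close> is continuous and integer-valued, hence constant, and zero at the start.\<close>

lemma ex_character_log:
  assumes g: "pathin (character_space \<iota>) g"
  obtains a where "\<And>x. x \<noteq> 0 \<Longrightarrow> continuous_on {0..1} (\<lambda>t. a t x)" "\<And>x. a 0 x = 0"
    "\<And>t. t \<in> {0..1} \<Longrightarrow> additive (a t)" "\<And>t. t \<in> {0..1} \<Longrightarrow> g t = twist (g 0) (a t)"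
proof -
  have gc: "g t \<in> characters \<iota>" if "t \<in> {0..1}" for t
    using g that unfolding pathin_def continuous_map_character_space by auto
  have cont: "continuous_on {0..1} (\<lambda>t. g t x)" if "x \<noteq> 0" for x
    using g that unfolding pathin_def continuous_map_character_space by auto
  have n1: "norm (g t x) = 1" if "t \<in> {0..1}" "x \<noteq> 0" for t x
    using charactersD(1)[OF gc[OF that(1)] that(2)] .
  then have nz: "g t x \<noteq> 0" if "t \<in> {0..1}" "x \<noteq> 0" for t x using that by force
  have "\<exists>l. continuous_on {0..1} l \<and> l 0 = 0 \<and> (\<forall>t\<in>{0..1}. g t x = g 0 x * cis (2 * pi * l t))"
    if x: "x \<noteq> 0" for x
  proof -
    have c: "continuous_on {0..1} (\<lambda>t. g t x / g 0 x)"
      using nz[of 0 x] x by (intro continuous_intros cont) auto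
    obtain l where l: "continuous_on {0..1} l" "\<And>t. t \<in> {0..1} \<Longrightarrow> g t x / g 0 x = exp (l t)"
      by (rule continuous_logarithm_on_contractible[OF c]) (use nz x in \<open>auto intro: convex_imp_contractible\<close>)
    have cis: "g t x / g 0 x = cis (Im (l t))" if t: "t \<in> {0..1}" for t
    proof -
      have "norm (exp (l t)) = 1" using l(2)[OF t, symmetric] n1 t x by (simp add: norm_divide)
      then have "Re (l t) = 0" by simp
      then show ?thesis using l(2)[OF t] by (simp add: exp_eq_polar)
    qed
    have c0: "cis (Im (l 0)) = 1" using cis[of 0] nz[of 0 x] x by simp
    show ?thesis
    \<comment> \<open>Subtracting the initial value, a multiple of 2 pi, makes the logarithm start
      at 0.\<close>
    proof (intro exI[of _ "\<lambda>t. (Im (l t) - Im (l 0)) / (2 * pi)"] conjI ballI)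
      show "continuous_on {0..1} (\<lambda>t. (Im (l t) - Im (l 0)) / (2 * pi))"
        by (intro continuous_intros l) auto
      show "g t x = g 0 x * cis (2 * pi * ((Im (l t) - Im (l 0)) / (2 * pi)))" if t: "t \<in> {0..1}" for t
      proof -
        have "cis (Im (l t) - Im (l 0)) = cis (Im (l t))" using c0 by (simp flip: cis_divide)
        then show ?thesis using cis[OF t] nz[of 0 x] x by (simp add: field_simps)
      qed
    qed simp
  qed
  then obtain l where l: "\<And>x. x \<noteq> 0 \<Longrightarrow> continuous_on {0..1} (l x)" "\<And>x. x \<noteq> 0 \<Longrightarrow> l x 0 = (0::real)"
    "\<And>x t. x \<noteq> 0 \<Longrightarrow> t \<in> {0..1} \<Longrightarrow> g t x = g 0 x * cis (2 * pi * l x t)"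
    by metis
  \<comment> \<open>The value 0 at \<open>x = 0\<close> lets \<open>a 0 x = 0\<close> hold for all
    \<open>x\<close>.\<close>
  define a where "a t x = (if x = 0 then 0 else l x t)" for t x
  show ?thesis
  proof
    show "continuous_on {0..1} (\<lambda>t. a t x)" if "x \<noteq> 0" for x using l(1)[OF that] that by (simp add: a_def)
    show "a 0 x = 0" for x using l(2) by (simp add: a_def)
    show "g t = twist (g 0) (a t)" if "t \<in> {0..1}" for t
    proof
      have "g t 0 = undefined" using charactersD(4)[OF gc[OF that]] by (simp add: extensional_def)
      then show "g t x = twist (g 0) (a t) x" for x using l(3)[OF _ that, of x] by (simp add: twist_def a_def)
    qed
    show "additive (a t)" if t: "t \<in> {0..1}" for t
      unfolding additive_def
    proof (intro allI impI)
      fix x y :: 'a assume xy: "x \<noteq> 0" "y \<noteq> 0"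
      let ?D = "\<lambda>t. l (x * y) t - (l x t + l y t)"
      have int: "?D s \<in> \<int>" if s: "s \<in> {0..1}" for s
      proof -
        have "g 0 (x * y) * cis (2 * pi * l (x * y) s) = g 0 (x * y) * cis (2 * pi * (l x s + l y s))"
          using l(3)[OF xy(1) s] l(3)[OF xy(2) s] l(3)[of "x * y", OF _ s] xy
            charactersD(2)[OF gc[OF s] xy] charactersD(2)[OF gc[of 0] xy]
          by (auto simp: cis_2pi_add)
        then have "cis (2 * pi * l (x * y) s) = cis (2 * pi * (l x s + l y s))"
          using nz[of 0 "x * y"] xy by simp
        then show ?thesis unfolding cis_2pi_eq_iff .
      qed
      have "?D constant_on {0..1}"
      proof (rule continuous_discrete_range_constant)
        show "continuous_on {0..1} ?D" using xy by (intro continuous_intros l(1)) auto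
        fix s assume s: "s \<in> {0..1::real}"
        have "1 \<le> norm (?D u - ?D s)" if "u \<in> {0..1}" "?D u \<noteq> ?D s" for u
          using Ints_nonzero_abs_ge1[OF Ints_diff[OF int[OF that(1)] int[OF s]]] that(2) by simp
        then show "\<exists>e>0. \<forall>u. u \<in> {0..1} \<and> ?D u \<noteq> ?D s \<longrightarrow> e \<le> norm (?D u - ?D s)"
          by (intro exI[of _ 1]) auto
      qed simp
      then obtain k where k: "\<And>s. s \<in> {0..1} \<Longrightarrow> ?D s = k" unfolding constant_on_def by blast
      have "k = 0" using k[of 0] l(2) xy by simp
      then show "a t (x * y) = a t x + a t y" using k[OF t] xy by (simp add: a_def)
    qed
  qed
qed

section \<open>The extension class of a character\<close>

lemma character_hom: "chi \<in> characters \<iota> \<Longrightarrow> chi \<in> hom units_group circle_group"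
  by (simp add: characters_def)

lemma groups:
  "group circle_group" "group integer_group" "group (units_group :: 'a monoid)"
  "group roots_of_unity_group"
  using comm_group_circle_group abelian_integer_group comm_group_units_group
    comm_group_roots_of_unity_group
  by (auto simp: comm_group_def)

lemma is_extension_character:
  "chi \<in> characters \<iota> \<Longrightarrow>
    is_extension units_group integer_group (pullback_extension units_group chi real_extension)"
  by (intro is_extension_pullback[OF groups(1,2) comm_group_units_group character_hom is_extension_real_extension])

lemma char_ext_eq:
  assumes "chi \<in> characters \<iota>"
  shows "char_ext chi =
    ext_class units_group integer_group (pullback_extension units_group chi real_extension)"
  unfolding char_ext_def
  by (intro ext_pullback_ext_class[OF groups(1,2) comm_group_units_group character_hom[OF assms]
        is_extension_real_extension])

text \<open>The classes separate exactly the path components of the character space: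
  \<open>ex_character_log\<close> turns a path into a twist, and scaling \<open>h\<close> turns a
  twist into a path.\<close>

lemma char_ext_eq_iff:
  assumes "chi \<in> characters \<iota>" "psi \<in> characters \<iota>"
  shows "char_ext chi = char_ext psi \<longleftrightarrow> (\<exists>h. additive h \<and> psi = twist chi h)"
proof -
  have "char_ext chi = char_ext psi \<longleftrightarrow>
      (\<exists>h \<in> hom units_group additive_group. \<forall>x\<in>carrier units_group. psi x = chi x * cis (2 * pi * h x))"
    unfolding char_ext_eq[OF assms(1)] char_ext_eq[OF assms(2)]
      ext_class_eq_iff[OF groups(3,2) is_extension_character[OF assms(1)] is_extension_character[OF assms(2)]]
    by (rule ext_equiv_pullback_real_iff[OF comm_group_units_group character_hom[OF assms(1)]
          character_hom[OF assms(2)]])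
  also have "\<dots> \<longleftrightarrow> (\<exists>h. additive h \<and> psi = twist chi h)"
  proof -
    have "h \<in> hom units_group additive_group \<longleftrightarrow> additive h" for h :: "'a \<Rightarrow> real"
      by (auto simp: hom_def additive_def)
    moreover have "(\<forall>x\<in>carrier units_group. psi x = chi x * cis (2 * pi * h x)) \<longleftrightarrow> psi = twist chi h" for h
      using charactersD(4)[OF assms(2)] by (auto simp: twist_def extensional_def fun_eq_iff)
    ultimately show ?thesis by blast
  qed
  finally show ?thesis .
qed

text \<open>Both sides are pullbacks of the real extension along \<open>chi\<close> composed with
  the inverse of \<open>\<sigma>\<close>.\<close>

lemma act_ext_char_ext:
  assumes chi: "chi \<in> characters \<iota>" and \<sigma>: "\<sigma> \<in> Gal"
  shows "act_ext \<sigma> (char_ext chi) = char_ext (act_char \<sigma> chi)"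
proof -
  let ?s = "inv_into UNIV \<sigma>"
  let ?P = "pullback_extension units_group chi real_extension"
  have s: "?s \<in> Gal" using \<sigma> by (rule inv_into_galois_group)
  have s_hom: "?s \<in> hom units_group units_group"
    using s by (auto simp: hom_def galois_group_zero galois_group_iff)
  note P = is_extension_character[OF chi]
  have "ext_class units_group integer_group (pullback_extension units_group (act_char \<sigma> chi) real_extension)
      = ext_class units_group integer_group (pullback_extension units_group ?s ?P)"
    unfolding ext_class_eq_iff[OF groups(3,2) is_extension_character[OF act_char_characters[OF \<sigma> chi]]
        is_extension_pullback[OF groups(3,2) comm_group_units_group s_hom P]]
    by (rule ext_equiv_pullback_pullback)
      (use s in \<open>auto simp: galois_group_zero galois_group_iff act_char_def\<close>)
  then show ?thesis
    unfolding act_ext_def char_ext_eq[OF chi] char_ext_eq[OF act_char_characters[OF \<sigma> chi]]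
      ext_pullback_ext_class[OF groups(3,2) comm_group_units_group s_hom P]
    by simp
qed

lemma char_ext_Ext_exp:
  assumes chi: "chi \<in> characters \<iota>"
  shows "char_ext chi \<in> Ext_exp \<iota>"
proof -
  let ?P = "pullback_extension units_group chi real_extension"
  note P = is_extension_character[OF chi]
  have \<iota>_hom: "\<iota> \<in> hom roots_of_unity_group units_group"
    using emb_root_neq_0 emb_hom(2)[OF emb_root(1) emb_root(1)] unfolding hom_def by auto
  have "char_ext chi \<in> Ext units_group integer_group"
  proof -
    \<comment> \<open>\<open>Ext\<close> ranges over extensions on the type
      \<open>'a \<times> int\<close>; the pullback lives on another type and is replaced by an
      equivalent representative.\<close>
    obtain Y where "Y \<in> ext_class units_group integer_group ?P"
      using ext_class_nonempty[OF groups(3,2) P] by blast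
    then have Y: "is_extension units_group integer_group Y" "ext_equiv integer_group ?P Y"
      by (auto simp: ext_class_def)
    then have "char_ext chi = ext_class units_group integer_group Y"
      unfolding char_ext_eq[OF chi] ext_class_eq_iff[OF groups(3,2) P Y(1)] by blast
    then show ?thesis using Y(1) by (auto simp: Ext_def)
  qed
  moreover have "ext_pullback roots_of_unity_group integer_group \<iota> (char_ext chi) =
      ext_class roots_of_unity_group integer_group rat_extension"
  proof -
    \<comment> \<open>As \<open>chi \<circ> \<iota>\<close> is the identity on roots of unity, the
      one-step pullback \<open>?Q\<close> links the iterated one to the rational extension.\<close>
    let ?Q = "pullback_extension roots_of_unity_group (chi \<circ> \<iota>) real_extension"
    let ?R = "pullback_extension roots_of_unity_group \<iota> ?P"
    have R: "is_extension roots_of_unity_group integer_group ?R"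
      by (rule is_extension_pullback[OF groups(3,2) comm_group_roots_of_unity_group \<iota>_hom P])
    have hom: "chi \<circ> \<iota> \<in> hom roots_of_unity_group circle_group"
      using \<iota>_hom character_hom[OF chi] by (rule hom_compose)
    have Q: "is_extension roots_of_unity_group integer_group ?Q"
      by (rule is_extension_pullback[OF groups(1,2) comm_group_roots_of_unity_group hom
            is_extension_real_extension])
    have "ext_equiv integer_group ?Q ?R"
      by (rule ext_equiv_pullback_pullback)
        (use \<iota>_hom emb_hom(1) in \<open>auto simp: hom_def\<close>)
    moreover have "ext_equiv integer_group ?Q rat_extension"
      by (rule ext_equiv_rat_pullback) (simp add: charactersD(5)[OF chi] del: roots_of_unity_group_simps)
    ultimately have "ext_equiv integer_group ?R rat_extension"
      using ext_equiv_trans ext_equiv_sym[OF Q R] by blast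
    then show ?thesis
      unfolding char_ext_eq[OF chi]
        ext_pullback_ext_class[OF groups(3,2) comm_group_roots_of_unity_group \<iota>_hom P]
        ext_class_eq_iff[OF groups(4,2) R is_extension_rat_extension] .
  qed
  ultimately show ?thesis by (simp add: Ext_exp_def)
qed

end

section \<open>Monodromy\<close>

text \<open>Transport of structure through the bijection; for homotopy classes it takes the place of
  reparametrisation homotopies.\<close>

lemma group_of_iso:
  assumes "group H" and \<Phi>: "\<Phi> \<in> iso P H" and one: "\<one>\<^bsub>P\<^esub> \<in> carrier P" "\<Phi> \<one>\<^bsub>P\<^esub> = \<one>\<^bsub>H\<^esub>"
    and closed: "\<And>x y. x \<in> carrier P \<Longrightarrow> y \<in> carrier P \<Longrightarrow> x \<otimes>\<^bsub>P\<^esub> y \<in> carrier P"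
  shows "group P"
proof -
  interpret H: group H by fact
  have mult: "\<Phi> (x \<otimes>\<^bsub>P\<^esub> y) = \<Phi> x \<otimes>\<^bsub>H\<^esub> \<Phi> y" if "x \<in> carrier P" "y \<in> carrier P" for x y
    using \<Phi> that by (auto simp: iso_def hom_def)
  have inj: "inj_on \<Phi> (carrier P)" and im: "\<Phi> ` carrier P = carrier H"
    using \<Phi> by (auto simp: iso_def bij_betw_def)
  have c: "\<Phi> x \<in> carrier H" if "x \<in> carrier P" for x using im that by auto
  show ?thesis
  proof (rule groupI)
    show "\<exists>y\<in>carrier P. y \<otimes>\<^bsub>P\<^esub> x = \<one>\<^bsub>P\<^esub>" if x: "x \<in> carrier P" for x
    proof -
      have "inv\<^bsub>H\<^esub> (\<Phi> x) \<in> \<Phi> ` carrier P" using c[OF x] im by simp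
      then obtain y where y: "y \<in> carrier P" "\<Phi> y = inv\<^bsub>H\<^esub> (\<Phi> x)" by force
      have "y \<otimes>\<^bsub>P\<^esub> x = \<one>\<^bsub>P\<^esub>"
        by (rule inj_onD[OF inj]) (use x y c one closed in \<open>auto simp: mult\<close>)
      then show ?thesis using y(1) by blast
    qed
    show "\<one>\<^bsub>P\<^esub> \<otimes>\<^bsub>P\<^esub> x = x" if "x \<in> carrier P" for x
      by (rule inj_onD[OF inj]) (use that c one closed in \<open>auto simp: mult\<close>)
    show "x \<otimes>\<^bsub>P\<^esub> y \<otimes>\<^bsub>P\<^esub> z = x \<otimes>\<^bsub>P\<^esub> (y \<otimes>\<^bsub>P\<^esub> z)"
      if "x \<in> carrier P" "y \<in> carrier P" "z \<in> carrier P" for x y z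
      by (rule inj_onD[OF inj]) (use that c closed in \<open>auto simp: mult H.m_assoc\<close>)
  qed (use one closed in auto)
qed

locale pointed_cyclotomic_closure = cyclotomic_closure +
  fixes chi
  assumes chi: "chi \<in> characters \<iota>"
begin

abbreviation "base \<equiv> char_orbit F chi"
abbreviation "X \<equiv> orbit_space F \<iota>"
abbreviation "lift \<equiv> is_lift F \<iota> chi"
abbreviation "Stab \<equiv> stabilizer (galois_group F) act_ext (char_ext chi)"

section \<open>Lifts of loops and their endpoints\<close>

lemma loopsD:
  assumes "\<gamma> \<in> loops X base"
  shows "continuous_map (top_of_set {0..1}) X \<gamma>" "\<gamma> 0 = base" "\<gamma> 1 = base"
  using assms by (auto simp: loops_def pathin_def)

lemma ex_lift:
  assumes "\<gamma> \<in> loops X base" shows "\<exists>g. lift \<gamma> g"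
proof -
  have "chi \<in> \<gamma> 0" using char_orbit_self by (simp add: loopsD[OF assms])
  then obtain g where "continuous_map (top_of_set {0..1}) (character_space \<iota>) g" "g 0 = chi"
    "\<And>t. t \<in> {0..1} \<Longrightarrow> char_orbit F (g t) = \<gamma> t"
    using ex_character_lift[OF loopsD(1)[OF assms], of 0 chi] by auto
  then show ?thesis by (auto simp: is_lift_def pathin_def)
qed

lemma path_lift_unique:
  assumes "pathin (character_space \<iota>) g" "pathin (character_space \<iota>) h" "g 0 = h 0"
    and "\<And>t. t \<in> {0..1} \<Longrightarrow> char_orbit F (g t) = char_orbit F (h t)" and "t \<in> {0..1}"
  shows "g t = h t"
  using assms unfolding pathin_def
  by (intro character_lift_unique[of "{0..1}" g h 0 t]) auto

lemma lift_unique: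
  assumes "lift \<gamma> g" "lift \<gamma> h" "t \<in> {0..1}"
  shows "g t = h t"
  by (rule path_lift_unique[of g h t]) (use assms in \<open>auto simp: is_lift_def\<close>)

lemma lift_endpoint:
  assumes \<gamma>: "\<gamma> \<in> loops X base" and g: "lift \<gamma> g"
  shows "\<exists>!\<sigma>. \<sigma> \<in> Gal \<and> g 1 = act_char \<sigma> chi"
proof -
  have "char_orbit F (g 1) = base" using g loopsD(3)[OF \<gamma>] by (simp add: is_lift_def)
  then have "\<exists>\<sigma>. \<sigma> \<in> Gal \<and> g 1 = act_char \<sigma> chi"
    unfolding char_orbit_eq_iff mem_char_orbit_iff by blast
  moreover have "\<sigma> = \<tau>"
    if "\<sigma> \<in> Gal \<and> g 1 = act_char \<sigma> chi" "\<tau> \<in> Gal \<and> g 1 = act_char \<tau> chi" for \<sigma> \<tau>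
    using that by (intro act_char_free[OF chi]) auto
  ultimately show ?thesis by blast
qed

text \<open>The element that moves \<open>chi\<close> to the end of the lift, not yet inverted.
  Unique lifting and freeness justify \<open>THE\<close>.\<close>

definition monodromy :: "(real \<Rightarrow> ('a \<Rightarrow> complex) set) \<Rightarrow> 'a \<Rightarrow> 'a" where
  "monodromy \<gamma> = (THE \<sigma>. \<sigma> \<in> Gal \<and> (\<exists>g. lift \<gamma> g \<and> g 1 = act_char \<sigma> chi))"

lemma monodromy_eqI:
  assumes "lift \<gamma> g" "\<sigma> \<in> Gal" "g 1 = act_char \<sigma> chi"
  shows "monodromy \<gamma> = \<sigma>"
  unfolding monodromy_def
proof (rule the_equality)
  fix \<tau> assume "\<tau> \<in> Gal \<and> (\<exists>g. lift \<gamma> g \<and> g 1 = act_char \<tau> chi)"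
  then obtain h where h: "\<tau> \<in> Gal" "lift \<gamma> h" "h 1 = act_char \<tau> chi" by blast
  have "h 1 = g 1" using h(2) assms(1) by (rule lift_unique) simp
  then show "\<tau> = \<sigma>" using h assms act_char_free[OF chi] by metis
qed (use assms in blast)

lemma monodromyE:
  assumes "\<gamma> \<in> loops X base"
  obtains g where "lift \<gamma> g" "monodromy \<gamma> \<in> Gal" "g 1 = act_char (monodromy \<gamma>) chi"
proof -
  obtain g where g: "lift \<gamma> g" using ex_lift[OF assms] by blast
  then obtain \<sigma> where "\<sigma> \<in> Gal" "g 1 = act_char \<sigma> chi" using lift_endpoint[OF assms] by blast
  with g monodromy_eqI[OF g] show ?thesis using that by blast
qed

lemma stabilizer_iff:
  "\<sigma> \<in> Stab \<longleftrightarrow> \<sigma> \<in> Gal \<and> (\<exists>h. additive h \<and> act_char \<sigma> chi = twist chi h)"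
proof (cases "\<sigma> \<in> Gal")
  case True
  have "\<sigma> \<in> Stab \<longleftrightarrow> char_ext chi = char_ext (act_char \<sigma> chi)"
    using True by (auto simp: stabilizer_def act_ext_char_ext[OF chi])
  then show ?thesis using True char_ext_eq_iff[OF chi act_char_characters[OF True chi]] by simp
qed (simp add: stabilizer_def)

text \<open>\<open>act_ext_char_ext\<close> rewrites membership as a condition on
  \<open>act_char\<close>, whose composition law is available.\<close>

lemma subgroup_stabilizer: "subgroup Stab (galois_group F)"
proof (rule subgroup.intro)
  have Stab: "\<sigma> \<in> Stab \<longleftrightarrow> \<sigma> \<in> Gal \<and> char_ext (act_char \<sigma> chi) = char_ext chi" for \<sigma>
    by (cases "\<sigma> \<in> Gal") (simp_all add: stabilizer_def act_ext_char_ext[OF chi])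
  show "Stab \<subseteq> Gal" by (auto simp: Stab)
  show "\<one>\<^bsub>galois_group F\<^esub> \<in> Stab" by (simp add: Stab galois_group_iff)
  show "\<sigma> \<otimes>\<^bsub>galois_group F\<^esub> \<tau> \<in> Stab" if "\<sigma> \<in> Stab" "\<tau> \<in> Stab" for \<sigma> \<tau>
  proof -
    have \<sigma>: "\<sigma> \<in> Gal" "char_ext (act_char \<sigma> chi) = char_ext chi"
      and \<tau>: "\<tau> \<in> Gal" "char_ext (act_char \<tau> chi) = char_ext chi" using that by (auto simp: Stab)
    have "char_ext (act_char (\<sigma> \<circ> \<tau>) chi) = act_ext \<sigma> (char_ext (act_char \<tau> chi))"
      by (simp add: act_comp[OF \<sigma>(1) \<tau>(1)] act_ext_char_ext[OF act_char_characters[OF \<tau>(1) chi] \<sigma>(1)])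
    also have "\<dots> = char_ext chi" using \<sigma> \<tau> act_ext_char_ext[OF chi \<sigma>(1)] by simp
    finally show ?thesis using \<sigma>(1) \<tau>(1) by (simp add: Stab galois_group_comp)
  qed
  show "inv\<^bsub>galois_group F\<^esub> \<sigma> \<in> Stab" if "\<sigma> \<in> Stab" for \<sigma>
  proof -
    have \<sigma>: "\<sigma> \<in> Gal" "char_ext (act_char \<sigma> chi) = char_ext chi" using that by (auto simp: Stab)
    let ?i = "inv_into UNIV \<sigma>"
    have i: "?i \<in> Gal" using \<sigma>(1) by (rule inv_into_galois_group)
    have "char_ext (act_char ?i chi) = act_ext ?i (char_ext (act_char \<sigma> chi))"
      by (simp add: \<sigma>(2) act_ext_char_ext[OF chi i])
    also have "\<dots> = char_ext chi"
      by (simp add: act_ext_char_ext[OF act_char_characters[OF \<sigma>(1) chi] i] act_inv_cancel[OF \<sigma>(1)])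
    finally show ?thesis using i by (simp add: Stab inv_galois_group[OF \<sigma>(1)])
  qed
qed

text \<open>The logarithm of the lift at time 1 is the additive map asked for by
  \<open>stabilizer_iff\<close>.\<close>

lemma monodromy_stabilizer:
  assumes \<gamma>: "\<gamma> \<in> loops X base" shows "monodromy \<gamma> \<in> Stab"
proof -
  obtain g where g: "lift \<gamma> g" "monodromy \<gamma> \<in> Gal" "g 1 = act_char (monodromy \<gamma>) chi"
    using \<gamma> by (rule monodromyE)
  then have g': "pathin (character_space \<iota>) g" "g 0 = chi" by (auto simp: is_lift_def)
  obtain a where "\<And>t. t \<in> {0..1} \<Longrightarrow> additive (a t)" "\<And>t. t \<in> {0..1} \<Longrightarrow> g t = twist (g 0) (a t)"
    by (rule ex_character_log[OF g'(1)]) blast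
  from this[of 1] have "additive (a 1)" "g 1 = twist chi (a 1)" by (simp_all add: g'(2))
  then show ?thesis using g(2,3) unfolding stabilizer_iff by metis
qed

lemma projected_path_loop:
  assumes "pathin (character_space \<iota>) g" "g 0 = chi" "\<sigma> \<in> Gal" "g 1 = act_char \<sigma> chi"
    and "\<And>t. t \<in> {0..1} \<Longrightarrow> \<gamma> t = char_orbit F (g t)"
  shows "\<gamma> \<in> loops X base" "monodromy \<gamma> = \<sigma>"
proof -
  have "continuous_map (top_of_set {0..1}) X (char_orbit F \<circ> g)"
    using assms(1) continuous_map_char_orbit unfolding pathin_def by (rule continuous_map_compose)
  then have "pathin X \<gamma>"
    unfolding pathin_def by (rule continuous_map_eq) (simp add: assms(5))
  moreover have "char_orbit F (act_char \<sigma> chi) = base"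
    using assms(3) by (auto simp: char_orbit_eq_iff mem_char_orbit_iff)
  ultimately show "\<gamma> \<in> loops X base"
    using assms by (simp add: loops_def)
  show "monodromy \<gamma> = \<sigma>"
    using assms by (intro monodromy_eqI[of \<gamma> g]) (auto simp: is_lift_def)
qed

lemma monodromy_surj:
  assumes "\<sigma> \<in> Stab" obtains \<gamma> where "\<gamma> \<in> loops X base" "monodromy \<gamma> = \<sigma>"
proof -
  obtain h where \<sigma>: "\<sigma> \<in> Gal" and h: "additive h" "act_char \<sigma> chi = twist chi h"
    using assms by (auto simp: stabilizer_iff)
  \<comment> \<open>Scaling the logarithm linearly joins \<open>chi\<close> to its translate by
    \<open>\<sigma>\<close>.\<close>
  let ?g = "\<lambda>t. twist chi (\<lambda>x. t * h x)"
  have "pathin (character_space \<iota>) ?g"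
    unfolding pathin_def using h(1)
    by (intro continuous_map_twist[OF chi]) (auto simp: additive_def algebra_simps intro!: continuous_intros)
  moreover have "?g 0 = chi"
    using charactersD(4)[OF chi] by (auto simp: twist_def extensional_def fun_eq_iff)
  moreover have "?g 1 = act_char \<sigma> chi" using h by simp
  moreover note \<sigma>
  ultimately have "(\<lambda>t. char_orbit F (?g t)) \<in> loops X base" "monodromy (\<lambda>t. char_orbit F (?g t)) = \<sigma>"
    by (simp_all add: projected_path_loop[of ?g \<sigma>])
  then show ?thesis by (rule that)
qed

text \<open>The lift of \<open>\<gamma>\<close> that starts where the lift of
  \<open>\<delta>\<close> ends is the translate by \<open>monodromy \<delta>\<close> of the lift at
  \<open>chi\<close>. Hence the order is reversed: monodromy is an antihomomorphism.\<close>

lemma monodromy_loop_comp: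
  assumes \<gamma>: "\<gamma> \<in> loops X base" and \<delta>: "\<delta> \<in> loops X base"
  shows "loop_comp \<gamma> \<delta> \<in> loops X base" "monodromy (loop_comp \<gamma> \<delta>) = monodromy \<delta> \<circ> monodromy \<gamma>"
proof -
  obtain g where g: "lift \<gamma> g" "monodromy \<gamma> \<in> Gal" "g 1 = act_char (monodromy \<gamma>) chi"
    using \<gamma> by (rule monodromyE)
  obtain h where h: "lift \<delta> h" "monodromy \<delta> \<in> Gal" "h 1 = act_char (monodromy \<delta>) chi"
    using \<delta> by (rule monodromyE)
  let ?\<sigma> = "monodromy \<delta>"
  let ?k = "\<lambda>t. if t \<le> 1/2 then h (2 * t) else act_char ?\<sigma> (g (2 * t - 1))"
  have g': "g 0 = chi" "\<And>t. t \<in> {0..1} \<Longrightarrow> char_orbit F (g t) = \<gamma> t"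
    "\<And>t. t \<in> {0..1} \<Longrightarrow> g t \<in> characters \<iota>" "\<And>x. x \<noteq> 0 \<Longrightarrow> continuous_on {0..1} (\<lambda>t. g t x)"
    using g(1) unfolding is_lift_def pathin_def continuous_map_character_space by auto
  have h': "h 0 = chi" "\<And>t. t \<in> {0..1} \<Longrightarrow> char_orbit F (h t) = \<delta> t"
    "\<And>t. t \<in> {0..1} \<Longrightarrow> h t \<in> characters \<iota>" "\<And>x. x \<noteq> 0 \<Longrightarrow> continuous_on {0..1} (\<lambda>t. h t x)"
    using h(1) unfolding is_lift_def pathin_def continuous_map_character_space by auto
  have k: "pathin (character_space \<iota>) ?k"
    unfolding pathin_def continuous_map_character_space
  proof (intro conjI ballI allI impI)
    show "?k t \<in> characters \<iota>" if "t \<in> topspace (top_of_set {0..1})" for t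
      using that g'(3) h'(3) act_char_characters[OF h(2)] by auto
    fix x :: 'a assume x: "x \<noteq> 0"
    let ?y = "inv_into UNIV ?\<sigma> x"
    have y: "?y \<noteq> 0" using x galois_group_zero(2)[OF inv_into_galois_group[OF h(2)]] by simp
    have "continuous_on {0..1} (\<lambda>t. if t \<le> 1/2 then h (2 * t) x else g (2 * t - 1) ?y)"
    proof (rule continuous_on_cases_le)
      show "continuous_on {t \<in> {0..1}. t \<le> 1/2} (\<lambda>t. h (2 * t) x)"
        by (rule continuous_on_compose2[OF h'(4)[OF x]]) (auto intro!: continuous_intros)
      show "continuous_on {t \<in> {0..1}. 1/2 \<le> t} (\<lambda>t. g (2 * t - 1) ?y)"
        by (rule continuous_on_compose2[OF g'(4)[OF y]]) (auto intro!: continuous_intros)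
      fix t :: real assume "t = 1/2"
      then have "2 * t = 1" "2 * t - 1 = 0" by simp_all
      then show "h (2 * t) x = g (2 * t - 1) ?y" by (simp only: h(3) g'(1) act_char_def comp_apply)
    qed (auto intro: continuous_intros)
    then have "continuous_on {0..1} (\<lambda>t. ?k t x)"
      by (rule continuous_on_eq) (simp add: act_char_def)
    then show "continuous_map (top_of_set {0..1}) euclidean (\<lambda>t. ?k t x)" by simp
  qed
  have k0: "?k 0 = chi" by (simp add: h'(1))
  have comp: "?\<sigma> \<circ> monodromy \<gamma> \<in> Gal" using g(2) h(2) by (rule galois_group_comp[rotated])
  have k1: "?k 1 = act_char (?\<sigma> \<circ> monodromy \<gamma>) chi"
    by (simp add: g(3) act_comp[OF h(2) g(2)])
  have "char_orbit F (act_char ?\<sigma> psi) = char_orbit F psi" for psi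
    using h(2) by (auto simp: char_orbit_eq_iff mem_char_orbit_iff)
  then have orb: "loop_comp \<gamma> \<delta> t = char_orbit F (?k t)" if "t \<in> {0..1}" for t
    using that g'(2)[of "2 * t - 1"] h'(2)[of "2 * t"] by (auto simp: loop_comp_def)
  show "loop_comp \<gamma> \<delta> \<in> loops X base" "monodromy (loop_comp \<gamma> \<delta>) = ?\<sigma> \<circ> monodromy \<gamma>"
    using projected_path_loop[OF k k0 comp k1 orb] by blast+
qed

text \<open>A homotopy of loops lifts to the square; its two vertical sides lift constant paths, hence
  are constant.\<close>

lemma homotopic_imp_monodromy_eq:
  assumes \<gamma>: "\<gamma> \<in> loops X base" and \<delta>: "\<delta> \<in> loops X base"
    and hom: "homotopic_with (\<lambda>p. p 0 = base \<and> p 1 = base) (top_of_set {0..1}) X \<gamma> \<delta>"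
  shows "monodromy \<gamma> = monodromy \<delta>"
proof -
  let ?I = "{0..1::real}"
  obtain H where H: "continuous_map (top_of_set (?I \<times> ?I)) X H"
    "\<And>t. H (0, t) = \<gamma> t" "\<And>t. H (1, t) = \<delta> t"
    "\<And>s. s \<in> ?I \<Longrightarrow> H (s, 0) = base" "\<And>s. s \<in> ?I \<Longrightarrow> H (s, 1) = base"
    using hom unfolding homotopic_with_def by auto
  have "chi \<in> H (0, 0)" using H(4)[of 0] char_orbit_self by simp
  then obtain K where K: "continuous_map (top_of_set (?I \<times> ?I)) (character_space \<iota>) K" "K (0, 0) = chi"
    "\<And>w. w \<in> ?I \<times> ?I \<Longrightarrow> char_orbit F (K w) = H w"
    using ex_character_lift[OF H(1), of "(0, 0)" chi] by (auto simp: compact_Times convex_Times)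
  have side: "pathin (character_space \<iota>) (\<lambda>t. K (f t))"
    if "continuous_on ?I f" "f ` ?I \<subseteq> ?I \<times> ?I" for f
  proof -
    have "continuous_map (top_of_set ?I) (top_of_set (?I \<times> ?I)) f"
      using that by (auto simp: continuous_map_in_subtopology)
    then have "continuous_map (top_of_set ?I) (character_space \<iota>) (K \<circ> f)"
      using K(1) by (rule continuous_map_compose)
    then show ?thesis unfolding pathin_def o_def .
  qed
  have const: "pathin (character_space \<iota>) (\<lambda>_. psi)" if "psi \<in> characters \<iota>" for psi
    using that by (simp add: topspace_character_space)
  have K_char: "K w \<in> characters \<iota>" if "w \<in> ?I \<times> ?I" for w
    using K(1) that unfolding continuous_map_character_space by auto
  have vert: "K (s, c) = K (0, c)" if s: "s \<in> ?I" and c: "c = 0 \<or> c = 1" for s c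
  proof (rule path_lift_unique[of "\<lambda>s. K (s, c)" "\<lambda>_. K (0, c)", OF _ _ _ _ s])
    show "pathin (character_space \<iota>) (\<lambda>s. K (s, c))"
      by (rule side) (use c in \<open>auto intro!: continuous_intros\<close>)
    show "pathin (character_space \<iota>) (\<lambda>_. K (0, c))"
      by (rule const, rule K_char) (use c in auto)
    show "char_orbit F (K (t, c)) = char_orbit F (K (0, c))" if "t \<in> ?I" for t
      using K(3)[of "(t, c)"] K(3)[of "(0, c)"] H(4,5)[of t] H(4,5)[of 0] that c by auto
  qed simp
  have hor: "pathin (character_space \<iota>) (\<lambda>t. K (s, t))" if "s \<in> ?I" for s
    by (rule side) (use that in \<open>auto intro!: continuous_intros\<close>)
  have "lift \<gamma> (\<lambda>t. K (0, t))"
    using hor[of 0] K(2) K(3)[of "(0, _)"] H(2) by (simp add: is_lift_def)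
  moreover have l: "lift \<delta> (\<lambda>t. K (1, t))"
    using hor[of 1] K(2) vert[of 1 0] K(3)[of "(1, _)"] H(3) by (simp add: is_lift_def)
  moreover obtain g where g: "lift \<gamma> g" "monodromy \<gamma> \<in> Gal" "g 1 = act_char (monodromy \<gamma>) chi"
    using \<gamma> by (rule monodromyE)
  ultimately have "K (0, 1) = act_char (monodromy \<gamma>) chi"
    using lift_unique[of \<gamma> "\<lambda>t. K (0, t)" g 1] by simp
  then have "monodromy \<delta> = monodromy \<gamma>"
    using vert[of 1 1] by (intro monodromy_eqI[OF l g(2)]) simp
  then show ?thesis by simp
qed

text \<open>Lifts with the same endpoints have logarithms with the same endpoints, and these can be
  joined by line segments.\<close>

lemma monodromy_eq_imp_homotopic:
  assumes \<gamma>: "\<gamma> \<in> loops X base" and \<delta>: "\<delta> \<in> loops X base" and eq: "monodromy \<gamma> = monodromy \<delta>"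
  shows "homotopic_with (\<lambda>p. p 0 = base \<and> p 1 = base) (top_of_set {0..1}) X \<gamma> \<delta>"
proof -
  let ?I = "{0..1::real}"
  obtain g where g: "lift \<gamma> g" "monodromy \<gamma> \<in> Gal" "g 1 = act_char (monodromy \<gamma>) chi"
    using \<gamma> by (rule monodromyE)
  obtain h where h: "lift \<delta> h" "h 1 = act_char (monodromy \<delta>) chi"
    using \<delta> by (rule monodromyE)
  have g': "pathin (character_space \<iota>) g" "g 0 = chi" "\<And>t. t \<in> ?I \<Longrightarrow> char_orbit F (g t) = \<gamma> t"
    using g(1) by (auto simp: is_lift_def)
  have h': "pathin (character_space \<iota>) h" "h 0 = chi" "\<And>t. t \<in> ?I \<Longrightarrow> char_orbit F (h t) = \<delta> t"
    using h(1) by (auto simp: is_lift_def)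
  obtain a where a: "\<And>x. x \<noteq> 0 \<Longrightarrow> continuous_on ?I (\<lambda>t. a t x)" "\<And>x. a 0 x = 0"
    "\<And>t. t \<in> ?I \<Longrightarrow> additive (a t)" "\<And>t. t \<in> ?I \<Longrightarrow> g t = twist chi (a t)"
    by (rule ex_character_log[OF g'(1), unfolded g'(2)]) (rule that)
  obtain b where b: "\<And>x. x \<noteq> 0 \<Longrightarrow> continuous_on ?I (\<lambda>t. b t x)" "\<And>x. b 0 x = 0"
    "\<And>t. t \<in> ?I \<Longrightarrow> additive (b t)" "\<And>t. t \<in> ?I \<Longrightarrow> h t = twist chi (b t)"
    by (rule ex_character_log[OF h'(1), unfolded h'(2)]) (rule that)
  \<comment> \<open>Equal monodromy gives equal characters at the end; by divisibility the
    logarithms agree there exactly, not just modulo integers.\<close>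
  have ab: "a 1 x = b 1 x" if "x \<noteq> 0" for x
    using twist_eq_imp_eq[OF chi a(3) b(3) _ that, of 1 1] a(4)[of 1] b(4)[of 1] g(3) h(2) eq by simp
  define m where "m = (\<lambda>(s, t) x. (1 - s) * a t x + s * b t x)"
  have m_add: "additive (m w)" if "w \<in> ?I \<times> ?I" for w
    using that a(3) b(3) by (auto simp: m_def additive_def algebra_simps)
  have m_cont: "continuous_on (?I \<times> ?I) (\<lambda>w. m w x)" if "x \<noteq> 0" for x
  proof -
    have "continuous_on (?I \<times> ?I) (\<lambda>w. a (snd w) x)" "continuous_on (?I \<times> ?I) (\<lambda>w. b (snd w) x)"
      using a(1)[OF that] b(1)[OF that]
      by (auto intro!: continuous_intros elim!: continuous_on_compose2)
    then show ?thesis by (auto simp: m_def case_prod_unfold intro!: continuous_intros)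
  qed
  have "continuous_map (top_of_set (?I \<times> ?I)) X (char_orbit F \<circ> (\<lambda>w. twist chi (m w)))"
    by (rule continuous_map_compose[OF continuous_map_twist[OF chi m_add m_cont] continuous_map_char_orbit])
  moreover have "twist chi (m (0, t)) = g t" "twist chi (m (1, t)) = h t" if "t \<in> ?I" for t
    by (simp_all add: m_def a(4)[OF that] b(4)[OF that])
  moreover have "twist chi (m (s, 0)) = g 0" for s
  proof -
    have "m (s, 0) = a 0" by (simp add: m_def fun_eq_iff a(2) b(2))
    then show ?thesis using a(4)[of 0] by simp
  qed
  moreover have "twist chi (m (s, 1)) = g 1" for s
  proof -
    have "m (s, 1) x = a 1 x" if "x \<noteq> 0" for x using ab[OF that] by (simp add: m_def algebra_simps)
    then show ?thesis using a(4)[of 1] by (auto simp: twist_def)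
  qed
  moreover have "char_orbit F (g 0) = base" "char_orbit F (g 1) = base"
    using g'(3)[of 0] g'(3)[of 1] loopsD[OF \<gamma>] by auto
  ultimately show ?thesis
    using g'(3) h'(3) by (subst homotopic_with) (auto intro!: exI[of _ "char_orbit F \<circ> (\<lambda>w. twist chi (m w))"])
qed

section \<open>Homotopy classes as fibres of monodromy, and the isomorphism\<close>

lemma loop_class_eq:
  assumes "\<gamma> \<in> loops X base"
  shows "loop_class X base \<gamma> = {\<delta> \<in> loops X base. monodromy \<delta> = monodromy \<gamma>}"
proof -
  have "homotopic_with (\<lambda>p. p 0 = base \<and> p 1 = base) (top_of_set {0..1}) X \<gamma> \<delta> \<longleftrightarrow>
      monodromy \<delta> = monodromy \<gamma>" if "\<delta> \<in> loops X base" for \<delta>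
    by (rule iffI, erule homotopic_imp_monodromy_eq[OF assms that, symmetric],
        rule monodromy_eq_imp_homotopic[OF assms that], erule sym)
  then show ?thesis unfolding loop_class_def by blast
qed

text \<open>The product is a union over all pairs of representatives. They yield a single class
  because the monodromy of the composite depends only on those of the factors.\<close>

lemma loop_class_mult:
  assumes \<gamma>: "\<gamma> \<in> loops X base" and \<delta>: "\<delta> \<in> loops X base"
  shows "loop_class X base \<gamma> \<otimes>\<^bsub>fundamental_group X base\<^esub> loop_class X base \<delta> =
    loop_class X base (loop_comp \<gamma> \<delta>)"
proof -
  let ?c = "loop_class X base \<gamma>" and ?d = "loop_class X base \<delta>" and ?e = "loop_class X base (loop_comp \<gamma> \<delta>)"
  have eq: "loop_class X base (loop_comp \<gamma>' \<delta>') = ?e" if "\<gamma>' \<in> ?c" "\<delta>' \<in> ?d" for \<gamma>' \<delta>'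
    using that \<gamma> \<delta> by (simp add: loop_class_eq monodromy_loop_comp)
  have ne: "\<gamma> \<in> ?c" "\<delta> \<in> ?d"
    using \<gamma> \<delta> by (simp_all add: loop_class_eq)
  have "(\<Union>\<gamma>'\<in>?c. \<Union>\<delta>'\<in>?d. loop_class X base (loop_comp \<gamma>' \<delta>')) = (\<Union>\<gamma>'\<in>?c. \<Union>\<delta>'\<in>?d. ?e)"
    by (intro SUP_cong refl eq)
  also have "\<dots> = ?e" using ne by blast
  finally show ?thesis unfolding fundamental_group_def by simp
qed

theorem fundamental_group_iso_stabilizer:
  defines "P \<equiv> fundamental_group X base"
    and "H \<equiv> (galois_group F)\<lparr>carrier := Stab\<rparr>"
  obtains \<Phi> where "\<Phi> \<in> iso P H" "group P" "group H"
    "\<And>\<gamma>. \<gamma> \<in> loops X base \<Longrightarrow> \<Phi> (loop_class X base \<gamma>) = inv\<^bsub>galois_group F\<^esub> (monodromy \<gamma>)"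
proof -
  let ?L = "loops X base" and ?G = "galois_group F"
  interpret G: group ?G by (rule group_galois_group)
  have H: "group H"
    unfolding H_def using subgroup_stabilizer group_galois_group by (rule subgroup.subgroup_is_group)
  have mG: "monodromy \<gamma> \<in> Gal" if "\<gamma> \<in> ?L" for \<gamma> using monodromyE[OF that] by blast
  \<comment> \<open>Any representative serves, since all loops of a class have the same
    monodromy.\<close>
  define \<Phi> where "\<Phi> c = inv\<^bsub>?G\<^esub> (monodromy (SOME \<gamma>. \<gamma> \<in> c))" for c
  have \<Phi>: "\<Phi> (loop_class X base \<gamma>) = inv\<^bsub>?G\<^esub> (monodromy \<gamma>)" if "\<gamma> \<in> ?L" for \<gamma>
  proof -
    have "\<gamma> \<in> loop_class X base \<gamma>" using that by (simp add: loop_class_eq)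
    then have "\<exists>\<delta>. \<delta> \<in> loop_class X base \<gamma>" by blast
    then have "(SOME \<delta>. \<delta> \<in> loop_class X base \<gamma>) \<in> loop_class X base \<gamma>" by (rule someI_ex)
    then show ?thesis using that by (simp add: \<Phi>_def loop_class_eq)
  qed
  have carP: "carrier P = loop_class X base ` ?L" by (simp add: P_def fundamental_group_def)
  have mult: "loop_class X base \<gamma> \<otimes>\<^bsub>P\<^esub> loop_class X base \<delta> = loop_class X base (loop_comp \<gamma> \<delta>)"
    if "\<gamma> \<in> ?L" "\<delta> \<in> ?L" for \<gamma> \<delta>
    using loop_class_mult[OF that] by (simp add: P_def)
  have iso: "\<Phi> \<in> iso P H"
  proof (rule isoI)
    show "\<Phi> \<in> hom P H"
    proof (rule homI)
      fix c assume "c \<in> carrier P"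
      then show "\<Phi> c \<in> carrier H"
        using subgroup.m_inv_closed[OF subgroup_stabilizer monodromy_stabilizer] by (auto simp: carP \<Phi> H_def)
    next
      fix c d assume "c \<in> carrier P" "d \<in> carrier P"
      then obtain \<gamma> \<delta> where cd: "\<gamma> \<in> ?L" "\<delta> \<in> ?L" "c = loop_class X base \<gamma>" "d = loop_class X base \<delta>"
        by (auto simp: carP)
      \<comment> \<open>Inversion undoes the order reversal of
        \<open>monodromy_loop_comp\<close>.\<close>
      have "\<Phi> (c \<otimes>\<^bsub>P\<^esub> d) = inv\<^bsub>?G\<^esub> (monodromy \<delta> \<otimes>\<^bsub>?G\<^esub> monodromy \<gamma>)"
        using cd by (simp add: mult \<Phi> monodromy_loop_comp)
      also have "\<dots> = inv\<^bsub>?G\<^esub> (monodromy \<gamma>) \<otimes>\<^bsub>?G\<^esub> inv\<^bsub>?G\<^esub> (monodromy \<delta>)"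
        using cd mG by (intro G.inv_mult_group)
      finally show "\<Phi> (c \<otimes>\<^bsub>P\<^esub> d) = \<Phi> c \<otimes>\<^bsub>H\<^esub> \<Phi> d" using cd by (simp add: \<Phi> H_def)
    qed
    show "bij_betw \<Phi> (carrier P) (carrier H)"
      unfolding bij_betw_def
    proof
      show "inj_on \<Phi> (carrier P)"
      proof (rule inj_onI)
        fix c d assume "c \<in> carrier P" "d \<in> carrier P" and eq: "\<Phi> c = \<Phi> d"
        then obtain \<gamma> \<delta> where cd: "\<gamma> \<in> ?L" "\<delta> \<in> ?L" "c = loop_class X base \<gamma>" "d = loop_class X base \<delta>"
          by (auto simp: carP)
        then have "inv\<^bsub>?G\<^esub> (monodromy \<gamma>) = inv\<^bsub>?G\<^esub> (monodromy \<delta>)" using eq by (simp add: \<Phi>)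
        then have "monodromy \<gamma> = monodromy \<delta>" using mG cd by (metis G.inv_inv)
        then show "c = d" using cd by (simp add: loop_class_eq)
      qed
      show "\<Phi> ` carrier P = carrier H"
      proof (intro equalityI subsetI)
        fix \<sigma> assume "\<sigma> \<in> \<Phi> ` carrier P"
        then show "\<sigma> \<in> carrier H"
          using subgroup.m_inv_closed[OF subgroup_stabilizer monodromy_stabilizer] by (auto simp: carP \<Phi> H_def)
      next
        fix \<sigma> assume "\<sigma> \<in> carrier H"
        then have \<sigma>: "\<sigma> \<in> Stab" by (simp add: H_def)
        obtain \<gamma> where \<gamma>: "\<gamma> \<in> ?L" "monodromy \<gamma> = inv\<^bsub>?G\<^esub> \<sigma>"
          using monodromy_surj[OF subgroup.m_inv_closed[OF subgroup_stabilizer \<sigma>]] by blast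
        then have "\<Phi> (loop_class X base \<gamma>) = \<sigma>"
          using G.inv_inv[OF subgroup.mem_carrier[OF subgroup_stabilizer \<sigma>]] by (simp add: \<Phi>)
        then show "\<sigma> \<in> \<Phi> ` carrier P" using \<gamma>(1) by (auto simp: carP)
      qed
    qed
  qed
  \<comment> \<open>The constant path at \<open>chi\<close> lifts the constant loop, so the neutral
    class goes to the identity.\<close>
  have const: "(\<lambda>_. base) \<in> ?L" "monodromy (\<lambda>_. base) = id"
    using projected_path_loop[of "\<lambda>_. chi" id "\<lambda>_. base"] chi
    by (auto simp: topspace_character_space galois_group_iff)
  have "group P"
  proof (rule group_of_iso[OF H iso])
    have one: "\<one>\<^bsub>P\<^esub> = loop_class X base (\<lambda>_. base)" by (simp add: P_def fundamental_group_def)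
    show "\<one>\<^bsub>P\<^esub> \<in> carrier P" using const(1) by (simp add: one carP)
    show "\<Phi> \<one>\<^bsub>P\<^esub> = \<one>\<^bsub>H\<^esub>"
      using const G.inv_one by (simp add: one \<Phi> H_def)
    show "c \<otimes>\<^bsub>P\<^esub> d \<in> carrier P" if "c \<in> carrier P" "d \<in> carrier P" for c d
      using that monodromy_loop_comp(1) by (auto simp: carP mult)
  qed
  with iso H \<Phi> show ?thesis using that by blast
qed

end

theorem proposition6p14:
  fixes F :: "'a::field set" and \<iota> :: "complex \<Rightarrow> 'a" and chi :: "'a \<Rightarrow> complex"
  assumes "algebraic_closure (ring_of_type_algebra :: 'a ring) F"
    and "\<iota> \<in> ring_hom cyclotomic_field (ring_of_type_algebra\<lparr>carrier := F\<rparr>)"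
    and "chi \<in> characters \<iota>"
  defines "\<epsilon> \<equiv> char_ext chi"
    and "G \<equiv> galois_group F"
    and "P \<equiv> fundamental_group (orbit_space F \<iota>) (char_orbit F chi)"
    and "L \<equiv> loops (orbit_space F \<iota>) (char_orbit F chi)"
  defines "S \<equiv> G\<lparr>carrier := stabilizer G act_ext \<epsilon>\<rparr>"
  shows "\<epsilon> \<in> Ext_exp \<iota> \<and>
         (\<forall>\<gamma>\<in>L. (\<exists>g. is_lift F \<iota> chi \<gamma> g) \<and>
               (\<forall>g h. is_lift F \<iota> chi \<gamma> g \<longrightarrow> is_lift F \<iota> chi \<gamma> h \<longrightarrow> (\<forall>t\<in>{0..1}. g t = h t)) \<and>
               (\<forall>g. is_lift F \<iota> chi \<gamma> g \<longrightarrow> (\<exists>!\<sigma>. \<sigma> \<in> carrier G \<and> g 1 = act_char \<sigma> chi))) \<and>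
         group P \<and> group S \<and>
         (\<exists>\<Phi> \<in> iso P S. \<forall>\<gamma>\<in>L. \<forall>g \<sigma>.
            is_lift F \<iota> chi \<gamma> g \<and> \<sigma> \<in> carrier G \<and> g 1 = act_char \<sigma> chi \<longrightarrow>
            \<Phi> (loop_class (orbit_space F \<iota>) (char_orbit F chi) \<gamma>) = inv\<^bsub>G\<^esub> \<sigma>)"
proof -
  interpret pointed_cyclotomic_closure F \<iota> chi
    using assms(1-3) by (simp add: pointed_cyclotomic_closure_def cyclotomic_closure_def
        pointed_cyclotomic_closure_axioms_def)
  obtain \<Phi> where \<Phi>: "\<Phi> \<in> iso (fundamental_group X base) ((galois_group F)\<lparr>carrier := Stab\<rparr>)"
    "group (fundamental_group X base)" "group ((galois_group F)\<lparr>carrier := Stab\<rparr>)"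
    "\<And>\<gamma>. \<gamma> \<in> loops X base \<Longrightarrow> \<Phi> (loop_class X base \<gamma>) = inv\<^bsub>galois_group F\<^esub> (monodromy \<gamma>)"
    by (rule fundamental_group_iso_stabilizer) (rule that)
  show ?thesis
    unfolding S_def P_def L_def G_def \<epsilon>_def
  proof (intro conjI ballI allI impI)
    show "char_ext chi \<in> Ext_exp \<iota>" by (rule char_ext_Ext_exp[OF chi])
    show "group (fundamental_group X base)" "group ((galois_group F)\<lparr>carrier := Stab\<rparr>)" by fact+
    show "\<exists>g. lift \<gamma> g" if "\<gamma> \<in> loops X base" for \<gamma> using that by (rule ex_lift)
    show "g t = h t" if "lift \<gamma> g" "lift \<gamma> h" "t \<in> {0..1}" for \<gamma> g h t
      using that by (rule lift_unique)
    show "\<exists>!\<sigma>. \<sigma> \<in> Gal \<and> g 1 = act_char \<sigma> chi" if "\<gamma> \<in> loops X base" "lift \<gamma> g" for \<gamma> g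
      using that by (rule lift_endpoint)
    show "\<exists>\<Phi> \<in> iso (fundamental_group X base) ((galois_group F)\<lparr>carrier := Stab\<rparr>).
        \<forall>\<gamma>\<in>loops X base. \<forall>g \<sigma>. lift \<gamma> g \<and> \<sigma> \<in> Gal \<and> g 1 = act_char \<sigma> chi \<longrightarrow>
          \<Phi> (loop_class X base \<gamma>) = inv\<^bsub>galois_group F\<^esub> \<sigma>"
    proof (intro bexI[OF _ \<Phi>(1)] ballI allI impI)
      fix \<gamma> g \<sigma>
      assume \<gamma>: "\<gamma> \<in> loops X base" and "lift \<gamma> g \<and> \<sigma> \<in> Gal \<and> g 1 = act_char \<sigma> chi"
      then have "lift \<gamma> g" "\<sigma> \<in> Gal" "g 1 = act_char \<sigma> chi" by auto
      \<comment> \<open>Any lift \<open>g\<close> and any \<open>\<sigma>\<close> describing its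
        endpoint give the same element, so the quantified pair reduces to
        \<open>monodromy \<gamma>\<close>.\<close>
      then have "monodromy \<gamma> = \<sigma>" by (rule monodromy_eqI)
      then show "\<Phi> (loop_class X base \<gamma>) = inv\<^bsub>galois_group F\<^esub> \<sigma>" using \<Phi>(4)[OF \<gamma>] by simp
    qed
  qed
qed

end
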